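(* Consider the global-local prior model with tuning parameter $\tau_n$ described in the context, with $a>0$, a slowly varying function $\ell$ that is non-decreasing with $0<m\le \ell(u)\le M<\infty$ for all $u$, and a fixed matrix $\boldsymbol{\Sigma}$ with $0<\lambda_{\min}(\boldsymbol{\Sigma})\le\lambda_{\max}(\boldsymbol{\Sigma})<\infty$. Let $(q_n)$ be positive integers with $q_n=o(n)$, and let $\tau_n=(q_n/n)^{(1+\epsilon_n)/a}$ with $\epsilon_n=1/\log(\log(n/q_n))$ (for $n$ large). Then $$\lim_{n\to\infty}\ \sup_{\{\boldsymbol{\theta}_{0i}\}\in L_0[q_n]}\ \frac{\sum_{i:\boldsymbol{\theta}_{0i}=\boldsymbol{0}}E_{\boldsymbol{0}}\lVert\widehat{\boldsymbol{\theta}}^R_i\rVert_\Sigma^2}{q_n\log(n/q_n)}=0$$ and $$\limsup_{n\to\infty}\ \sup_{\{\boldsymbol{\theta}_{0i}\}\in L_0[q_n]}\ \frac{\sum_{i:\boldsymbol{\theta}_{0i}\neq\boldsymbol{0}}E_{\boldsymbol{\theta}_{0i}}\lVert\widehat{\boldsymbol{\theta}}^R_i-\boldsymbol{\theta}_{0i}\rVert_\Sigma^2}{2q_n\log(n/q_n)}\le 1.$$ Consequently, $$\limsup_{n\to\infty}\ \sup_{\{\boldsymbol{\theta}_{0i}\}\in L_0[q_n]}\ \frac{\sum_{i=1}^nE_{\boldsymbol{\theta}_{0i}}\lVert\widehat{\boldsymbol{\theta}}^R_i-\boldsymbol{\theta}_{0i}\rVert_\Sigma^2}{2q_n\log(n/q_n)}\le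 1,$$ and in fact $$\lim_{n\to\infty}\ \sup_{\{\boldsymbol{\theta}_{0i}\}\in L_0[q_n]}\ \frac{\sum_{i=1}^nE_{\boldsymbol{\theta}_{0i}}\lVert\widehat{\boldsymbol{\theta}}^R_i-\boldsymbol{\theta}_{0i}\rVert_\Sigma^2}{2q_n\log(n/q_n)}=1.$$
   Context: Model (dimension $k\ge1$ fixed): (i) $\boldsymbol{X}_i\mid\boldsymbol{\theta}_i\sim N_k(\boldsymbol{\theta}_i,\boldsymbol{\Sigma})$ independently, $i=1,\dots,n$, with $\boldsymbol{\Sigma}$ known positive definite; (ii) $\boldsymbol{\theta}_i\mid\lambda_i^2\sim N_k(\boldsymbol{0},\lambda_i^2\tau_n\boldsymbol{\Sigma})$ independently, where $\tau_n\in(0,1)$ is a sequence of positive constants, $\tau_n\to0$; (iii) $\lambda_1^2,\dots,\lambda_n^2$ are independent with density $\pi(\lambda_i^2)=K(\lambda_i^2)^{-a-1}\ell(\lambda_i^2)$ on $(0,\infty)$, $K>0$ a constant. The estimator is the posterior mean $\widehat{\boldsymbol{\theta}}^R_i=E(\boldsymbol{\theta}_i\mid\boldsymbol{X}_i)=E(1-\kappa_i\mid\boldsymbol{X}_i)\boldsymbol{X}_i$, with shrinkage factor $\kappa_i=(1+\lambda_i^2\tau_n)^{-1}$. Mahalanobis norm: $\lVert\boldsymbol{x}\rVert_\Sigma^2=\boldsymbol{x}^T\boldsymbol{\Sigma}^{-1}\boldsymbol{x}$. Nearly-black means: $L_0[q_n]=\{\{\boldsymbol{\theta}_{0i}\}_{i=1}^n:\boldsymbol{\theta}_{0i}\in\mathbb{R}^k,\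 \sum_{i=1}^n\mathbf{1}(\boldsymbol{\theta}_{0i}\ne\boldsymbol{0})\le q_n\}$. $E_{\boldsymbol{\theta}_{0i}}$ denotes expectation when $\boldsymbol{X}_i\sim N_k(\boldsymbol{\theta}_{0i},\boldsymbol{\Sigma})$. $\lambda_{\min},\lambda_{\max}$ are the smallest and largest eigenvalues.
   Formalization: The bound 0<m≤ℓ(u), which for all u>0 is incompatible with a proper prior density, is required only for u above some u0≥0; when u0>0 the exponent is restricted to 0<a≤2, since the first limit fails for a>2. *)

theory Defs
  imports "HOL-Probability.Probability" "HOL-Library.Landau_Symbols"
begin

definition positive_definite :: "real^'k^'k \<Rightarrow> bool" where
  "positive_definite S \<longleftrightarrow> transpose S = S \<and> (\<forall>x. x \<noteq> 0 \<longrightarrow> 0 < x \<bullet> (S *v x))"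

definition eigenvalues :: "real^'k^'k \<Rightarrow> real set" where
  "eigenvalues S = {c. \<exists>v. v \<noteq> 0 \<and> S *v v = c *\<^sub>R v}"

(* Used for symmetric matrices only, whose set of real eigenvalues is finite and nonempty. *)
definition lambda_min :: "real^'k^'k \<Rightarrow> real" where
  "lambda_min S = Min (eigenvalues S)"

definition lambda_max :: "real^'k^'k \<Rightarrow> real" where
  "lambda_max S = Max (eigenvalues S)"

definition mahalanobis_sq :: "real^'k^'k \<Rightarrow> real^'k \<Rightarrow> real" where
  "mahalanobis_sq S x = x \<bullet> (matrix_inv S *v x)"

definition mvn_density :: "real^'k \<Rightarrow> real^'k^'k \<Rightarrow> real^'k \<Rightarrow> real" where
  "mvn_density \<mu> S x =
     exp (- mahalanobis_sq S (x - \<mu>) / 2) / sqrt ((2 * pi) ^ CARD('k) * det S)"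

definition mvn :: "real^'k \<Rightarrow> real^'k^'k \<Rightarrow> (real^'k) measure" where
  "mvn \<mu> S = density lborel (\<lambda>x. ennreal (mvn_density \<mu> S x))"

(* Expectation of a nonnegative loss under N(\<mu>, S), as an extended nonnegative real. *)
definition mvn_expect :: "real^'k \<Rightarrow> real^'k^'k \<Rightarrow> (real^'k \<Rightarrow> real) \<Rightarrow> ennreal" where
  "mvn_expect \<mu> S f = (\<integral>\<^sup>+ x. ennreal (f x) \<partial>mvn \<mu> S)"

(* Karamata: measurable, positive on (0, infinity). *)
definition slowly_varying :: "(real \<Rightarrow> real) \<Rightarrow> bool" where
  "slowly_varying l \<longleftrightarrow>
     set_borel_measurable borel {0<..} l \<and> (\<forall>u>0. 0 < l u) \<and>
     (\<forall>c>0. ((\<lambda>u. l (c * u) / l u) \<longlongrightarrow> 1) at_top)"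

(* Density of the squared local scale u = lambda^2.  Since u powr (-a-1) is not integrable at 0
   for a > 0, this is a probability density with l non-decreasing only if l tends to 0 at 0: a lower
   bound m > 0 on l is compatible with a proper prior only on some half-line u > u0 with u0 > 0.
   If moreover a > 2, the prior mean of u is finite and the shrinkage weight E(1 - \<kappa> | X) at a zero
   mean is of order t rather than of the order t powr a; the accumulated risk n * t^2 is then not
   o(q log(n / q)) when t = (q / n) powr ((1 + \<epsilon>) / a). *)
definition scale_density :: "real \<Rightarrow> real \<Rightarrow> (real \<Rightarrow> real) \<Rightarrow> real \<Rightarrow> real" where
  "scale_density K a l u = (if 0 < u then K * u powr (- a - 1) * l u else 0)"

definition scale_prior :: "real \<Rightarrow> real \<Rightarrow> (real \<Rightarrow> real) \<Rightarrow> real measure" where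
  "scale_prior K a l = density lborel (\<lambda>u. ennreal (scale_density K a l u))"

(* Joint density of (X, \<theta>, u), where p is the density of u:
   X | \<theta> ~ N(\<theta>, S) and \<theta> | u ~ N(0, u t S). *)
definition joint_density ::
  "real^'k^'k \<Rightarrow> (real \<Rightarrow> real) \<Rightarrow> real \<Rightarrow> real^'k \<Rightarrow> real^'k \<Rightarrow> real \<Rightarrow> real" where
  "joint_density S p t x \<theta> u =
     mvn_density \<theta> S x * mvn_density 0 ((u * t) *\<^sub>R S) \<theta> * p u"

definition marginal_density ::
  "real^'k^'k \<Rightarrow> (real \<Rightarrow> real) \<Rightarrow> real \<Rightarrow> real^'k \<Rightarrow> real" where
  "marginal_density S p t x = (\<integral>(\<theta>, u). joint_density S p t x \<theta> u \<partial>lborel)"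

definition posterior_density ::
  "real^'k^'k \<Rightarrow> (real \<Rightarrow> real) \<Rightarrow> real \<Rightarrow> real^'k \<Rightarrow> real^'k \<Rightarrow> real \<Rightarrow> real" where
  "posterior_density S p t x \<theta> u = joint_density S p t x \<theta> u / marginal_density S p t x"

(* E(\<theta> | X = x), by Bayes' formula.  The n coordinates of the model are independent, so the
   posterior of the i-th mean depends on the data only through the i-th observation. *)
definition posterior_mean ::
  "real^'k^'k \<Rightarrow> (real \<Rightarrow> real) \<Rightarrow> real \<Rightarrow> real^'k \<Rightarrow> real^'k" where
  "posterior_mean S p t x = (\<integral>(\<theta>, u). posterior_density S p t x \<theta> u *\<^sub>R \<theta> \<partial>lborel)"

definition nearly_black :: "nat \<Rightarrow> nat \<Rightarrow> (nat \<Rightarrow> real^'k) set" where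
  "nearly_black n q = {\<theta> \<in> {1..n} \<rightarrow>\<^sub>E UNIV. card {i \<in> {1..n}. \<theta> i \<noteq> 0} \<le> q}"

end

theory Submission
  imports Defs "HOL-Real_Asymp.Real_Asymp"
begin

text \<open>Write \<open>s x\<close> for the squared Mahalanobis norm, \<open>b = ln (n / q)\<close> and \<open>B = 2 a ln (1 / \<tau>)\<close>.  The choice
of \<open>\<tau>\<close> gives \<open>B = 2 b (1 + 1 / ln b)\<close>, so \<open>B\<close> and \<open>2 b\<close> agree to first order, while
\<open>\<tau> powr a = exp (- b - b / ln b)\<close> is smaller than \<open>q / n = exp (- b)\<close> by a factor that beats every
power of \<open>b\<close>.

Integrating \<open>\<theta>\<close> out of the joint density by completing the square shows that the posterior mean is
\<open>W x\<close> with a scalar \<open>W = weight \<tau> (s x)\<close> in the unit interval (\<open>posterior_mean_eq\<close>); it is the average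
of \<open>1 - \<kappa>(u)\<close>, \<open>\<kappa>(u) = 1 / (1 + u \<tau>)\<close>, under the prior of \<open>u\<close> reweighted by
\<open>\<kappa> powr (k / 2) * exp (- s x \<kappa> / 2)\<close>.  The prior puts mass of order \<open>\<tau> powr a\<close> on scales \<open>u\<close> of order
\<open>1 / \<tau>\<close>, which are those that do not shrink, whereas the bulk of the prior explains \<open>x\<close> with likelihood
about \<open>exp (- s x / 2)\<close>.  The two balance at \<open>s x = B\<close>, which acts as a squared threshold.

\<^item> At \<open>\<theta> = 0\<close> the Gaussian density cancels the lower bound \<open>exp (- s x / 2)\<close> for the normalising integral
  in Jensen's bound for \<open>W\<^sup>2\<close>, and Tonelli's theorem leaves the prior mean of \<open>(1 - \<kappa>)\<^sup>2\<close>, which is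
  \<open>O(\<tau> powr a ln (1 / \<tau>))\<close> for \<open>a \<le> 2\<close> (\<open>risk_at_zero\<close>).  Multiplied by \<open>n\<close> this is \<open>o(q b)\<close>.

\<^item> For every \<open>x\<close>, \<open>(1 - W)\<^sup>2 s x\<close> is at most \<open>(1 + \<delta>) B + O(1)\<close>: trivially when \<open>s x \<le> (1 + \<delta>) B\<close>, and
  otherwise because the large scales dominate and \<open>(1 - W) sqrt (s x)\<close> is bounded
  (\<open>shrunk_norm_bounded\<close>).  Since \<open>W x - \<theta> = (x - \<theta>) - (1 - W) x\<close> and \<open>s (x - \<theta>)\<close> has bounded
  expectation, the risk at any \<open>\<theta>\<close> is at most about \<open>B\<close> (\<open>risk_upper_bound\<close>).

\<^item> If \<open>s \<theta>\<close> is slightly below \<open>B\<close>, then so is \<open>s x\<close> with high probability, hence \<open>W\<close> is small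
  (\<open>weight_upper\<close>) and the loss is nearly \<open>s \<theta>\<close> (\<open>risk_lower_bound\<close>).  Placing such a mean in \<open>q\<close>
  coordinates shows that the factor 1 in the limit is attained.

The value 1 of the limit rests on the total mass 1 of the normal density, which comes from a factorisation
\<open>s x = (R x) \<bullet> (R x)\<close> and the linear substitution rule.\<close>

section \<open>Linear substitution in Lebesgue integrals\<close>

text \<open>Only one coordinate of \<open>x\<close> moves, by an amount that depends on another coordinate.  So integrate over the
moving coordinate first and use translation invariance on the line.\<close>

lemma nn_integral_lborel_shear:
  fixes b d :: "'a::euclidean_space"
  assumes b: "b \<in> Basis" and d: "d \<in> Basis" and bd: "b \<noteq> d"
    and h[measurable]: "h \<in> borel_measurable borel"
  shows "(\<integral>\<^sup>+x. h (x + (x \<bullet> b) *\<^sub>R d) \<partial>lborel) = (\<integral>\<^sup>+x. h x \<partial>lborel)"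
proof -
  interpret product_sigma_finite "\<lambda>_::'a. lborel :: real measure"
    by standard
  let ?I = "Basis - {d}"
  have ins: "insert d ?I = Basis" using d by auto
  have fin: "finite ?I" and notin: "d \<notin> ?I" by auto
  have split: "(\<integral>\<^sup>+x. F x \<partial>lborel) =
      (\<integral>\<^sup>+w. (\<integral>\<^sup>+y. F ((\<Sum>c\<in>?I. w c *\<^sub>R c) + y *\<^sub>R d) \<partial>lborel) \<partial>Pi\<^sub>M ?I (\<lambda>_. lborel))"
    if F[measurable]: "F \<in> borel_measurable borel" for F :: "'a \<Rightarrow> ennreal"
  proof -
    have "(\<integral>\<^sup>+x. F x \<partial>lborel) =
        (\<integral>\<^sup>+w. F (\<Sum>c\<in>Basis. w c *\<^sub>R c) \<partial>Pi\<^sub>M (insert d ?I) (\<lambda>_. lborel))"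
      unfolding ins by (subst lborel_def) (simp add: nn_integral_distr lborel_eq_real)
    also have "\<dots> = (\<integral>\<^sup>+w. (\<integral>\<^sup>+y. F (\<Sum>c\<in>Basis. (w(d := y)) c *\<^sub>R c) \<partial>lborel)
        \<partial>Pi\<^sub>M ?I (\<lambda>_. lborel))"
      by (rule product_nn_integral_insert[OF fin notin]) (simp add: ins)
    also have "\<dots> = (\<integral>\<^sup>+w. (\<integral>\<^sup>+y. F ((\<Sum>c\<in>?I. w c *\<^sub>R c) + y *\<^sub>R d) \<partial>lborel)
        \<partial>Pi\<^sub>M ?I (\<lambda>_. lborel))"
    proof -
      have "(\<Sum>c\<in>Basis. (w(d := y)) c *\<^sub>R c) = (\<Sum>c\<in>?I. w c *\<^sub>R c) + y *\<^sub>R d" for w y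
        using d by (subst sum.remove[OF _ d]) (auto simp: add.commute intro!: sum.cong)
      then show ?thesis by simp
    qed
    finally show ?thesis .
  qed
  have coord: "((\<Sum>c\<in>?I. w c *\<^sub>R c) + y *\<^sub>R d) \<bullet> b = w b" for w :: "'a \<Rightarrow> real" and y
    using b d bd by (simp add: inner_sum_left inner_add_left inner_Basis if_distrib sum.If_cases
        cong: if_cong)
  have "(\<integral>\<^sup>+x. h (x + (x \<bullet> b) *\<^sub>R d) \<partial>lborel) =
      (\<integral>\<^sup>+w. (\<integral>\<^sup>+y. h ((\<Sum>c\<in>?I. w c *\<^sub>R c) + (w b + 1 * y) *\<^sub>R d) \<partial>lborel) \<partial>Pi\<^sub>M ?I (\<lambda>_. lborel))"
    by (subst split) (simp_all only: coord, simp_all add: scaleR_left_distrib algebra_simps)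
  also have "\<dots> = (\<integral>\<^sup>+w. (\<integral>\<^sup>+y. h ((\<Sum>c\<in>?I. w c *\<^sub>R c) + y *\<^sub>R d) \<partial>lborel) \<partial>Pi\<^sub>M ?I (\<lambda>_. lborel))"
    by (rule nn_integral_cong, subst (2) nn_integral_real_affine[where c = 1 and t = "_ b"]) simp_all
  also have "\<dots> = (\<integral>\<^sup>+x. h x \<partial>lborel)"
    by (rule split[symmetric]) simp
  finally show ?thesis .
qed

text \<open>The substitution rule as a property of \<open>f\<close>, so that it can be proved by induction over a factorisation into
elementary maps.  It must hold vacuously for singular maps, because the induction passes through them;
linearity is part of the property so that determinants multiply under composition.\<close>

definition substitution_rule :: "(real^'n \<Rightarrow> real^'n) \<Rightarrow> bool" where
  "substitution_rule f \<longleftrightarrow> linear f \<and> (det (matrix f) \<noteq> 0 \<longrightarrow>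
     (\<forall>h\<in>borel_measurable borel.
       (\<integral>\<^sup>+x. h x \<partial>lborel) = ennreal \<bar>det (matrix f)\<bar> * (\<integral>\<^sup>+x. h (f x) \<partial>lborel)))"

lemma substitution_rule_compose:
  assumes "substitution_rule f" "substitution_rule g"
  shows "substitution_rule (f \<circ> g)"
proof -
  have lin: "linear f" "linear g" using assms by (auto simp: substitution_rule_def)
  have m: "det (matrix (f \<circ> g)) = det (matrix f) * det (matrix g)"
    using matrix_compose[of g f] lin by (simp add: det_mul)
  { fix h :: "real^'a \<Rightarrow> ennreal" assume nz: "det (matrix (f \<circ> g)) \<noteq> 0"
    assume h[measurable]: "h \<in> borel_measurable borel"
    have nz': "det (matrix f) \<noteq> 0" "det (matrix g) \<noteq> 0" using nz unfolding m by auto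
    have [measurable]: "f \<in> borel_measurable borel"
      using lin(1) by (simp add: borel_measurable_continuous_onI linear_continuous_on linear_conv_bounded_linear)
    have "(\<integral>\<^sup>+x. h x \<partial>lborel) = ennreal \<bar>det (matrix f)\<bar> * (\<integral>\<^sup>+x. h (f x) \<partial>lborel)"
      using assms(1) nz' h unfolding substitution_rule_def by blast
    also have "(\<integral>\<^sup>+x. h (f x) \<partial>lborel) = ennreal \<bar>det (matrix g)\<bar> * (\<integral>\<^sup>+x. h (f (g x)) \<partial>lborel)"
    proof -
      have "(\<lambda>x. h (f x)) \<in> borel_measurable borel" by measurable
      then show ?thesis using assms(2) nz' unfolding substitution_rule_def by blast
    qed
    finally have "(\<integral>\<^sup>+x. h x \<partial>lborel) =
        ennreal \<bar>det (matrix (f \<circ> g))\<bar> * (\<integral>\<^sup>+x. h ((f \<circ> g) x) \<partial>lborel)"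
      unfolding m abs_mult comp_apply by (subst ennreal_mult) (simp_all only: mult.assoc abs_ge_zero) }
  then show ?thesis
    using linear_compose[OF lin(2,1)] unfolding substitution_rule_def by blast
qed

lemma substitution_rule_diagonal: "substitution_rule (\<lambda>x::real^'n. \<chi> i. c i * x $ i)"
proof -
  let ?f = "\<lambda>x::real^'n. \<chi> i. c i * x $ i"
  have lin: "linear ?f"
    by (rule linearI) (simp_all add: vec_eq_iff algebra_simps)
  have "det (matrix ?f) = (\<Prod>i\<in>UNIV. matrix ?f $ i $ i)"
    by (rule det_diagonal) (simp add: matrix_def axis_def)
  then have det: "det (matrix ?f) = (\<Prod>i\<in>UNIV. c i)"
    by (simp add: matrix_def axis_def)
  { fix h :: "real^'n \<Rightarrow> ennreal" assume nz: "det (matrix ?f) \<noteq> 0"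
    assume h[measurable]: "h \<in> borel_measurable borel"
    define e where "e = (\<lambda>b::real^'n. \<Sum>i\<in>UNIV. c i * (b $ i))"
    have e_axis: "e (axis i 1) = c i" for i
      unfolding e_def by (simp add: axis_def if_distrib sum.If_cases cong: if_cong)
    have Bas: "(Basis :: (real^'n) set) = (\<lambda>i. axis i 1) ` UNIV"
      by (auto simp: Basis_vec_def)
    have inj: "inj (\<lambda>i::'n. axis i (1::real))"
      by (auto simp: inj_on_def axis_eq_axis)
    have f_eq: "0 + (\<Sum>j\<in>Basis. (e j * (x \<bullet> j)) *\<^sub>R j) = ?f x" for x
      unfolding Bas sum.reindex[OF inj] o_def e_axis inner_axis
      by (simp add: vec_eq_iff axis_def if_distrib sum.If_cases cong: if_cong)
    have pr: "(\<Prod>j\<in>Basis. \<bar>e j\<bar>) = \<bar>det (matrix ?f)\<bar>"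
      unfolding Bas prod.reindex[OF inj] o_def e_axis det by (simp add: abs_prod)
    have nz': "e j \<noteq> 0" if "j \<in> Basis" for j
      using that nz unfolding Bas det by (auto simp: e_axis)
    have [measurable]: "?f \<in> borel_measurable borel"
      using lin by (simp add: borel_measurable_continuous_onI linear_continuous_on linear_conv_bounded_linear)
    have "lborel = density (distr lborel borel ?f) (\<lambda>_. ennreal \<bar>det (matrix ?f)\<bar>)"
      using lborel_affine_euclidean[of e 0] nz' unfolding f_eq pr by simp
    then have "(\<integral>\<^sup>+x. h x \<partial>lborel) = (\<integral>\<^sup>+x. h x \<partial>density (distr lborel borel ?f) (\<lambda>_. ennreal \<bar>det (matrix ?f)\<bar>))"
      by simp
    also have "\<dots> = ennreal \<bar>det (matrix ?f)\<bar> * (\<integral>\<^sup>+x. h (?f x) \<partial>lborel)"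
      by (simp add: nn_integral_density nn_integral_distr nn_integral_cmult)
    finally have "(\<integral>\<^sup>+x. h x \<partial>lborel) = ennreal \<bar>det (matrix ?f)\<bar> * (\<integral>\<^sup>+x. h (?f x) \<partial>lborel)" . }
  then show ?thesis using lin by (auto simp: substitution_rule_def)
qed

lemma substitution_rule_shear:
  fixes m n :: "'n::finite"
  assumes "m \<noteq> n"
  shows "substitution_rule (\<lambda>x::real^'n. \<chi> i. if i = m then x $ m + x $ n else x $ i)"
proof -
  let ?f = "\<lambda>x::real^'n. \<chi> i. if i = m then x $ m + x $ n else x $ i"
  have lin: "linear ?f"
    by (rule linearI) (auto simp: vec_eq_iff algebra_simps)
  have "matrix ?f = (\<chi> k. if k = m then row m (mat 1) + 1 *s row n (mat 1) else row k (mat 1))"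
    using assms by (auto simp: vec_eq_iff matrix_def axis_def row_def mat_def)
  then have det: "det (matrix ?f) = 1"
    using det_row_operation[OF assms, of "mat 1" 1] by simp
  have f_eq: "?f x = x + (x \<bullet> axis n 1) *\<^sub>R axis m 1" for x
    using assms unfolding inner_axis by (auto simp: vec_eq_iff axis_def)
  have "(\<integral>\<^sup>+x. h (?f x) \<partial>lborel) = (\<integral>\<^sup>+x. h x \<partial>lborel)" if "h \<in> borel_measurable borel" for h
    unfolding f_eq using assms that
    by (intro nn_integral_lborel_shear) (auto simp: axis_in_Basis_iff axis_eq_axis)
  then show ?thesis using lin det by (auto simp: substitution_rule_def)
qed

text \<open>With \<open>D\<close> the reflection of coordinate \<open>n\<close>, the swap sends \<open>(x, y)\<close> through \<open>(x + y, y)\<close>, \<open>(x + y, - x)\<close>,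
\<open>(y, - x)\<close> to \<open>(y, x)\<close>, which are shears up to conjugation by \<open>D\<close>; its determinant then needs no computation.\<close>

lemma substitution_rule_swap:
  fixes m n :: "'n::finite"
  assumes "m \<noteq> n"
  shows "substitution_rule (\<lambda>x::real^'n. \<chi> i. x $ Transposition.transpose m n i)"
proof -
  let ?A = "\<lambda>x::real^'n. \<chi> i. if i = m then x $ m + x $ n else x $ i"
  let ?B = "\<lambda>x::real^'n. \<chi> i. if i = n then x $ n + x $ m else x $ i"
  let ?D = "\<lambda>x::real^'n. \<chi> i. (if i = n then -1 else 1) * x $ i"
  have "(\<lambda>x::real^'n. \<chi> i. x $ Transposition.transpose m n i) = ?D \<circ> (?A \<circ> ((?D \<circ> (?B \<circ> ?D)) \<circ> ?A))"
    using assms by (auto simp: fun_eq_iff vec_eq_iff Transposition.transpose_def)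
  then show ?thesis
    using assms by (auto intro!: substitution_rule_compose substitution_rule_diagonal substitution_rule_shear)
qed

theorem substitution_rule_linear:
  fixes f :: "real^'n \<Rightarrow> real^'n"
  assumes "linear f"
  shows "substitution_rule f"
proof (rule induct_linear_elementary[OF assms])
  fix f :: "real^'n \<Rightarrow> real^'n" and i
  assume lin: "linear f" and z: "\<And>x. f x $ i = 0"
  then have "row i (matrix f) = 0"
    by (simp add: row_def matrix_def vec_eq_iff)
  then have "det (matrix f) = 0" by (rule det_zero_row(2))
  then show "substitution_rule f" using lin by (simp add: substitution_rule_def)
qed ((rule substitution_rule_compose substitution_rule_diagonal substitution_rule_shear
  substitution_rule_swap; assumption)+)

lemma nn_integral_matrix_substitution:
  fixes A :: "real^'n^'n"
  assumes "det A \<noteq> 0" "h \<in> borel_measurable borel"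
  shows "(\<integral>\<^sup>+x. h x \<partial>lborel) = ennreal \<bar>det A\<bar> * (\<integral>\<^sup>+x. h (A *v x) \<partial>lborel)"
  using substitution_rule_linear[OF matrix_vector_mul_linear[of A]] assms
  by (auto simp: substitution_rule_def)

section \<open>Factorisation of positive definite matrices\<close>

lemma positive_definite_sym:
  assumes "positive_definite S"
  shows "x \<bullet> (S *v y) = y \<bullet> (S *v x)"
proof -
  have "x \<bullet> (S *v y) = (x v* S) \<bullet> y" by (simp add: dot_lmul_matrix)
  also have "x v* S = transpose S *v x" by simp
  also have "transpose S = S" using assms by (simp add: positive_definite_def)
  finally show ?thesis by (simp add: inner_commute)
qed

text \<open>Gram-Schmidt for the inner product \<open>x \<bullet> (S *v y)\<close>: a vector that is orthogonal in the ordinary sense to all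
\<open>S *v c j\<close> found so far exists by counting dimensions, and it is normalised by its \<open>S\<close>-length.\<close>

lemma positive_definite_orthonormal_family:
  fixes S :: "real^'k^'k"
  assumes S: "positive_definite S" and "finite J"
  shows "\<exists>c. \<forall>i\<in>J. \<forall>j\<in>J. c i \<bullet> (S *v c j) = (if i = (j::'k) then 1 else 0)"
  using \<open>finite J\<close>
proof (induction J)
  case empty
  then show ?case by simp
next
  case (insert i J)
  then obtain c where c: "\<And>r j. r \<in> J \<Longrightarrow> j \<in> J \<Longrightarrow> c r \<bullet> (S *v c j) = (if r = j then 1 else 0)"
    by blast
  let ?V = "(\<lambda>j. S *v c j) ` J"
  have "dim ?V \<le> card J"
    using insert.hyps(1) by (meson card_image_le dim_le_card' finite_imageI order_trans)
  also have "card J < CARD('k)"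
    using insert.hyps by (metis UNIV_I card_mono card_insert_disjoint finite_code subset_UNIV Suc_le_eq)
  finally have "dim ?V < DIM(real^'k)" by simp
  then obtain w where w: "w \<noteq> 0" "\<And>y. y \<in> span ?V \<Longrightarrow> orthogonal w y"
    using orthogonal_to_subspace_exists by metis
  have wJ: "w \<bullet> (S *v c j) = 0" if "j \<in> J" for j
    using w(2)[of "S *v c j"] that by (auto simp: orthogonal_def intro: span_base)
  define r where "r = w \<bullet> (S *v w)"
  have r: "r > 0" using S w(1) by (auto simp: positive_definite_def r_def)
  define d where "d = c(i := (1 / sqrt r) *\<^sub>R w)"
  have di: "d i = (1 / sqrt r) *\<^sub>R w" and dj: "\<And>j. j \<in> J \<Longrightarrow> d j = c j"
    using insert.hyps(2) by (auto simp: d_def)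
  have "d i \<bullet> (S *v d i) = 1"
    unfolding di using r by (simp add: matrix_scaleR_vector_ac scaleR_matrix_vector_assoc[symmetric] r_def[symmetric])
  moreover have "d i \<bullet> (S *v d j) = 0" "d j \<bullet> (S *v d i) = 0" if "j \<in> J" for j
    using wJ[OF that] positive_definite_sym[OF S, of "d j" "d i"]
    unfolding di dj[OF that] by (simp_all)
  ultimately show ?case
    using c dj insert.hyps(2) by (intro exI[of _ d]) (auto simp: dj)
qed

lemma matrix_inv_eqI:
  fixes A B :: "real^'n^'n"
  assumes "A ** B = mat 1"
  shows "matrix_inv A = B"
proof -
  have 2: "B ** A = mat 1" using assms matrix_left_right_inverse by blast
  have inv: "A ** matrix_inv A = mat 1"
    using assms 2 someI_ex[of "\<lambda>C. A ** C = mat 1 \<and> C ** A = mat 1"] unfolding matrix_inv_def by blast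
  have "matrix_inv A = B ** (A ** matrix_inv A)"
    using 2 by (simp add: matrix_mul_assoc)
  then show ?thesis using inv by simp
qed

text \<open>The rows of \<open>R\<close> form an \<open>S\<close>-orthonormal basis, so that \<open>R S R\<^sup>T = 1\<close> and therefore \<open>matrix_inv S = R\<^sup>T R\<close>.\<close>

lemma mahalanobis_sq_factorization:
  fixes S :: "real^'k^'k"
  assumes S: "positive_definite S"
  obtains R :: "real^'k^'k" where "det R \<noteq> 0" "det S = 1 / (det R)\<^sup>2"
    "\<And>x. mahalanobis_sq S x = (R *v x) \<bullet> (R *v x)"
proof -
  obtain c where c: "\<And>i j::'k. c i \<bullet> (S *v c j) = (if i = j then 1 else 0)"
    using positive_definite_orthonormal_family[OF S finite_class.finite_UNIV] by auto
  define R :: "real^'k^'k" where "R = (\<chi> i. c i)"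
  have "(R ** (S ** transpose R)) $ i $ j = mat 1 $ i $ j" for i j
  proof -
    have "(R ** (S ** transpose R)) $ i $ j = c i \<bullet> (S *v c j)"
      by (simp add: R_def matrix_matrix_mult_def matrix_vector_mult_def transpose_def inner_vec_def)
    then show ?thesis by (simp add: c mat_def)
  qed
  then have RSR: "R ** (S ** transpose R) = mat 1" by (simp add: vec_eq_iff)
  then have "det R * (det S * det R) = 1"
    by (metis det_mul det_I det_transpose)
  then have dR: "det R \<noteq> 0" and dS: "det S = 1 / (det R)\<^sup>2"
    by (auto simp: eq_divide_eq power2_eq_square mult_ac)
  have "(S ** transpose R) ** R = mat 1"
    using RSR matrix_left_right_inverse by blast
  then have mi: "matrix_inv S = transpose R ** R"
    by (intro matrix_inv_eqI) (simp add: matrix_mul_assoc)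
  have "mahalanobis_sq S x = (R *v x) \<bullet> (R *v x)" for x
  proof -
    have "x \<bullet> (transpose R *v (R *v x)) = (R *v x) \<bullet> (R *v x)"
      by (metis dot_lmul_matrix vector_transpose_matrix transpose_transpose)
    then show ?thesis unfolding mahalanobis_sq_def mi by (simp add: matrix_vector_mul_assoc)
  qed
  then show thesis using that dR dS by blast
qed

section \<open>Gaussian integrals in the Mahalanobis norm\<close>

lemma nn_integral_gauss_line:
  assumes "0 < c"
  shows "(\<integral>\<^sup>+x. ennreal (exp (- c * x\<^sup>2)) \<partial>lborel) = ennreal (sqrt (pi / c))"
proof -
  define \<sigma> where "\<sigma> = 1 / sqrt (2 * c)"
  have \<sigma>: "\<sigma> > 0" "\<sigma>\<^sup>2 = 1 / (2 * c)" using assms by (auto simp: \<sigma>_def power_divide)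
  interpret prob_space "density lborel (normal_density 0 \<sigma>)"
    by (rule prob_space_normal_density[OF \<sigma>(1)])
  have dens: "exp (- c * x\<^sup>2) = sqrt (pi / c) * normal_density 0 \<sigma> x" for x
    using assms unfolding normal_density_def \<sigma>(2) by (simp add: field_simps real_sqrt_divide)
  have "(\<integral>\<^sup>+x. ennreal (exp (- c * x\<^sup>2)) \<partial>lborel) =
      (\<integral>\<^sup>+x. ennreal (sqrt (pi / c)) * ennreal (normal_density 0 \<sigma> x) \<partial>lborel)"
    unfolding dens using assms by (simp add: ennreal_mult)
  also have "\<dots> = ennreal (sqrt (pi / c)) * (\<integral>\<^sup>+x. ennreal (normal_density 0 \<sigma> x) \<partial>lborel)"
    by (rule nn_integral_cmult) simp
  also have "(\<integral>\<^sup>+x. ennreal (normal_density 0 \<sigma> x) \<partial>lborel) = 1"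
    using emeasure_space_1 by (simp add: emeasure_density)
  finally show ?thesis by simp
qed

lemma nn_integral_gauss_euclidean:
  assumes "0 < c"
  shows "(\<integral>\<^sup>+x. ennreal (exp (- c * (x \<bullet> x))) \<partial>(lborel :: 'a::euclidean_space measure))
    = ennreal (sqrt (pi / c) ^ DIM('a))"
proof -
  have "ennreal (exp (- c * (x \<bullet> x))) = (\<Prod>b\<in>Basis. ennreal (exp (- c * (x \<bullet> b)\<^sup>2)))" for x :: 'a
  proof -
    have "- c * (x \<bullet> x) = (\<Sum>b\<in>Basis. - c * (x \<bullet> b)\<^sup>2)"
      by (subst euclidean_inner) (simp add: sum_distrib_left power2_eq_square sum_negf)
    then show ?thesis by (simp add: exp_sum prod_ennreal)
  qed
  then have "(\<integral>\<^sup>+x. ennreal (exp (- c * (x \<bullet> x))) \<partial>(lborel :: 'a measure)) =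
      (\<integral>\<^sup>+x. (\<Prod>b\<in>Basis. ennreal (exp (- c * (x \<bullet> b)\<^sup>2))) \<partial>(lborel :: 'a measure))"
    by simp
  also have "\<dots> = (\<Prod>b\<in>(Basis :: 'a set). (\<integral>\<^sup>+x. ennreal (exp (- c * x\<^sup>2)) \<partial>lborel))"
    by (rule nn_integral_lborel_prod) simp_all
  also have "\<dots> = ennreal (sqrt (pi / c) ^ DIM('a))"
    unfolding nn_integral_gauss_line[OF assms] using assms by (simp add: prod_constant ennreal_power)
  finally show ?thesis .
qed

lemma nn_integral_lborel_translate:
  fixes h :: "'a::euclidean_space \<Rightarrow> ennreal"
  assumes [measurable]: "h \<in> borel_measurable borel"
  shows "(\<integral>\<^sup>+x. h (m + x) \<partial>lborel) = (\<integral>\<^sup>+x. h x \<partial>lborel)"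
  by (subst (2) lborel_distr_plus[symmetric, of m]) (simp add: nn_integral_distr)

locale pd_matrix =
  fixes S :: "real^'k^'k"
  assumes pd: "positive_definite S"
begin

abbreviation s :: "real^'k \<Rightarrow> real" where
  "s \<equiv> mahalanobis_sq S"

lemma s_factor:
  "\<exists>R::real^'k^'k. det R \<noteq> 0 \<and> det S = 1 / (det R)\<^sup>2 \<and> (\<forall>x. s x = (R *v x) \<bullet> (R *v x))"
  by (rule mahalanobis_sq_factorization[OF pd]) blast

lemma s_nonneg: "0 \<le> s x"
proof -
  obtain R :: "real^'k^'k" where "\<And>x. s x = (R *v x) \<bullet> (R *v x)"
    using s_factor by blast
  then show ?thesis by simp
qed

lemma s_scaleR: "s (c *\<^sub>R x) = c\<^sup>2 * s x"
  unfolding mahalanobis_sq_def by (simp add: matrix_vector_mult_scaleR power2_eq_square)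

lemma s_minus: "s (- x) = s x"
  using s_scaleR[of "-1" x] by simp

text \<open>The squared triangle inequality with weights, from \<open>2 \<langle>x, y\<rangle> \<le> \<eta> s x + s y / \<eta>\<close>.  Small \<open>\<eta>\<close> keeps the factor of the
leading term near 1.\<close>

lemma s_add_le:
  assumes "0 < \<eta>"
  shows "s (x + y) \<le> (1 + \<eta>) * s x + (1 + 1 / \<eta>) * s y"
proof -
  obtain R :: "real^'k^'k" where R: "\<And>x. s x = (R *v x) \<bullet> (R *v x)"
    using s_factor by blast
  let ?p = "R *v x" and ?q = "R *v y"
  have "0 \<le> (sqrt \<eta> *\<^sub>R ?p - (1 / sqrt \<eta>) *\<^sub>R ?q) \<bullet> (sqrt \<eta> *\<^sub>R ?p - (1 / sqrt \<eta>) *\<^sub>R ?q)"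
    by simp
  also have "\<dots> = \<eta> * (?p \<bullet> ?p) - 2 * (?p \<bullet> ?q) + (1 / \<eta>) * (?q \<bullet> ?q)"
    using assms by (simp add: inner_diff_left inner_diff_right inner_commute)
  finally show ?thesis
    unfolding R by (simp add: matrix_vector_right_distrib inner_add_left inner_add_right inner_commute algebra_simps)
qed

lemma s_add_le2: "s (x + y) \<le> 2 * s x + 2 * s y"
  using s_add_le[of 1 x y] by simp

text \<open>The exponent of the joint density as a function of \<open>\<theta>\<close>: the conditional law of \<open>\<theta>\<close> is centred at
\<open>(v / (1 + v)) x\<close>, and the remaining term is the exponent of the marginal law N(0, (1 + v) S) of \<open>x\<close>.\<close>

lemma s_complete_square:
  assumes "0 < v"
  shows "s (x - \<theta>) + s \<theta> / v = ((1 + v) / v) * s (\<theta> - (v / (1 + v)) *\<^sub>R x) + s x / (1 + v)"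
proof -
  obtain R :: "real^'k^'k" where R: "\<And>x. s x = (R *v x) \<bullet> (R *v x)"
    using s_factor by blast
  define A B C where "A = (R *v x) \<bullet> (R *v x)" and "B = (R *v \<theta>) \<bullet> (R *v x)" and "C = (R *v \<theta>) \<bullet> (R *v \<theta>)"
  have "(A - 2 * B + C) + C / v =
      ((1 + v) / v) * (C - 2 * (v / (1 + v)) * B + (v / (1 + v))\<^sup>2 * A) + A / (1 + v)"
  proof -
    define w where "w = 1 + v"
    have w: "w \<noteq> 0" "v \<noteq> 0" "v = w - 1" using assms by (auto simp: w_def)
    have "((1 + v) / v) * (C - 2 * (v / (1 + v)) * B + (v / (1 + v))\<^sup>2 * A) + A / (1 + v)
      = (w / v) * C - 2 * B + (v / w + 1 / w) * A"
      unfolding w_def[symmetric] using w(1,2) by (simp add: field_simps power2_eq_square)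
    also have "v / w + 1 / w = 1" using w(1) unfolding w(3) by (simp add: field_simps)
    also have "w / v = 1 + 1 / v" using w(2) by (simp add: w_def field_simps)
    finally show ?thesis by (simp add: algebra_simps)
  qed
  moreover have "s (x - \<theta>) = A - 2 * B + C"
    unfolding R A_def B_def C_def
    by (simp add: matrix_vector_mult_diff_distrib inner_diff_left inner_diff_right inner_commute)
  moreover have "s (\<theta> - c *\<^sub>R x) = C - 2 * c * B + c\<^sup>2 * A" for c
    unfolding R A_def B_def C_def
    by (simp add: matrix_vector_mult_diff_distrib matrix_vector_mult_scaleR inner_diff_left
        inner_diff_right inner_commute power2_eq_square algebra_simps)
  moreover have "s \<theta> = C" "s x = A" by (simp_all add: R A_def C_def)
  ultimately show ?thesis by simp
qed

lemma s_continuous: "continuous_on UNIV s"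
proof -
  have "continuous_on UNIV (\<lambda>x. matrix_inv S *v x)"
    by (simp add: linear_continuous_on linear_conv_bounded_linear[symmetric])
  then show ?thesis unfolding mahalanobis_sq_def by (intro continuous_intros)
qed

lemma s_measurable[measurable]: "s \<in> borel_measurable borel"
  by (rule borel_measurable_continuous_onI[OF s_continuous])

lemma s_lower: "\<exists>c>0. \<forall>x. c * (norm x)\<^sup>2 \<le> s x"
proof -
  obtain R :: "real^'k^'k" where R: "det R \<noteq> 0" "\<And>x. s x = (R *v x) \<bullet> (R *v x)"
    using s_factor by blast
  then obtain Q where Q: "Q ** R = mat 1"
    using invertible_det_nz invertible_left_inverse by blast
  have "norm x \<le> onorm ((*v) Q) * norm (R *v x)" for x
  proof -
    have "norm (Q *v (R *v x)) \<le> onorm ((*v) Q) * norm (R *v x)"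
      by (rule onorm) (rule matrix_vector_mul_bounded_linear)
    then show ?thesis by (simp add: matrix_vector_mul_assoc Q)
  qed
  then have n: "norm x \<le> (1 + onorm ((*v) Q)) * norm (R *v x)" for x
    by (simp add: distrib_right add_increasing)
  define r where "r = 1 + onorm ((*v) Q)"
  have r: "r > 0" using onorm_pos_le[OF matrix_vector_mul_bounded_linear[of Q]] by (simp add: r_def)
  have "(1 / r\<^sup>2) * (norm x)\<^sup>2 \<le> s x" for x
  proof -
    have "(norm x)\<^sup>2 \<le> (r * norm (R *v x))\<^sup>2"
      using n[of x] by (intro power_mono) (simp_all add: r_def)
    then show ?thesis using r by (simp add: R(2) power_mult_distrib divide_le_eq power2_norm_eq_inner mult.commute)
  qed
  then show ?thesis using r by (intro exI[of _ "1 / r\<^sup>2"]) auto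
qed

lemma s_pos: "x \<noteq> 0 \<Longrightarrow> 0 < s x"
proof -
  assume x: "x \<noteq> 0"
  obtain c where c: "c > 0" "\<And>x. c * (norm x)\<^sup>2 \<le> s x" using s_lower by blast
  have "0 < c * (norm x)\<^sup>2" using c(1) x by simp
  then show ?thesis using c(2)[of x] by linarith
qed

lemma det_pos: "0 < det S"
proof -
  obtain R :: "real^'k^'k" where R: "det R \<noteq> 0" "det S = 1 / (det R)\<^sup>2"
    using s_factor by blast
  then show ?thesis by simp
qed

lemma nn_integral_gauss:
  assumes "0 < c"
  shows "(\<integral>\<^sup>+x. ennreal (exp (- c * s x)) \<partial>lborel) = ennreal (sqrt (det S) * sqrt (pi / c) ^ CARD('k))"
proof -
  obtain R :: "real^'k^'k" where R: "det R \<noteq> 0" "det S = 1 / (det R)\<^sup>2" "\<And>x. s x = (R *v x) \<bullet> (R *v x)"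
    using s_factor by blast
  have "ennreal (sqrt (pi / c) ^ CARD('k)) = ennreal \<bar>det R\<bar> * (\<integral>\<^sup>+x. ennreal (exp (- c * s x)) \<partial>lborel)"
    using nn_integral_matrix_substitution[OF R(1), of "\<lambda>y. ennreal (exp (- c * (y \<bullet> y)))"]
      nn_integral_gauss_euclidean[OF assms, where 'a = "real^'k"]
    by (simp add: R(3))
  then have "ennreal (1 / \<bar>det R\<bar>) * ennreal (sqrt (pi / c) ^ CARD('k)) =
      (ennreal (1 / \<bar>det R\<bar>) * ennreal \<bar>det R\<bar>) * (\<integral>\<^sup>+x. ennreal (exp (- c * s x)) \<partial>lborel)"
    by (simp add: mult.assoc)
  also have "ennreal (1 / \<bar>det R\<bar>) * ennreal \<bar>det R\<bar> = 1"
    using R(1) by (simp add: ennreal_mult[symmetric])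
  finally show ?thesis
    using R(1) assms by (simp add: R(2) real_sqrt_divide ennreal_mult[symmetric])
qed

definition Z :: real where
  "Z = sqrt ((2 * pi) ^ CARD('k) * det S)"

lemma Z_pos: "0 < Z"
  using det_pos by (simp add: Z_def)

lemma mvn_density_eq: "mvn_density \<mu> S x = exp (- s (x - \<mu>) / 2) / Z"
  by (simp add: mvn_density_def Z_def)

lemma mvn_density_scaled:
  assumes "0 < v"
  shows "mvn_density \<mu> (v *\<^sub>R S) x = exp (- s (x - \<mu>) / (2 * v)) / (sqrt v ^ CARD('k) * Z)"
proof -
  have "invertible S" using det_pos invertible_det_nz[of S] by auto
  then have "S ** matrix_inv S = mat 1"
    by (metis invertible_def matrix_inv_eqI)
  then have "matrix_inv (v *\<^sub>R S) = (1 / v) *\<^sub>R matrix_inv S"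
    using assms by (intro matrix_inv_eqI) (simp add: scalar_matrix_assoc[symmetric] matrix_scalar_ac)
  then have m: "mahalanobis_sq (v *\<^sub>R S) y = s y / v" for y
    by (simp add: mahalanobis_sq_def scaleR_matrix_vector_assoc[symmetric])
  have "det (v *\<^sub>R S) = v ^ CARD('k) * det S"
    using det_rows_mul[of "\<lambda>_. v" "\<lambda>i. row i S"]
    by (simp add: row_def vec_eq_iff scaleR_vec_def scalar_mult_eq_scaleR[symmetric] vector_scalar_mult_def)
  then have "sqrt ((2 * pi) ^ CARD('k) * det (v *\<^sub>R S)) = sqrt v ^ CARD('k) * Z"
    by (simp add: Z_def real_sqrt_mult real_sqrt_power)
  then show ?thesis by (simp add: mvn_density_def m mult.commute)
qed

lemma nn_integral_gauss_half:
  assumes "0 < v"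
  shows "(\<integral>\<^sup>+x. ennreal (exp (- s x / (2 * v))) \<partial>lborel) = ennreal (sqrt v ^ CARD('k) * Z)"
proof -
  have "(\<integral>\<^sup>+x. ennreal (exp (- s x / (2 * v))) \<partial>lborel) = (\<integral>\<^sup>+x. ennreal (exp (- (1 / (2 * v)) * s x)) \<partial>lborel)"
    by simp
  also have "\<dots> = ennreal (sqrt (det S) * sqrt (pi / (1 / (2 * v))) ^ CARD('k))"
    using assms by (intro nn_integral_gauss) simp
  also have "sqrt (det S) * sqrt (pi / (1 / (2 * v))) ^ CARD('k) = sqrt v ^ CARD('k) * Z"
    by (simp add: Z_def real_sqrt_mult real_sqrt_power power_mult_distrib mult_ac)
  finally show ?thesis .
qed

lemma integrable_gauss:
  assumes "0 < v"
  shows "integrable lborel (\<lambda>x. exp (- s (x - m) / (2 * v)))"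
    and "(\<integral>x. exp (- s (x - m) / (2 * v)) \<partial>lborel) = sqrt v ^ CARD('k) * Z"
proof -
  have "(\<integral>\<^sup>+x. ennreal (exp (- s (x - m) / (2 * v))) \<partial>lborel) = ennreal (sqrt v ^ CARD('k) * Z)"
    using nn_integral_lborel_translate[of "\<lambda>x. ennreal (exp (- s x / (2 * v)))" "- m"]
      nn_integral_gauss_half[OF assms] by simp
  moreover have "0 \<le> sqrt v ^ CARD('k) * Z" using Z_pos assms by simp
  ultimately have "has_bochner_integral lborel (\<lambda>x. exp (- s (x - m) / (2 * v))) (sqrt v ^ CARD('k) * Z)"
    by (intro has_bochner_integral_nn_integral) simp_all
  then show "integrable lborel (\<lambda>x. exp (- s (x - m) / (2 * v)))"
    and "(\<integral>x. exp (- s (x - m) / (2 * v)) \<partial>lborel) = sqrt v ^ CARD('k) * Z"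
    by (auto simp: has_bochner_integral_iff)
qed

lemma mvn_expect_eq:
  assumes f[measurable]: "f \<in> borel_measurable borel" and f0: "\<And>x. 0 \<le> f x"
  shows "mvn_expect \<mu> S f = (\<integral>\<^sup>+z. ennreal (f (\<mu> + z) * (exp (- s z / 2) / Z)) \<partial>lborel)"
proof -
  have "mvn_expect \<mu> S f = (\<integral>\<^sup>+x. ennreal (f x * (exp (- s (x - \<mu>) / 2) / Z)) \<partial>lborel)"
    unfolding mvn_expect_def mvn_def mvn_density_eq using f0 Z_pos
    by (subst nn_integral_density) (simp_all add: ennreal_mult[symmetric] mult.commute)
  also have "\<dots> = (\<integral>\<^sup>+z. ennreal (f (\<mu> + z) * (exp (- s z / 2) / Z)) \<partial>lborel)"
    by (subst nn_integral_lborel_translate[symmetric, of _ \<mu>]) simp_all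
  finally show ?thesis .
qed

lemma nn_integral_std: "(\<integral>\<^sup>+z. ennreal (exp (- s z / 2) / Z) \<partial>lborel) = 1"
proof -
  have "(\<integral>\<^sup>+z. ennreal (exp (- s z / 2) / Z) \<partial>lborel) =
      (\<integral>\<^sup>+z. ennreal (1 / Z) * ennreal (exp (- s z / (2 * 1))) \<partial>lborel)"
    using Z_pos by (simp add: ennreal_mult[symmetric])
  also have "\<dots> = ennreal (1 / Z) * ennreal Z"
    by (subst nn_integral_cmult, simp, subst nn_integral_gauss_half) simp_all
  also have "\<dots> = 1" using Z_pos by (simp add: ennreal_mult[symmetric])
  finally show ?thesis .
qed

text \<open>A quarter of the Gaussian exponent pays for the decay in \<open>r\<close>, an eighth absorbs the factor \<open>s z\<close>, and the
last eighth is integrable.\<close>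

lemma second_moment_tail:
  "\<exists>C\<ge>(0::real). \<forall>r. (\<integral>\<^sup>+z. ennreal (s z * indicator {z. r < s z} z * (exp (- s z / 2) / Z)) \<partial>lborel)
      \<le> ennreal (C * exp (- r / 4))"
proof -
  define C :: real where "C = 8 * 2 ^ CARD('k)"
  have "(\<integral>\<^sup>+z. ennreal (s z * indicator {z. r < s z} z * (exp (- s z / 2) / Z)) \<partial>lborel)
      \<le> ennreal (C * exp (- r / 4))" for r
  proof -
    have le: "s z * indicator {z. r < s z} z * (exp (- s z / 2) / Z)
        \<le> 8 * exp (- r / 4) / Z * exp (- s z / (2 * 4))" for z
    proof (cases "r < s z")
      case True
      have "s z / 8 \<le> exp (s z / 8)" using exp_ge_add_one_self[of "s z / 8"] by linarith
      then have 1: "s z \<le> 8 * exp (s z / 8)" by simp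
      have "s z * exp (- s z / 2) \<le> 8 * exp (s z / 8) * exp (- s z / 2)"
        by (intro mult_right_mono 1) simp
      also have "\<dots> = 8 * (exp (- s z / 4) * exp (- s z / 8))"
        by (simp add: exp_add[symmetric])
      also have "\<dots> \<le> 8 * (exp (- r / 4) * exp (- s z / 8))"
        using True by (intro mult_left_mono mult_right_mono) auto
      finally show ?thesis using True Z_pos by (simp add: divide_right_mono)
    qed (use Z_pos in simp)
    have "(\<integral>\<^sup>+z. ennreal (s z * indicator {z. r < s z} z * (exp (- s z / 2) / Z)) \<partial>lborel)
        \<le> (\<integral>\<^sup>+z. ennreal (8 * exp (- r / 4) / Z) * ennreal (exp (- s z / (2 * 4))) \<partial>lborel)"
      using Z_pos by (intro nn_integral_mono) (simp add: ennreal_mult[symmetric] ennreal_leI[OF le, simplified])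
    also have "\<dots> = ennreal (8 * exp (- r / 4) / Z) * ennreal (sqrt 4 ^ CARD('k) * Z)"
      by (subst nn_integral_cmult, simp, subst nn_integral_gauss_half) simp_all
    also have "\<dots> = ennreal (C * exp (- r / 4))"
      using Z_pos by (simp add: ennreal_mult[symmetric] C_def mult_ac)
    finally show ?thesis .
  qed
  then show ?thesis by (intro exI[of _ C]) (simp add: C_def)
qed

lemma second_moment:
  "\<exists>C\<ge>(0::real). (\<integral>\<^sup>+z. ennreal (s z * (exp (- s z / 2) / Z)) \<partial>lborel) \<le> ennreal C"
proof -
  obtain C where C: "C \<ge> 0" "\<And>r. (\<integral>\<^sup>+z. ennreal (s z * indicator {z. r < s z} z * (exp (- s z / 2) / Z)) \<partial>lborel)
      \<le> ennreal (C * exp (- r / 4))"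
    using second_moment_tail by blast
  have "indicator {z. - 1 < s z} z = (1::real)" for z
    using s_nonneg[of z] by (simp add: indicator_def)
  then show ?thesis using C(2)[of "-1"] C(1) by (intro exI[of _ "C * exp (1 / 4)"]) simp
qed

end

section \<open>The posterior mean as a shrinkage rule\<close>

lemma lborel_integral_translate:
  fixes h :: "'a::euclidean_space \<Rightarrow> 'b::euclidean_space"
  assumes [measurable]: "h \<in> borel_measurable borel"
  shows "(\<integral>x. h (m + x) \<partial>lborel) = (\<integral>x. h x \<partial>lborel)"
  by (subst (2) lborel_distr_plus[symmetric, of m]) (simp add: integral_distr)

lemma lborel_integral_odd:
  fixes h :: "'a::euclidean_space \<Rightarrow> 'b::euclidean_space"
  assumes [measurable]: "h \<in> borel_measurable borel" and odd: "\<And>x. h (- x) = - h x"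
  shows "(\<integral>x. h x \<partial>lborel) = 0"
proof -
  have "lborel = distr lborel borel (\<lambda>x::'a. - x)"
    using lborel_affine[of "-1" "0::'a"] by (simp add: density_1)
  then have "(\<integral>x. h x \<partial>lborel) = (\<integral>x. h x \<partial>distr lborel borel (\<lambda>x::'a. - x))" by simp
  also have "\<dots> = (\<integral>x. h (- x) \<partial>lborel)" by (simp add: integral_distr)
  also have "\<dots> = - (\<integral>x. h x \<partial>lborel)" by (simp add: odd)
  finally have eq: "(\<integral>x. h x \<partial>lborel) = - (\<integral>x. h x \<partial>lborel)" .
  have "(\<integral>x. h x \<partial>lborel) + (\<integral>x. h x \<partial>lborel) = 0" by (subst (2) eq) simp
  then show ?thesis unfolding scaleR_2[symmetric] by simp
qed

context pd_matrix
begin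

text \<open>Turns a factor \<open>norm y\<close> into a small loss in a Gaussian exponent, which is how integrability of first moments is
checked below.\<close>

lemma norm_le_exp:
  "\<exists>C\<ge>(0::real). \<forall>w>0. \<forall>y. norm y \<le> (1 + C * w) * exp (s y / w)"
proof -
  obtain c where c: "c > 0" "\<And>x. c * (norm x)\<^sup>2 \<le> s x" using s_lower by blast
  have "norm y \<le> (1 + (1 / c) * w) * exp (s y / w)" if w: "w > 0" for w y
  proof -
    have 1: "norm y \<le> 1 + (norm y)\<^sup>2"
      using zero_le_power2[of "norm y - 1"] norm_ge_zero[of y]
      unfolding power2_eq_square left_diff_distrib right_diff_distrib by linarith
    have "(norm y)\<^sup>2 \<le> s y / c" using c(1) c(2)[of y] by (simp add: field_simps)
    moreover have "s y / w \<le> exp (s y / w)" using exp_ge_add_one_self[of "s y / w"] by linarith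
    then have "s y / c \<le> w * exp (s y / w) / c"
      using c(1) w by (intro divide_right_mono) (simp_all add: field_simps)
    moreover have "1 \<le> exp (s y / w)" using w s_nonneg[of y] by simp
    ultimately have "norm y \<le> exp (s y / w) + w * exp (s y / w) / c" using 1 by linarith
    then show ?thesis by (simp add: algebra_simps)
  qed
  then show ?thesis using c(1) by (intro exI[of _ "1 / c"]) auto
qed

text \<open>After the translation by \<open>m\<close> the first-order term is odd and integrates to zero.\<close>

lemma gauss_mean:
  assumes w: "0 < w"
  shows "(\<integral>\<theta>. exp (- s (\<theta> - m) / (2 * w)) *\<^sub>R \<theta> \<partial>lborel) = (sqrt w ^ CARD('k) * Z) *\<^sub>R m"
proof -
  obtain C where C: "C \<ge> 0" "\<And>w y. w > 0 \<Longrightarrow> norm y \<le> (1 + C * w) * exp (s y / w)"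
    using norm_le_exp by blast
  let ?f = "\<lambda>y. exp (- s y / (2 * w))"
  have int1: "integrable lborel ?f" and val: "(\<integral>y. ?f y \<partial>lborel) = sqrt w ^ CARD('k) * Z"
    using integrable_gauss[OF w, of 0] by simp_all
  have int2: "integrable lborel (\<lambda>y. ?f y *\<^sub>R y)"
  proof (rule Bochner_Integration.integrable_bound)
    show "integrable lborel (\<lambda>y. (1 + C * (4 * w)) * exp (- s y / (2 * (2 * w))))"
      using integrable_gauss(1)[of "2 * w" 0] w by (intro integrable_mult_right) simp
    show "AE y in lborel. norm (?f y *\<^sub>R y) \<le> norm ((1 + C * (4 * w)) * exp (- s y / (2 * (2 * w))))"
    proof (rule AE_I2)
      fix y
      have "?f y * norm y \<le> ?f y * ((1 + C * (4 * w)) * exp (s y / (4 * w)))"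
        using w by (intro mult_left_mono C(2)) auto
      also have "\<dots> = (1 + C * (4 * w)) * (?f y * exp (s y / (4 * w)))" by simp
      also have "?f y * exp (s y / (4 * w)) = exp (- s y / (2 * (2 * w)))"
        by (simp add: exp_add[symmetric] field_simps)
      finally show "norm (?f y *\<^sub>R y) \<le> norm ((1 + C * (4 * w)) * exp (- s y / (2 * (2 * w))))"
        using C(1) w by simp
    qed
  qed simp
  have "(\<integral>\<theta>. exp (- s (\<theta> - m) / (2 * w)) *\<^sub>R \<theta> \<partial>lborel) = (\<integral>y. ?f y *\<^sub>R (m + y) \<partial>lborel)"
    using lborel_integral_translate[of "\<lambda>\<theta>. exp (- s (\<theta> - m) / (2 * w)) *\<^sub>R \<theta>" m] by simp
  also have "\<dots> = (\<integral>y. ?f y *\<^sub>R m \<partial>lborel) + (\<integral>y. ?f y *\<^sub>R y \<partial>lborel)"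
    unfolding scaleR_right_distrib by (rule Bochner_Integration.integral_add) (use int1 int2 in simp_all)
  also have "(\<integral>y. ?f y *\<^sub>R y \<partial>lborel) = 0"
    by (rule lborel_integral_odd) (simp_all add: s_minus)
  also have "(\<integral>y. ?f y *\<^sub>R m \<partial>lborel) = (\<integral>y. ?f y \<partial>lborel) *\<^sub>R m"
    using int1 by simp
  finally show ?thesis unfolding val by simp
qed

end

text \<open>The shrinkage factor \<open>\<kappa>\<close> of the squared local scale \<open>u\<close>.\<close>

definition shrink :: "real \<Rightarrow> real \<Rightarrow> real" where
  "shrink t u = 1 / (1 + u * t)"

locale scale_mixture = pd_matrix S for S :: "real^'k^'k" +
  fixes p :: "real \<Rightarrow> real"
  assumes p_meas[measurable]: "p \<in> borel_measurable borel"
    and p_nonneg: "\<And>u. 0 \<le> p u"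
    and p_zero: "\<And>u. u \<le> 0 \<Longrightarrow> p u = 0"
    and p_one: "(\<integral>\<^sup>+u. ennreal (p u) \<partial>lborel) = 1"
begin

text \<open>Up to the factor \<open>1 / Z\<close>, the density at \<open>x\<close> of the marginal law N(0, (1 + u t) S) given \<open>u\<close>, as a function of
\<open>r = s x\<close> only.  Hence \<open>evidence\<close> is proportional to the marginal density of \<open>x\<close>, and \<open>weight\<close> below is the posterior
expectation of \<open>1 - \<kappa>\<close>.\<close>

definition kernel :: "real \<Rightarrow> real \<Rightarrow> real \<Rightarrow> real" where
  "kernel t r u = sqrt (shrink t u) ^ CARD('k) * exp (- r * shrink t u / 2)"

definition evidence :: "real \<Rightarrow> real \<Rightarrow> real" where
  "evidence t r = (\<integral>u. kernel t r u * p u \<partial>lborel)"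

definition weight :: "real \<Rightarrow> real \<Rightarrow> real" where
  "weight t r = (\<integral>u. (1 - shrink t u) * kernel t r u * p u \<partial>lborel) / evidence t r"

lemma shrink_measurable[measurable]: "shrink t \<in> borel_measurable borel"
  unfolding shrink_def by measurable

lemma kernel_measurable[measurable]: "kernel t r \<in> borel_measurable borel"
  unfolding kernel_def by measurable

lemma joint_density_eq:
  assumes t: "0 < t"
  shows "joint_density S p t x \<theta> u =
    exp (- s (x - \<theta>) / 2) / Z *
    ((if 0 < u then exp (- s \<theta> / (2 * (u * t))) / (sqrt (u * t) ^ CARD('k) * Z) else 0) * p u)"
  using t by (auto simp: joint_density_def mvn_density_eq mvn_density_scaled p_zero)

text \<open>The joint prior density of \<open>(\<theta>, u)\<close> has total mass 1; it dominates, up to constants depending on \<open>x\<close>, all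
integrands on the product space below, which justifies Fubini's theorem.\<close>

lemma prior_predictive_integrable:
  assumes t: "0 < t"
  shows "integrable (lborel :: ((real^'k) \<times> real) measure) (\<lambda>(\<theta>, u).
    (if 0 < u then exp (- s \<theta> / (2 * (u * t))) / (sqrt (u * t) ^ CARD('k) * Z) else 0) * p u)"
    (is "integrable _ (\<lambda>(\<theta>, u). ?h \<theta> u)")
proof (rule integrableI_nonneg)
  have meas: "(\<lambda>(\<theta>, u). ?h \<theta> u) \<in> borel_measurable (borel \<Otimes>\<^sub>M borel)" by measurable
  then show m: "(\<lambda>(\<theta>, u). ?h \<theta> u) \<in> borel_measurable lborel"
    by (simp add: borel_prod)
  show "AE z in lborel. 0 \<le> (case z of (\<theta>, u) \<Rightarrow> ?h \<theta> u)"
    using t Z_pos p_nonneg by (intro AE_I2) (auto split: prod.split)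
  have "(\<integral>\<^sup>+z. ennreal (case z of (\<theta>, u) \<Rightarrow> ?h \<theta> u) \<partial>(lborel :: ((real^'k) \<times> real) measure)) =
      (\<integral>\<^sup>+u. (\<integral>\<^sup>+\<theta>. ennreal (?h \<theta> u) \<partial>lborel) \<partial>lborel)"
    using lborel_pair.nn_integral_snd[of "\<lambda>z. ennreal (case z of (\<theta>, u) \<Rightarrow> ?h \<theta> u)"] m
    unfolding lborel_prod by simp
  also have "\<dots> = (\<integral>\<^sup>+u. ennreal (p u) \<partial>lborel)"
  proof (rule nn_integral_cong)
    fix u :: real
    show "(\<integral>\<^sup>+\<theta>. ennreal (?h \<theta> u) \<partial>lborel) = ennreal (p u)"
    proof (cases "0 < u")
      case True
      then have v: "0 < u * t" using t by simp
      define c where "c = sqrt (u * t) ^ CARD('k) * Z"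
      have c: "0 < c" using v Z_pos by (simp add: c_def)
      have "(\<integral>\<^sup>+\<theta>. ennreal (?h \<theta> u) \<partial>lborel) =
          (\<integral>\<^sup>+\<theta>. ennreal (p u / c) * ennreal (exp (- s \<theta> / (2 * (u * t)))) \<partial>lborel)"
        using True c p_nonneg by (intro nn_integral_cong) (simp add: c_def[symmetric] ennreal_mult[symmetric])
      also have "\<dots> = ennreal (p u / c) * ennreal c"
        by (subst nn_integral_cmult, simp, subst nn_integral_gauss_half[OF v]) (simp add: c_def)
      also have "\<dots> = ennreal (p u)" using c p_nonneg[of u] by (simp add: ennreal_mult[symmetric])
      finally show ?thesis .
    qed (simp add: p_zero)
  qed
  finally show "(\<integral>\<^sup>+z. ennreal (case z of (\<theta>, u) \<Rightarrow> ?h \<theta> u) \<partial>(lborel :: ((real^'k) \<times> real) measure)) < \<infinity>"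
    by (simp add: p_one)
qed

text \<open>The likelihood stays bounded even after multiplication by \<open>norm \<theta>\<close>: as \<open>\<theta>\<close> moves away from \<open>x\<close>, the factor
\<open>exp (- s (x - \<theta>) / 2)\<close> compensates the growth of \<open>norm \<theta>\<close>.\<close>

lemma joint_density_integrable:
  assumes t: "0 < t"
  shows "integrable (lborel :: ((real^'k) \<times> real) measure) (\<lambda>(\<theta>, u). joint_density S p t x \<theta> u)"
    and "integrable (lborel :: ((real^'k) \<times> real) measure) (\<lambda>(\<theta>, u). joint_density S p t x \<theta> u *\<^sub>R \<theta>)"
proof -
  let ?h = "\<lambda>(\<theta>::real^'k) (u::real). (if 0 < u then exp (- s \<theta> / (2 * (u * t))) / (sqrt (u * t) ^ CARD('k) * Z) else 0) * p u"
  have h0: "0 \<le> ?h \<theta> u" for \<theta> u using t Z_pos p_nonneg by auto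
  have hint: "integrable (lborel :: ((real^'k) \<times> real) measure) (\<lambda>(\<theta>, u). ?h \<theta> u)"
    by (rule prior_predictive_integrable[OF t])
  have meas: "(\<lambda>(\<theta>, u). joint_density S p t x \<theta> u) \<in> borel_measurable (borel \<Otimes>\<^sub>M borel)"
    unfolding joint_density_eq[OF t] by measurable
  then have meas1: "(\<lambda>(\<theta>, u). joint_density S p t x \<theta> u) \<in> borel_measurable lborel"
    by (simp add: borel_prod)
  have "(\<lambda>(\<theta>, u). joint_density S p t x \<theta> u *\<^sub>R \<theta>) \<in> borel_measurable (borel \<Otimes>\<^sub>M borel)"
    unfolding joint_density_eq[OF t] by measurable
  then have meas2: "(\<lambda>(\<theta>, u). joint_density S p t x \<theta> u *\<^sub>R \<theta>) \<in> borel_measurable lborel"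
    by (simp add: borel_prod)
  have "integrable lborel (\<lambda>z. (1 / Z) * (case z of (\<theta>, u) \<Rightarrow> ?h \<theta> u))"
    by (intro integrable_mult_right hint)
  then show "integrable (lborel :: ((real^'k) \<times> real) measure) (\<lambda>(\<theta>, u). joint_density S p t x \<theta> u)"
  proof (rule Bochner_Integration.integrable_bound[OF _ meas1], intro AE_I2, clarify)
    fix \<theta> :: "real^'k" and u :: real
    have le: "exp (- s (x - \<theta>) / 2) / Z * ?h \<theta> u \<le> 1 / Z * ?h \<theta> u"
      using Z_pos s_nonneg[of "x - \<theta>"] by (intro mult_right_mono divide_right_mono h0) simp_all
    have nn: "0 \<le> exp (- s (x - \<theta>) / 2) / Z * ?h \<theta> u"
      using Z_pos by (intro mult_nonneg_nonneg h0) simp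
    show "norm (joint_density S p t x \<theta> u) \<le> norm (1 / Z * ?h \<theta> u)"
      unfolding joint_density_eq[OF t] real_norm_def abs_of_nonneg[OF nn]
      by (rule order_trans[OF le abs_ge_self])
  qed
  obtain C where C: "C \<ge> 0" "\<And>w y. w > 0 \<Longrightarrow> norm y \<le> (1 + C * w) * exp (s y / w)"
    using norm_le_exp by blast
  define B where "B = (1 + C * 4) * exp (s x / 2) / Z"
  have "integrable lborel (\<lambda>z. B * (case z of (\<theta>, u) \<Rightarrow> ?h \<theta> u))"
    by (intro integrable_mult_right hint)
  then show "integrable (lborel :: ((real^'k) \<times> real) measure) (\<lambda>(\<theta>, u). joint_density S p t x \<theta> u *\<^sub>R \<theta>)"
  proof (rule Bochner_Integration.integrable_bound[OF _ meas2], intro AE_I2, clarify)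
    fix \<theta> :: "real^'k" and u :: real
    have "s \<theta> \<le> 2 * s (\<theta> - x) + 2 * s x" using s_add_le2[of "\<theta> - x" x] by simp
    moreover have "s (\<theta> - x) = s (x - \<theta>)" using s_minus[of "x - \<theta>"] by simp
    ultimately have e: "exp (- s (x - \<theta>) / 2) \<le> exp (s x / 2 - s \<theta> / 4)" by simp
    have "exp (- s (x - \<theta>) / 2) * norm \<theta> \<le> exp (s x / 2 - s \<theta> / 4) * ((1 + C * 4) * exp (s \<theta> / 4))"
      by (intro mult_mono e C(2)) simp_all
    also have "\<dots> = (1 + C * 4) * exp (s x / 2)"
      by (simp add: exp_diff)
    finally have b: "exp (- s (x - \<theta>) / 2) / Z * norm \<theta> \<le> B"
      using Z_pos by (simp add: B_def divide_right_mono)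
    have nn: "0 \<le> exp (- s (x - \<theta>) / 2) / Z * ?h \<theta> u"
      using Z_pos by (intro mult_nonneg_nonneg h0) simp
    have "norm (joint_density S p t x \<theta> u *\<^sub>R \<theta>) = (exp (- s (x - \<theta>) / 2) / Z * norm \<theta>) * ?h \<theta> u"
      unfolding joint_density_eq[OF t] norm_scaleR abs_of_nonneg[OF nn] by (simp only: mult_ac)
    also have "\<dots> \<le> B * ?h \<theta> u" by (intro mult_right_mono b h0)
    also have "\<dots> \<le> norm (B * ?h \<theta> u)" by simp
    finally show "norm (joint_density S p t x \<theta> u *\<^sub>R \<theta>) \<le> norm (B * ?h \<theta> u)" .
  qed
qed

lemma joint_density_section:
  assumes t: "0 < t"
  shows "(\<integral>\<theta>. joint_density S p t x \<theta> u \<partial>lborel) = kernel t (s x) u * p u / Z"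
    and "(\<integral>\<theta>. joint_density S p t x \<theta> u *\<^sub>R \<theta> \<partial>lborel)
      = ((1 - shrink t u) * kernel t (s x) u * p u / Z) *\<^sub>R x"
proof -
  have "(\<integral>\<theta>. joint_density S p t x \<theta> u \<partial>lborel) = kernel t (s x) u * p u / Z \<and>
      (\<integral>\<theta>. joint_density S p t x \<theta> u *\<^sub>R \<theta> \<partial>lborel)
      = ((1 - shrink t u) * kernel t (s x) u * p u / Z) *\<^sub>R x"
  proof (cases "0 < u")
    case False
    then have "p u = 0" by (simp add: p_zero)
    then show ?thesis by (simp add: joint_density_def)
  next
    case True
    define v where "v = u * t"
    have v: "0 < v" using True t by (simp add: v_def)
    define w where "w = v / (1 + v)"
    have w: "0 < w" using v by (simp add: w_def)
    have sh: "shrink t u = 1 / (1 + v)" by (simp add: shrink_def v_def)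
    have w1: "1 - shrink t u = w" unfolding sh using v by (simp add: w_def field_simps)
    define c where "c = exp (- s x / (2 * (1 + v))) / (Z * (sqrt v ^ CARD('k) * Z)) * p u"
    have joint: "joint_density S p t x \<theta> u = c * exp (- s (\<theta> - w *\<^sub>R x) / (2 * w))" for \<theta>
    proof -
      have "exp (- s (x - \<theta>) / 2) * exp (- s \<theta> / (2 * v)) = exp (- (s (x - \<theta>) + s \<theta> / v) / 2)"
        by (simp add: exp_add[symmetric] field_simps)
      also have "s (x - \<theta>) + s \<theta> / v = s (\<theta> - w *\<^sub>R x) / w + s x / (1 + v)"
        using s_complete_square[OF v, of x \<theta>] by (simp add: w_def mult.commute)
      also have "exp (- (s (\<theta> - w *\<^sub>R x) / w + s x / (1 + v)) / 2) =
          exp (- s x / (2 * (1 + v))) * exp (- s (\<theta> - w *\<^sub>R x) / (2 * w))"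
      proof -
        have "- (A / w + B / (1 + v)) / 2 = - B / (2 * (1 + v)) + - A / (2 * w)" for A B
          by (simp only: add_divide_distrib minus_add_distrib divide_divide_eq_left minus_divide_left mult.commute add.commute)
        then show ?thesis unfolding exp_add[symmetric] by simp
      qed
      finally show ?thesis
        unfolding joint_density_eq[OF t] c_def using True by (simp add: v_def[symmetric])
    qed
    have "sqrt w ^ CARD('k) / sqrt v ^ CARD('k) = sqrt (shrink t u) ^ CARD('k)"
      unfolding sh using v by (simp add: power_divide[symmetric] real_sqrt_divide[symmetric] w_def)
    then have sq: "sqrt (shrink t u) ^ CARD('k) = sqrt w ^ CARD('k) / sqrt v ^ CARD('k)" ..
    have cw: "c * (sqrt w ^ CARD('k) * Z) = kernel t (s x) u * p u / Z"
      unfolding kernel_def sq using Z_pos by (simp add: c_def sh mult_ac)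
    have "(\<integral>\<theta>. joint_density S p t x \<theta> u \<partial>lborel) = c * (sqrt w ^ CARD('k) * Z)"
      unfolding joint integral_mult_right_zero integrable_gauss(2)[OF w] ..
    moreover have "(\<integral>\<theta>. joint_density S p t x \<theta> u *\<^sub>R \<theta> \<partial>lborel) =
        (\<integral>\<theta>. c *\<^sub>R (exp (- s (\<theta> - w *\<^sub>R x) / (2 * w)) *\<^sub>R \<theta>) \<partial>lborel)"
      by (simp only: joint scaleR_scaleR)
    then have "(\<integral>\<theta>. joint_density S p t x \<theta> u *\<^sub>R \<theta> \<partial>lborel) = (c * (sqrt w ^ CARD('k) * Z)) *\<^sub>R (w *\<^sub>R x)"
      unfolding integral_scaleR_right gauss_mean[OF w] by simp
    ultimately show ?thesis unfolding cw w1 by (simp add: mult_ac)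
  qed
  then show "(\<integral>\<theta>. joint_density S p t x \<theta> u \<partial>lborel) = kernel t (s x) u * p u / Z"
    and "(\<integral>\<theta>. joint_density S p t x \<theta> u *\<^sub>R \<theta> \<partial>lborel)
      = ((1 - shrink t u) * kernel t (s x) u * p u / Z) *\<^sub>R x" by auto
qed

lemma shrink_bounds:
  assumes "0 < t" "0 < u"
  shows "0 < shrink t u" "shrink t u \<le> 1"
proof -
  have "0 < u * t" using assms by simp
  then show "0 < shrink t u" "shrink t u \<le> 1" by (simp_all add: shrink_def)
qed

lemma kernel_bounds:
  assumes "0 < t" "0 < u" "0 \<le> r"
  shows "0 < kernel t r u" "kernel t r u \<le> 1"
proof -
  note b = shrink_bounds[OF assms(1,2)]
  show "0 < kernel t r u" using b by (simp add: kernel_def)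
  have "sqrt (shrink t u) ^ CARD('k) \<le> 1" using b by (intro power_le_one) simp_all
  moreover have "exp (- r * shrink t u / 2) \<le> 1" using b assms(3) by simp
  ultimately show "kernel t r u \<le> 1"
    unfolding kernel_def using b by (intro mult_le_one) simp_all
qed

lemma integrable_p: "integrable lborel p"
  using p_one p_nonneg by (intro integrableI_nonneg) simp_all

lemma integral_p: "(\<integral>u. p u \<partial>lborel) = 1"
  using p_one p_nonneg by (simp add: integral_eq_nn_integral)

lemma integrable_weighted:
  assumes [measurable]: "f \<in> borel_measurable borel" and b: "\<And>u. 0 < u \<Longrightarrow> \<bar>f u\<bar> \<le> B"
  shows "integrable lborel (\<lambda>u. f u * p u)"
proof (rule Bochner_Integration.integrable_bound)
  show "integrable lborel (\<lambda>u. B * p u)" by (intro integrable_mult_right integrable_p)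
  show "AE u in lborel. norm (f u * p u) \<le> norm (B * p u)"
  proof (rule AE_I2)
    fix u
    show "norm (f u * p u) \<le> norm (B * p u)"
    proof (cases "0 < u")
      case True
      then show ?thesis using b[OF True] p_nonneg[of u] by (simp add: abs_mult mult_right_mono)
    qed (simp add: p_zero)
  qed
qed simp

text \<open>Fubini reduces both the marginal density and the numerator to integrals over \<open>u\<close>; the factors \<open>1 / Z\<close> cancel in
the quotient.\<close>

theorem posterior_mean_eq:
  assumes t: "0 < t"
  shows "posterior_mean S p t x = weight t (s x) *\<^sub>R x"
proof -
  have marg: "marginal_density S p t x = evidence t (s x) / Z"
  proof -
    have "marginal_density S p t x = (\<integral>u. (\<integral>\<theta>. joint_density S p t x \<theta> u \<partial>lborel) \<partial>lborel)"
      unfolding marginal_density_def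
      by (subst lborel_pair.integral_snd) (simp_all add: lborel_prod joint_density_integrable[OF t])
    then show ?thesis by (simp add: joint_density_section[OF t] evidence_def)
  qed
  define N where "N = (\<integral>u. (1 - shrink t u) * kernel t (s x) u * p u \<partial>lborel)"
  have num: "(\<integral>(\<theta>, u). joint_density S p t x \<theta> u *\<^sub>R \<theta> \<partial>lborel) = (N / Z) *\<^sub>R x"
  proof -
    have "(\<integral>(\<theta>, u). joint_density S p t x \<theta> u *\<^sub>R \<theta> \<partial>lborel) =
        (\<integral>u. (\<integral>\<theta>. joint_density S p t x \<theta> u *\<^sub>R \<theta> \<partial>lborel) \<partial>lborel)"
      by (subst lborel_pair.integral_snd) (simp_all add: lborel_prod joint_density_integrable[OF t])
    also have "\<dots> = (\<integral>u. ((1 - shrink t u) * kernel t (s x) u * p u / Z) *\<^sub>R x \<partial>lborel)"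
      by (simp add: joint_density_section[OF t])
    also have "\<dots> = (N / Z) *\<^sub>R x"
    proof -
      have "integrable lborel (\<lambda>u. ((1 - shrink t u) * kernel t (s x) u) * p u)"
      proof (rule integrable_weighted)
        fix u :: real assume "0 < u"
        note b = shrink_bounds[OF t this] kernel_bounds[OF t this s_nonneg, of x]
        show "\<bar>(1 - shrink t u) * kernel t (s x) u\<bar> \<le> 1"
          using b by (simp add: abs_mult mult_le_one)
      qed simp
      then show ?thesis by (simp add: N_def)
    qed
    finally show ?thesis .
  qed
  have "posterior_mean S p t x =
      (\<integral>z. (1 / marginal_density S p t x) *\<^sub>R (case z of (\<theta>, u) \<Rightarrow> joint_density S p t x \<theta> u *\<^sub>R \<theta>) \<partial>lborel)"
    unfolding posterior_mean_def posterior_density_def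
    by (intro Bochner_Integration.integral_cong) (auto split: prod.split)
  also have "\<dots> = (1 / marginal_density S p t x) *\<^sub>R ((N / Z) *\<^sub>R x)"
    by (simp add: num)
  also have "\<dots> = weight t (s x) *\<^sub>R x"
    using Z_pos by (simp add: marg weight_def N_def)
  finally show ?thesis .
qed

end

section \<open>Prior tails and the shrinkage weight\<close>

lemma nn_integral_powr_tail:
  fixes y a A :: real
  assumes "0 < y" "0 < a" "0 \<le> A"
  shows "(\<integral>\<^sup>+u. ennreal (A * u powr (- a - 1)) * indicator {y..} u \<partial>lborel) = ennreal (A / a * y powr (- a))"
proof -
  have "((\<lambda>u. - (A / a) * u powr (- a)) \<longlongrightarrow> - (A / a) * 0) at_top"
    using assms by (intro tendsto_mult_left tendsto_neg_powr filterlim_ident) simp_all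
  then have lim: "((\<lambda>u. - (A / a) * u powr (- a)) \<longlongrightarrow> 0) at_top" by simp
  have "(\<integral>\<^sup>+u. ennreal (A * u powr (- a - 1)) * indicator {y..} u \<partial>lborel) =
      ennreal (0 - (- (A / a) * y powr (- a)))"
  proof (rule nn_integral_FTC_atLeast[OF _ _ _ lim])
    fix x assume "y \<le> x"
    then have x: "0 < x" using assms by simp
    have "((\<lambda>u. - (A / a) * u powr (- a)) has_real_derivative - (A / a) * (- a * x powr (- a - 1))) (at x)"
      using x by (intro DERIV_cmult has_real_derivative_powr) 
    then show "((\<lambda>u. - (A / a) * u powr (- a)) has_real_derivative A * x powr (- a - 1)) (at x)"
      using assms by simp
    show "0 \<le> A * x powr (- a - 1)" using assms by simp
  qed simp
  then show ?thesis by simp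
qed

lemma has_bochner_integral_inverse:
  fixes y :: real
  assumes "1 \<le> y"
  shows "has_bochner_integral lborel (\<lambda>u. (1 / u) * indicator {1..y} u) (ln y)"
proof -
  have "has_bochner_integral lborel (\<lambda>u. (1 / u) * indicator {1..y} u) (ln y - ln 1)"
    by (rule has_bochner_integral_FTC_Icc_nonneg) (use assms in \<open>auto intro!: DERIV_ln_divide\<close>)
  then show ?thesis by simp
qed

text \<open>Power bounds on the prior density with the same exponent on both sides.  The upper one limits the mass beyond
\<open>y\<close> to order \<open>y powr (- a)\<close>; the lower one, valid beyond \<open>u0\<close>, puts mass of that order between \<open>y\<close> and
\<open>2 y\<close>.\<close>

locale power_tail_prior = scale_mixture S p for S :: "real^'k^'k" and p +
  fixes a A m u0 :: real
  assumes a_pos: "0 < a" and A_pos: "0 < A" and m_pos: "0 < m" and u0_nonneg: "0 \<le> u0"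
    and p_upper: "\<And>u. 0 < u \<Longrightarrow> p u \<le> A * u powr (- a - 1)"
    and p_lower: "\<And>u. u0 < u \<Longrightarrow> m * u powr (- a - 1) \<le> p u"
begin

lemma tail_upper:
  assumes y: "0 < y"
  shows "(\<integral>u. indicator {y..} u * p u \<partial>lborel) \<le> A / a * y powr (- a)"
proof -
  have "(\<integral>\<^sup>+u. ennreal (indicator {y..} u * p u) \<partial>lborel) \<le>
      (\<integral>\<^sup>+u. ennreal (A * u powr (- a - 1)) * indicator {y..} u \<partial>lborel)"
    using y p_upper by (intro nn_integral_mono) (auto simp: indicator_def intro!: ennreal_leI)
  then have "(\<integral>\<^sup>+u. ennreal (indicator {y..} u * p u) \<partial>lborel) \<le> ennreal (A / a * y powr (- a))"
    using nn_integral_powr_tail[OF y a_pos, of A] A_pos by simp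
  then show ?thesis
    using a_pos A_pos p_nonneg by (subst integral_eq_nn_integral) (auto intro!: enn2real_leI)
qed

lemma tail_lower:
  assumes y: "0 < y" "u0 \<le> y"
  shows "m * 2 powr (- a - 1) * y powr (- a) \<le> (\<integral>u. indicator {y<..2 * y} u * p u \<partial>lborel)"
proof -
  define c where "c = m * (2 * y) powr (- a - 1)"
  have "m * 2 powr (- a - 1) * y powr (- a) = c * y"
    using y by (simp add: c_def powr_mult powr_diff powr_minus)
  also have "\<dots> = (\<integral>u. indicator {y<..2 * y} u * c \<partial>lborel)"
    using y by simp
  also have "\<dots> \<le> (\<integral>u. indicator {y<..2 * y} u * p u \<partial>lborel)"
  proof (rule integral_mono)
    show "integrable lborel (\<lambda>u. indicator {y<..2 * y} u * c)"
      using y by (intro integrable_mult_left integrable_real_indicator) (simp_all add: emeasure_lborel_Ioc)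
    show "integrable lborel (\<lambda>u. indicator {y<..2 * y} u * p u)"
      by (rule integrable_weighted[where B = 1]) (auto simp: indicator_def)
    fix u :: real
    have "c \<le> p u" if u: "y < u" "u \<le> 2 * y"
    proof -
      have "c \<le> m * u powr (- a - 1)"
        unfolding c_def using u y m_pos a_pos by (intro mult_left_mono powr_mono2') auto
      also have "\<dots> \<le> p u" using u y by (intro p_lower) simp
      finally show ?thesis .
    qed
    then show "indicator {y<..2 * y} u * c \<le> indicator {y<..2 * y} u * p u"
      by (auto simp: indicator_def)
  qed
  finally show ?thesis .
qed

text \<open>Otherwise \<open>tail_lower\<close> would give the interval from \<open>y\<close> to \<open>2 y\<close> prior mass of order \<open>y powr (- a)\<close> for arbitrarily
small \<open>y\<close>, which exceeds 1.\<close>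

lemma u0_pos: "0 < u0"
proof (rule ccontr)
  assume "\<not> 0 < u0"
  then have u0: "u0 = 0" using u0_nonneg by simp
  define c where "c = m * 2 powr (- a - 1)"
  have c: "0 < c" using m_pos by (simp add: c_def)
  have le: "c * y powr (- a) \<le> 1" if y: "0 < y" for y
  proof -
    have "c * y powr (- a) \<le> (\<integral>u. indicator {y<..2 * y} u * p u \<partial>lborel)"
      using tail_lower[of y] y u0 by (simp add: c_def)
    also have "\<dots> \<le> (\<integral>u. p u \<partial>lborel)"
      by (intro integral_mono integrable_p integrable_weighted[where B = 1])
        (auto simp: indicator_def p_nonneg)
    finally show ?thesis by (simp add: integral_p)
  qed
  \<comment> \<open>Solves \<open>c * y powr (- a) = 2\<close>.\<close>
  define y where "y = (c / 2) powr (1 / a)"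
  have "c * y powr (- a) = 2" using c a_pos by (simp add: y_def powr_powr powr_minus)
  moreover have "0 < y" using c by (simp add: y_def)
  ultimately show False using le[of y] by simp
qed

lemma one_minus_shrink:
  assumes "0 < t" "0 < u"
  shows "0 \<le> 1 - shrink t u" "1 - shrink t u \<le> 1" "1 - shrink t u \<le> u * t"
proof -
  show "0 \<le> 1 - shrink t u" "1 - shrink t u \<le> 1"
    using shrink_bounds[OF assms] by simp_all
  have "0 < u * t" using assms by simp
  then have "1 - shrink t u = (u * t) / (1 + u * t)" by (simp add: shrink_def field_simps)
  also have "\<dots> \<le> u * t / 1" using \<open>0 < u * t\<close> by (intro divide_left_mono) simp_all
  finally show "1 - shrink t u \<le> u * t" by simp
qed

text \<open>For \<open>a \<le> 2\<close> and \<open>u t \<le> 1\<close> one has \<open>(1 - \<kappa>)\<^sup>2 \<le> (u t)\<^sup>2 \<le> (u t) powr a\<close>.  Against \<open>A u powr (- a - 1)\<close> this is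
\<open>A t powr a / u\<close>, which produces the logarithm between \<open>u = 1\<close> and \<open>u = 1 / t\<close>; the pieces \<open>u \<le> 1\<close> and
\<open>u \<ge> 1 / t\<close> contribute \<open>t powr a\<close> each.\<close>

lemma squared_weight_prior_mean:
  assumes t: "0 < t" "t < 1" and a2: "a \<le> 2"
  shows "(\<integral>u. (1 - shrink t u)\<^sup>2 * p u \<partial>lborel) \<le> (1 + A + A / a) * (t powr a * (1 + ln (1 / t)))"
proof -
  let ?f = "\<lambda>u. t powr a * p u + (A * t powr a) * ((1 / u) * indicator {1..1 / t} u) + indicator {1 / t..} u * p u"
  have i1: "integrable lborel (\<lambda>u. t powr a * p u)" by (intro integrable_mult_right integrable_p)
  have lnt: "has_bochner_integral lborel (\<lambda>u. (1 / u) * indicator {1..1 / t} u) (ln (1 / t))"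
    using t by (intro has_bochner_integral_inverse) simp
  have i2: "integrable lborel (\<lambda>u. (A * t powr a) * ((1 / u) * indicator {1..1 / t} u))"
    using lnt by (intro integrable_mult_right) (simp add: has_bochner_integral_iff)
  have i3: "integrable lborel (\<lambda>u. indicator {1 / t..} u * p u)"
    by (rule integrable_weighted[where B = 1]) (auto simp: indicator_def)
  have "(\<integral>u. (1 - shrink t u)\<^sup>2 * p u \<partial>lborel) \<le> (\<integral>u. ?f u \<partial>lborel)"
  proof (rule integral_mono)
    show "integrable lborel (\<lambda>u. (1 - shrink t u)\<^sup>2 * p u)"
    proof (rule integrable_weighted[where B = 1])
      fix u :: real assume "0 < u"
      then show "\<bar>(1 - shrink t u)\<^sup>2\<bar> \<le> 1"
        using one_minus_shrink[OF t(1)] by (simp add: power_le_one)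
    qed simp
    show "integrable lborel ?f" using i1 i2 i3 by (intro Bochner_Integration.integrable_add)
    fix u :: real
    have nn: "0 \<le> t powr a * p u" "0 \<le> (A * t powr a) * ((1 / u) * indicator {1..1 / t} u)"
      "0 \<le> indicator {1 / t..} u * p u"
      using p_nonneg A_pos by (auto simp: indicator_def)
    show "(1 - shrink t u)\<^sup>2 * p u \<le> ?f u"
    proof (cases "0 < u")
      case False
      then show ?thesis using nn by (simp add: p_zero)
    next
      case u: True
      note o = one_minus_shrink[OF t(1) u]
      show ?thesis
      proof (cases "u < 1 / t")
        case False
        have "(1 - shrink t u)\<^sup>2 * p u \<le> 1 * p u"
          using o p_nonneg by (intro mult_right_mono) (simp_all add: power_le_one)
        also have "\<dots> = indicator {1 / t..} u * p u" using False by simp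
        finally show ?thesis using nn by linarith
      next
        case True
        then have ut: "0 < u * t" "u * t \<le> 1" using u t by (simp_all add: field_simps)
        have "(1 - shrink t u)\<^sup>2 \<le> (u * t)\<^sup>2" using o by (intro power_mono)
        also have "\<dots> = (u * t) powr 2" using ut by (simp add: powr_numeral)
        also have "\<dots> \<le> (u * t) powr a" using ut a2 by (intro powr_mono') simp_all
        also have "\<dots> = t powr a * u powr a" using u t by (simp add: powr_mult)
        finally have sq: "(1 - shrink t u)\<^sup>2 \<le> t powr a * u powr a" .
        show ?thesis
        proof (cases "u \<le> 1")
          case True
          then have "u powr a \<le> 1" using u a_pos by (intro powr_le1) simp_all
          then have "t powr a * u powr a \<le> t powr a" by (simp add: mult_left_le)
          then have "(1 - shrink t u)\<^sup>2 * p u \<le> t powr a * p u"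
            using sq by (intro mult_right_mono p_nonneg) simp
          then show ?thesis using nn by linarith
        next
          case False
          have "(1 - shrink t u)\<^sup>2 * p u \<le> (t powr a * u powr a) * (A * u powr (- a - 1))"
            using sq p_upper[OF u] p_nonneg by (intro mult_mono) simp_all
          also have "\<dots> = (A * t powr a) * (u powr a * u powr (- a - 1))" by simp
          also have "u powr a * u powr (- a - 1) = 1 / u"
            unfolding powr_add[symmetric] using u by (simp add: powr_minus_divide)
          also have "(A * t powr a) * (1 / u) = (A * t powr a) * ((1 / u) * indicator {1..1 / t} u)"
            using False \<open>u < 1 / t\<close> by simp
          finally show ?thesis using nn by linarith
        qed
      qed
    qed
  qed
  also have "\<dots> = (\<integral>u. t powr a * p u \<partial>lborel) +
      (\<integral>u. (A * t powr a) * ((1 / u) * indicator {1..1 / t} u) \<partial>lborel) + (\<integral>u. indicator {1 / t..} u * p u \<partial>lborel)"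
    by (simp only: Bochner_Integration.integral_add i1 i2 i3 Bochner_Integration.integrable_add)
  also have "\<dots> = t powr a + A * t powr a * ln (1 / t) + (\<integral>u. indicator {1 / t..} u * p u \<partial>lborel)"
    by (simp only: integral_mult_right_zero has_bochner_integral_integral_eq[OF lnt] integral_p mult_1_right)
  also have "\<dots> \<le> t powr a + A * t powr a * ln (1 / t) + A / a * t powr a"
    using tail_upper[of "1 / t"] t by (simp add: powr_divide powr_minus)
  also have "\<dots> = t powr a * (1 + A * ln (1 / t) + A / a)" by (simp add: algebra_simps)
  also have "\<dots> \<le> t powr a * ((1 + A + A / a) * (1 + ln (1 / t)))"
  proof (intro mult_left_mono)
    have l: "0 \<le> ln (1 / t)" using t by simp
    have "0 \<le> ln (1 / t) + A + A / a * ln (1 / t)" using l A_pos a_pos by (intro add_nonneg_nonneg mult_nonneg_nonneg) auto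
    then show "1 + A * ln (1 / t) + A / a \<le> (1 + A + A / a) * (1 + ln (1 / t))"
      by (simp add: algebra_simps)
  qed simp
  finally show ?thesis by (simp add: mult_ac)
qed

lemma integrable_kernel:
  assumes t: "0 < t" and r: "0 \<le> r" and [measurable]: "f \<in> borel_measurable borel"
    and f: "\<And>u. 0 < u \<Longrightarrow> \<bar>f u\<bar> \<le> 1"
  shows "integrable lborel (\<lambda>u. f u * kernel t r u * p u)"
proof (rule integrable_weighted[where B = 1])
  fix u :: real assume u: "0 < u"
  then show "\<bar>f u * kernel t r u\<bar> \<le> 1"
    using f[OF u] kernel_bounds[OF t u r] by (simp add: abs_mult mult_le_one)
qed simp

lemma integrable_kernel_one:
  assumes t: "0 < t" and r: "0 \<le> r"
  shows "integrable lborel (\<lambda>u. kernel t r u * p u)"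
  using integrable_kernel[OF t r, of "\<lambda>_. 1"] by simp

lemma integrable_kernel_shrink:
  assumes t: "0 < t" and r: "0 \<le> r"
  shows "integrable lborel (\<lambda>u. shrink t u * kernel t r u * p u)"
    and "integrable lborel (\<lambda>u. (1 - shrink t u) * kernel t r u * p u)"
    and "integrable lborel (\<lambda>u. (1 - shrink t u)\<^sup>2 * kernel t r u * p u)"
  using shrink_bounds[OF t] one_minus_shrink[OF t]
  by (intro integrable_kernel[OF t r]; simp add: abs_le_iff power_le_one less_imp_le)+

text \<open>For \<open>t < 1\<close> the kernel is at least \<open>exp (- r / 2)\<close> times its value at \<open>t = 1\<close>, \<open>r = 0\<close>.  This is the contribution of
scales that shrink completely.\<close>

lemma evidence_lower:
  "\<exists>c>0. \<forall>t r. 0 < t \<longrightarrow> t < 1 \<longrightarrow> 0 \<le> r \<longrightarrow> c * exp (- r / 2) \<le> evidence t r"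
proof -
  define c where "c = (\<integral>u. kernel 1 0 u * p u \<partial>lborel)"
  have nn: "0 \<le> kernel 1 0 u * p u" for u
    using kernel_bounds(1)[of 1 u 0] p_nonneg[of u] p_zero[of u] by (cases "0 < u") auto
  then have c0: "0 \<le> c" by (simp add: c_def)
  have "c \<noteq> 0"
  proof
    assume "c = 0"
    then have "AE u in lborel. kernel 1 0 u * p u = 0"
      unfolding c_def using integrable_kernel_one[of 1 0] nn
      by (subst (asm) integral_nonneg_eq_0_iff_AE) auto
    then have "AE u in lborel. p u = 0"
    proof (rule AE_mp, intro AE_I2 impI)
      fix u assume "kernel 1 0 u * p u = 0"
      then show "p u = 0" using kernel_bounds(1)[of 1 u 0] p_zero[of u] by (cases "0 < u") auto
    qed
    then have "(\<integral>u. p u \<partial>lborel) = 0" by (simp add: integral_eq_zero_AE)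
    then show False by (simp add: integral_p)
  qed
  moreover have "c * exp (- r / 2) \<le> evidence t r" if t: "0 < t" "t < 1" and r: "0 \<le> r" for t r
  proof -
    have "c * exp (- r / 2) = (\<integral>u. exp (- r / 2) * (kernel 1 0 u * p u) \<partial>lborel)"
      by (simp add: c_def)
    also have "\<dots> \<le> (\<integral>u. kernel t r u * p u \<partial>lborel)"
    proof (rule integral_mono)
      show "integrable lborel (\<lambda>u. exp (- r / 2) * (kernel 1 0 u * p u))"
        by (intro integrable_mult_right integrable_kernel_one) simp_all
      show "integrable lborel (\<lambda>u. kernel t r u * p u)" using t r by (intro integrable_kernel_one)
      fix u :: real
      show "exp (- r / 2) * (kernel 1 0 u * p u) \<le> kernel t r u * p u"
      proof (cases "0 < u")
        case True
        have "u * t \<le> u * 1" using True t by (intro mult_left_mono) simp_all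
        then have "shrink 1 u \<le> shrink t u"
          unfolding shrink_def using True t by (intro divide_left_mono) (simp_all add: add_pos_pos)
        moreover have "r * shrink t u \<le> r"
          using shrink_bounds[OF t(1) True] r by (simp add: mult_left_le)
        ultimately have "sqrt (shrink 1 u) ^ CARD('k) * exp (- r / 2) \<le> kernel t r u"
          unfolding kernel_def using shrink_bounds[of 1 u] True
          by (intro mult_mono power_mono) simp_all
        then have "(sqrt (shrink 1 u) ^ CARD('k) * exp (- r / 2)) * p u \<le> kernel t r u * p u"
          by (intro mult_right_mono p_nonneg)
        then show ?thesis by (simp add: kernel_def mult_ac)
      qed (simp add: p_zero)
    qed
    finally show ?thesis by (simp add: evidence_def)
  qed
  ultimately show ?thesis using c0 by (intro exI[of _ c]) simp
qed

lemma evidence_pos: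
  assumes t: "0 < t" "t < 1" and r: "0 \<le> r"
  shows "0 < evidence t r"
proof -
  obtain c where "c > 0" "c * exp (- r / 2) \<le> evidence t r" using evidence_lower assms by blast
  moreover from this have "0 < c * exp (- r / 2)" by simp
  ultimately show ?thesis by linarith
qed

lemma one_minus_weight:
  assumes t: "0 < t" "t < 1" and r: "0 \<le> r"
  shows "1 - weight t r = (\<integral>u. shrink t u * kernel t r u * p u \<partial>lborel) / evidence t r"
proof -
  note D = evidence_pos[OF assms]
  have "(\<integral>u. (1 - shrink t u) * kernel t r u * p u \<partial>lborel) =
      (\<integral>u. kernel t r u * p u - shrink t u * kernel t r u * p u \<partial>lborel)"
    by (simp add: algebra_simps)
  also have "\<dots> = evidence t r - (\<integral>u. shrink t u * kernel t r u * p u \<partial>lborel)"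
    unfolding evidence_def using integrable_kernel_one[OF t(1) r] integrable_kernel_shrink(1)[OF t(1) r]
    by (rule Bochner_Integration.integral_diff)
  finally show ?thesis using D by (simp add: weight_def diff_divide_distrib)
qed

lemma kernel_p_nonneg: "0 < t \<Longrightarrow> 0 \<le> r \<Longrightarrow> 0 \<le> kernel t r u * p u"
  using kernel_bounds(1)[of t u r] p_nonneg[of u] p_zero[of u] by (cases "0 < u") auto

lemma weight_bounds:
  assumes t: "0 < t" "t < 1" and r: "0 \<le> r"
  shows "0 \<le> weight t r" "weight t r \<le> 1"
proof -
  note D = evidence_pos[OF assms]
  have "0 \<le> (1 - shrink t u) * kernel t r u * p u" for u
    using kernel_p_nonneg[OF t(1) r, of u] one_minus_shrink(1)[OF t(1), of u] p_zero[of u]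
    by (cases "0 < u") (auto simp: mult.assoc)
  then show "0 \<le> weight t r" using D by (simp add: weight_def integral_nonneg)
  have "0 \<le> shrink t u * kernel t r u * p u" for u
    using kernel_p_nonneg[OF t(1) r, of u] shrink_bounds(1)[OF t(1), of u] p_zero[of u]
    by (cases "0 < u") (auto simp: mult.assoc)
  then have "0 \<le> 1 - weight t r" using D by (simp add: one_minus_weight[OF assms] integral_nonneg)
  then show "weight t r \<le> 1" by simp
qed

text \<open>Jensen's inequality for the posterior law of \<open>u\<close>, obtained from the nonnegative posterior variance of \<open>1 - \<kappa>\<close>.\<close>

lemma weight_squared_le:
  assumes t: "0 < t" "t < 1" and r: "0 \<le> r"
  shows "(weight t r)\<^sup>2 \<le> (\<integral>u. (1 - shrink t u)\<^sup>2 * kernel t r u * p u \<partial>lborel) / evidence t r"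
proof -
  note D = evidence_pos[OF assms]
  define w where "w = weight t r"
  define N1 where "N1 = (\<integral>u. (1 - shrink t u) * kernel t r u * p u \<partial>lborel)"
  define N2 where "N2 = (\<integral>u. (1 - shrink t u)\<^sup>2 * kernel t r u * p u \<partial>lborel)"
  note i = integrable_kernel_one[OF t(1) r] integrable_kernel_shrink[OF t(1) r]
  have N1: "N1 = w * evidence t r" using D by (simp add: w_def weight_def N1_def)
  have "0 \<le> (\<integral>u. (1 - shrink t u - w)\<^sup>2 * (kernel t r u * p u) \<partial>lborel)"
    using kernel_p_nonneg[OF t(1) r] by (intro Bochner_Integration.integral_nonneg) simp
  also have "\<dots> = (\<integral>u. (1 - shrink t u)\<^sup>2 * kernel t r u * p u -
      2 * w * ((1 - shrink t u) * kernel t r u * p u) + w\<^sup>2 * (kernel t r u * p u) \<partial>lborel)"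
    by (intro Bochner_Integration.integral_cong) (simp_all add: power2_eq_square algebra_simps)
  also have "\<dots> = N2 - 2 * w * N1 + w\<^sup>2 * evidence t r"
    unfolding N1_def N2_def evidence_def using i by simp
  also have "\<dots> = N2 - w\<^sup>2 * evidence t r" by (simp add: N1 power2_eq_square)
  finally have "w\<^sup>2 \<le> N2 / evidence t r" using D by (simp add: pos_le_divide_eq)
  then show ?thesis by (simp only: w_def N2_def)
qed

lemma weight_measurable[measurable]: "weight t \<in> borel_measurable borel"
proof -
  have [measurable]: "(\<lambda>z. kernel t (fst z) (snd z)) \<in> borel_measurable (borel \<Otimes>\<^sub>M borel)"
    unfolding kernel_def by measurable
  have 1: "(\<lambda>r. \<integral>u. kernel t r u * p u \<partial>lborel) \<in> borel_measurable borel"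
    by (rule lborel.borel_measurable_lebesgue_integral) (simp add: case_prod_beta')
  have 2: "(\<lambda>r. \<integral>u. (1 - shrink t u) * kernel t r u * p u \<partial>lborel) \<in> borel_measurable borel"
    by (rule lborel.borel_measurable_lebesgue_integral) (simp add: case_prod_beta')
  show ?thesis unfolding weight_def[abs_def] evidence_def using 1 2 by measurable
qed

end

section \<open>Risk at a zero mean\<close>

text \<open>From \<open>ln z \<le> z - 1\<close> at \<open>z = \<beta> x / q\<close>.\<close>

lemma powr_exp_bounded:
  fixes \<beta> q :: real
  assumes "0 < \<beta>" "0 < q"
  shows "\<exists>B\<ge>0. \<forall>x>0. x powr q * exp (- \<beta> * x) \<le> B"
proof (intro exI conjI allI impI)
  show "0 \<le> exp (- q - q * ln (\<beta> / q))" by simp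
  fix x :: real assume x: "0 < x"
  have "ln (x * (\<beta> / q)) \<le> x * (\<beta> / q) - 1"
    using x assms by (intro ln_le_minus_one) simp
  then have "ln x + ln (\<beta> / q) \<le> x * (\<beta> / q) - 1"
    using x assms by (subst (asm) ln_mult) auto
  then have "q * (ln x + ln (\<beta> / q)) \<le> q * (x * (\<beta> / q) - 1)"
    using assms by (intro mult_left_mono) simp_all
  also have "q * (x * (\<beta> / q) - 1) = \<beta> * x - q" using assms by (simp add: right_diff_distrib)
  finally have "q * ln x - \<beta> * x \<le> - q - q * ln (\<beta> / q)" by (simp add: distrib_left)
  then show "x powr q * exp (- \<beta> * x) \<le> exp (- q - q * ln (\<beta> / q))"
    using x by (simp add: powr_def exp_add[symmetric])
qed

context power_tail_prior
begin

lemma loss_measurable[measurable]: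
  "(\<lambda>x. s (weight t (s x) *\<^sub>R x - \<theta>)) \<in> borel_measurable borel"
  by measurable

lemma mvn_expect_estimator:
  assumes t: "0 < t"
  shows "mvn_expect \<theta> S (\<lambda>x. s (posterior_mean S p t x - \<theta>)) =
    (\<integral>\<^sup>+z. ennreal (s (weight t (s (\<theta> + z)) *\<^sub>R (\<theta> + z) - \<theta>) * (exp (- s z / 2) / Z)) \<partial>lborel)"
  unfolding posterior_mean_eq[OF t] by (rule mvn_expect_eq) (simp_all add: s_nonneg)

text \<open>Here \<open>b\<close> is a free truncation level for \<open>s x\<close>.  Beyond it \<open>W \<le> 1\<close> and the Gaussian tail suffice.  Below it,
the standard normal density divided by the evidence is bounded, so that only the integral of
\<open>(1 - \<kappa>)\<^sup>2\<close> against prior and kernel remains, and the kernel integrates to \<open>Z\<close> over \<open>x\<close> for each fixed \<open>u\<close>.\<close>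

theorem risk_at_zero:
  assumes a2: "a \<le> 2"
  shows "\<exists>C\<ge>(0::real). \<forall>t b. 0 < t \<longrightarrow> t < 1 \<longrightarrow> 0 < b \<longrightarrow>
    mvn_expect 0 S (\<lambda>x. s (posterior_mean S p t x)) \<le>
      ennreal (C * (b * (t powr a * (1 + ln (1 / t))) + exp (- b / 4)))"
proof -
  obtain c0 where c0: "c0 > 0" "\<And>t r. 0 < t \<Longrightarrow> t < 1 \<Longrightarrow> 0 \<le> r \<Longrightarrow> c0 * exp (- r / 2) \<le> evidence t r"
    using evidence_lower by blast
  obtain C1 :: real where C1: "C1 \<ge> 0" "\<And>r. (\<integral>\<^sup>+z. ennreal (s z * indicator {z. r < s z} z * (exp (- s z / 2) / Z)) \<partial>lborel)
      \<le> ennreal (C1 * exp (- r / 4))"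
    using second_moment_tail by blast
  define C2 where "C2 = (1 + A + A / a) / c0"
  have C2: "C2 > 0" using A_pos a_pos c0 by (simp add: C2_def add_pos_pos)
  define C where "C = C1 + C2"
  have "mvn_expect 0 S (\<lambda>x. s (posterior_mean S p t x)) \<le>
      ennreal (C * (b * (t powr a * (1 + ln (1 / t))) + exp (- b / 4)))"
    if t: "0 < t" "t < 1" and b: "0 < b" for t b
  proof -
    let ?N = "\<lambda>r. \<integral>u. (1 - shrink t u)\<^sup>2 * kernel t r u * p u \<partial>lborel"
    let ?T = "\<lambda>z. s z * indicator {z. b < s z} z * (exp (- s z / 2) / Z)"
    have [measurable]: "(\<lambda>z. kernel t (fst z) (snd z)) \<in> borel_measurable (borel \<Otimes>\<^sub>M borel)"
      unfolding kernel_def by measurable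
    have [measurable]: "(\<lambda>w. kernel t (s (snd w)) (fst w)) \<in> borel_measurable (borel \<Otimes>\<^sub>M borel)"
      unfolding kernel_def by measurable
    have nn: "0 \<le> (1 - shrink t u)\<^sup>2 * kernel t (s z) u * p u" for z u
      using kernel_p_nonneg[OF t(1) s_nonneg, of z u] by (simp add: mult.assoc)
    have Nnn: "0 \<le> ?N (s z)" for z by (rule Bochner_Integration.integral_nonneg) (rule nn)
    have [measurable]: "(\<lambda>r. ?N r) \<in> borel_measurable borel"
      by (rule lborel.borel_measurable_lebesgue_integral) (simp add: case_prod_beta')
    \<comment> \<open>The first term will be integrated by Tonelli's theorem, the second is the Gaussian tail.\<close>
    have point: "s (weight t (s z) *\<^sub>R z) * (exp (- s z / 2) / Z) \<le> b / (c0 * Z) * ?N (s z) + ?T z" for z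
    proof (cases "b < s z")
      case True
      have "(weight t (s z))\<^sup>2 * s z \<le> 1 * s z"
        using weight_bounds[OF t s_nonneg, of z] s_nonneg[of z] by (intro mult_right_mono) (simp_all add: power_le_one)
      then have "s (weight t (s z) *\<^sub>R z) * (exp (- s z / 2) / Z) \<le> ?T z"
        using True Z_pos by (simp add: s_scaleR mult_right_mono divide_right_mono)
      moreover have "0 \<le> b / (c0 * Z) * ?N (s z)" using b c0(1) Z_pos Nnn by simp
      ultimately show ?thesis by linarith
    next
      case False
      have e: "c0 * exp (- s z / 2) \<le> evidence t (s z)" using c0(2)[OF t s_nonneg] .
      have ep: "0 < c0 * exp (- s z / 2)" using c0(1) by simp
      have "(weight t (s z))\<^sup>2 \<le> ?N (s z) / evidence t (s z)"
        by (rule weight_squared_le[OF t s_nonneg])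
      also have "\<dots> \<le> ?N (s z) / (c0 * exp (- s z / 2))"
        using e ep c0(1) Nnn order_less_le_trans[OF ep e] by (intro divide_left_mono mult_pos_pos) auto
      finally have w: "(weight t (s z))\<^sup>2 \<le> ?N (s z) / (c0 * exp (- s z / 2))" .
      have "(weight t (s z))\<^sup>2 * s z \<le> ?N (s z) / (c0 * exp (- s z / 2)) * b"
        using False w Nnn[of z] s_nonneg[of z] ep by (intro mult_mono divide_nonneg_pos) auto
      then have "(weight t (s z))\<^sup>2 * s z * (exp (- s z / 2) / Z) \<le>
          ?N (s z) / (c0 * exp (- s z / 2)) * b * (exp (- s z / 2) / Z)"
        using Z_pos by (intro mult_right_mono) simp_all
      also have "\<dots> = b / (c0 * Z) * ?N (s z)" by simp
      finally show ?thesis using False by (simp add: s_scaleR)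
    qed
    have N_int: "(\<integral>\<^sup>+z. ennreal (?N (s z)) \<partial>lborel) \<le> ennreal (Z * ((1 + A + A / a) * (t powr a * (1 + ln (1 / t)))))"
    proof -
      have "(\<integral>\<^sup>+z. ennreal (?N (s z)) \<partial>lborel) =
          (\<integral>\<^sup>+z. (\<integral>\<^sup>+u. ennreal ((1 - shrink t u)\<^sup>2 * kernel t (s z) u * p u) \<partial>lborel) \<partial>lborel)"
        by (intro nn_integral_cong nn_integral_eq_integral[symmetric] integrable_kernel_shrink(3) t s_nonneg AE_I2 nn)
      also have "\<dots> = (\<integral>\<^sup>+u. (\<integral>\<^sup>+z. ennreal ((1 - shrink t u)\<^sup>2 * kernel t (s z) u * p u) \<partial>lborel) \<partial>lborel)"
        by (rule lborel_pair.Fubini') (simp add: case_prod_beta')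
      also have "\<dots> = (\<integral>\<^sup>+u. ennreal (Z * ((1 - shrink t u)\<^sup>2 * p u)) \<partial>lborel)"
      proof (rule nn_integral_cong)
        fix u :: real
        show "(\<integral>\<^sup>+z. ennreal ((1 - shrink t u)\<^sup>2 * kernel t (s z) u * p u) \<partial>lborel) =
            ennreal (Z * ((1 - shrink t u)\<^sup>2 * p u))"
        proof (cases "0 < u")
          case True
          define v where "v = 1 / shrink t u"
          have v: "0 < v" "shrink t u = 1 / v" using shrink_bounds[OF t(1) True] by (simp_all add: v_def)
          define c where "c = (1 - shrink t u)\<^sup>2 * p u * sqrt (shrink t u) ^ CARD('k)"
          have c: "0 \<le> c" using p_nonneg v by (simp add: c_def)
          have "(\<integral>\<^sup>+z. ennreal ((1 - shrink t u)\<^sup>2 * kernel t (s z) u * p u) \<partial>lborel) =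
              (\<integral>\<^sup>+z. ennreal c * ennreal (exp (- s z / (2 * v))) \<partial>lborel)"
            using c by (intro nn_integral_cong)
              (simp add: ennreal_mult[symmetric] kernel_def c_def v(2) mult_ac)
          also have "\<dots> = ennreal c * ennreal (sqrt v ^ CARD('k) * Z)"
            by (subst nn_integral_cmult, simp, subst nn_integral_gauss_half[OF v(1)]) simp
          also have "\<dots> = ennreal (c * (sqrt v ^ CARD('k) * Z))"
            using c v Z_pos by (simp add: ennreal_mult[symmetric])
          also have "c * (sqrt v ^ CARD('k) * Z) =
              (sqrt (shrink t u) * sqrt v) ^ CARD('k) * (Z * ((1 - shrink t u)\<^sup>2 * p u))"
            by (simp add: c_def power_mult_distrib mult_ac)
          also have "sqrt (shrink t u) * sqrt v = 1"
            unfolding real_sqrt_mult[symmetric] using v by simp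
          finally show ?thesis by simp
        qed (simp add: p_zero)
      qed
      also have "\<dots> = ennreal (Z * (\<integral>u. (1 - shrink t u)\<^sup>2 * p u \<partial>lborel))"
      proof -
        have i: "integrable lborel (\<lambda>u. (1 - shrink t u)\<^sup>2 * p u)"
        proof (rule integrable_weighted[where B = 1])
          fix u :: real assume "0 < u"
          then show "\<bar>(1 - shrink t u)\<^sup>2\<bar> \<le> 1"
            using one_minus_shrink[OF t(1)] by (simp add: power_le_one)
        qed simp
        show ?thesis
          using i p_nonneg Z_pos by (subst nn_integral_eq_integral) simp_all
      qed
      also have "\<dots> \<le> ennreal (Z * ((1 + A + A / a) * (t powr a * (1 + ln (1 / t)))))"
        using Z_pos squared_weight_prior_mean[OF t a2] by (intro ennreal_leI mult_left_mono) simp_all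
      finally show ?thesis .
    qed
    have "mvn_expect 0 S (\<lambda>x. s (posterior_mean S p t x)) =
        (\<integral>\<^sup>+z. ennreal (s (weight t (s z) *\<^sub>R z) * (exp (- s z / 2) / Z)) \<partial>lborel)"
      using mvn_expect_estimator[OF t(1), of 0] by simp
    also have "\<dots> \<le> (\<integral>\<^sup>+z. ennreal (b / (c0 * Z)) * ennreal (?N (s z)) + ennreal (?T z) \<partial>lborel)"
    proof (rule nn_integral_mono)
      fix z
      have T: "0 \<le> ?T z" using s_nonneg[of z] Z_pos by simp
      have c: "0 \<le> b / (c0 * Z)" using b c0(1) Z_pos by simp
      have "ennreal (s (weight t (s z) *\<^sub>R z) * (exp (- s z / 2) / Z)) \<le>
          ennreal (b / (c0 * Z) * ?N (s z) + ?T z)"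
        by (rule ennreal_leI[OF point])
      also have "\<dots> = ennreal (b / (c0 * Z) * ?N (s z)) + ennreal (?T z)"
        by (rule ennreal_plus[OF mult_nonneg_nonneg[OF c Nnn] T])
      also have "ennreal (b / (c0 * Z) * ?N (s z)) = ennreal (b / (c0 * Z)) * ennreal (?N (s z))"
        by (rule ennreal_mult[OF c Nnn])
      finally show "ennreal (s (weight t (s z) *\<^sub>R z) * (exp (- s z / 2) / Z)) \<le>
          ennreal (b / (c0 * Z)) * ennreal (?N (s z)) + ennreal (?T z)" .
    qed
    also have "\<dots> = ennreal (b / (c0 * Z)) * (\<integral>\<^sup>+z. ennreal (?N (s z)) \<partial>lborel) + (\<integral>\<^sup>+z. ennreal (?T z) \<partial>lborel)"
      by (subst nn_integral_add) (simp_all add: nn_integral_cmult)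
    also have "\<dots> \<le> ennreal (b / (c0 * Z)) * ennreal (Z * ((1 + A + A / a) * (t powr a * (1 + ln (1 / t))))) +
        ennreal (C1 * exp (- b / 4))"
      by (intro add_mono mult_left_mono N_int C1(2)) simp
    also have "\<dots> = ennreal (C2 * (b * (t powr a * (1 + ln (1 / t)))) + C1 * exp (- b / 4))"
    proof -
      have "0 \<le> ln (1 / t)" using t by simp
      then have l: "0 \<le> 1 + ln (1 / t)" by linarith
      have "ennreal (b / (c0 * Z)) * ennreal (Z * ((1 + A + A / a) * (t powr a * (1 + ln (1 / t))))) =
          ennreal (b / (c0 * Z) * (Z * ((1 + A + A / a) * (t powr a * (1 + ln (1 / t))))))"
        using b c0(1) Z_pos A_pos a_pos l by (subst ennreal_mult) (simp_all)
      also have "b / (c0 * Z) * (Z * ((1 + A + A / a) * (t powr a * (1 + ln (1 / t))))) =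
          C2 * (b * (t powr a * (1 + ln (1 / t))))"
        using Z_pos by (simp add: C2_def)
      finally show ?thesis
        using b C2 C1(1) l by (subst ennreal_plus) (simp_all add: mult_nonneg_nonneg)
    qed
    also have "\<dots> \<le> ennreal (C * (b * (t powr a * (1 + ln (1 / t))) + exp (- b / 4)))"
    proof (rule ennreal_leI)
      have "0 \<le> ln (1 / t)" using t by simp
      then have l: "0 \<le> b * (t powr a * (1 + ln (1 / t)))"
        using b by (intro mult_nonneg_nonneg add_nonneg_nonneg) simp_all
      have "0 \<le> C1 * (b * (t powr a * (1 + ln (1 / t)))) + C2 * exp (- b / 4)"
        by (intro add_nonneg_nonneg mult_nonneg_nonneg[OF C1(1) l]) (use C2 in simp)
      then show "C2 * (b * (t powr a * (1 + ln (1 / t)))) + C1 * exp (- b / 4)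
          \<le> C * (b * (t powr a * (1 + ln (1 / t))) + exp (- b / 4))"
        unfolding C_def distrib_right distrib_left by linarith
    qed
    finally show ?thesis .
  qed
  then show ?thesis using C1(1) C2 by (intro exI[of _ C]) (auto simp: C_def)
qed

end

section \<open>Upper bound on the risk at an arbitrary mean\<close>

context power_tail_prior
begin

text \<open>The contribution of the scales with \<open>u t\<close> between \<open>r\<close> and \<open>2 r\<close>: they have \<open>r \<kappa> \<le> 1\<close>, so they pay only a power of \<open>r\<close>
instead of \<open>exp (- r / 2)\<close>, besides their prior mass of order \<open>(t / r) powr a\<close>.\<close>

lemma evidence_polynomial_lower:
  "\<exists>c>0. \<forall>t r. 0 < t \<longrightarrow> 1 \<le> r \<longrightarrow> u0 * t \<le> r \<longrightarrow>
    c * t powr a * r powr (- (real CARD('k) / 2 + a)) \<le> evidence t r"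
proof -
  define k where "k = real CARD('k)"
  define c where "c = 3 powr (- k / 2) * exp (- 1 / 2) * (m * 2 powr (- a - 1))"
  have c: "0 < c" using m_pos by (simp add: c_def)
  have "c * t powr a * r powr (- (k / 2 + a)) \<le> evidence t r"
    if t: "0 < t" and r: "1 \<le> r" and tr: "u0 * t \<le> r" for t r
  proof -
    define y where "y = r / t"
    have y: "0 < y" "u0 \<le> y" using t r tr by (simp_all add: y_def field_simps)
    define g where "g = (3 * r) powr (- k / 2) * exp (- 1 / 2)"
    have g: "0 \<le> g" by (simp add: g_def)
    have "c * t powr a * r powr (- (k / 2 + a)) = g * (m * 2 powr (- a - 1) * y powr (- a))"
    proof -
      have "r powr (- (k / 2 + a)) = r powr (- k / 2) * r powr (- a)"
        by (simp add: powr_add[symmetric])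
      moreover have "y powr (- a) = r powr (- a) * t powr a"
        using t r by (simp add: y_def powr_divide powr_minus field_simps)
      moreover have "(3 * r) powr (- k / 2) = 3 powr (- k / 2) * r powr (- k / 2)"
        using r by (simp add: powr_mult)
      ultimately show ?thesis by (simp only: c_def g_def mult_ac)
    qed
    also have "\<dots> \<le> g * (\<integral>u. indicator {y<..2 * y} u * p u \<partial>lborel)"
      by (intro mult_left_mono tail_lower y g)
    also have "\<dots> = (\<integral>u. g * (indicator {y<..2 * y} u * p u) \<partial>lborel)" by simp
    also have "\<dots> \<le> (\<integral>u. kernel t r u * p u \<partial>lborel)"
    proof (rule integral_mono)
      show "integrable lborel (\<lambda>u. g * (indicator {y<..2 * y} u * p u))"
        by (intro integrable_mult_right integrable_weighted[where B = 1]) (auto simp: indicator_def)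
      show "integrable lborel (\<lambda>u. kernel t r u * p u)" using t r by (intro integrable_kernel_one) simp_all
      fix u :: real
      show "g * (indicator {y<..2 * y} u * p u) \<le> kernel t r u * p u"
      proof (cases "y < u \<and> u \<le> 2 * y")
        case False
        then show ?thesis using kernel_p_nonneg[OF t, of r u] r by simp
      next
        case True
        then have ut: "r < u * t" "u * t \<le> 2 * r" using t by (simp_all add: y_def field_simps)
        have k1: "1 / (3 * r) \<le> shrink t u"
          unfolding shrink_def using ut r by (intro divide_left_mono) simp_all
        have "r * shrink t u = r / (1 + u * t)" by (simp add: shrink_def)
        also have "\<dots> \<le> 1" using ut r by simp
        finally have k2: "exp (- 1 / 2) \<le> exp (- r * shrink t u / 2)" by simp
        have "(3 * r) powr (- k / 2) = sqrt (1 / (3 * r)) powr k"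
          using r by (simp add: powr_half_sqrt[symmetric] powr_powr powr_divide powr_minus_divide)
        also have "\<dots> = sqrt (1 / (3 * r)) ^ CARD('k)"
          unfolding k_def using r by (subst powr_realpow) simp_all
        also have "\<dots> \<le> sqrt (shrink t u) ^ CARD('k)"
          using k1 r by (intro power_mono) simp_all
        finally have "g \<le> kernel t r u"
          unfolding g_def kernel_def using k2 order_trans[OF _ k1, of 0] r by (intro mult_mono) simp_all
        then show ?thesis using True p_nonneg[of u] by (simp add: mult_right_mono)
      qed
    qed
    finally show ?thesis by (simp add: evidence_def)
  qed
  then show ?thesis using c unfolding k_def by blast
qed

text \<open>The quantity is the posterior mean of \<open>sqrt r \<kappa>\<close>.  Where \<open>sqrt r \<kappa> \<le> 1\<close> there is nothing to show.  Elsewhere the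
kernel is at most \<open>exp (- sqrt r / 2)\<close> on the scales \<open>u \<ge> h / t\<close>, whose prior mass cancels the \<open>t powr a\<close> in
\<open>evidence_polynomial_lower\<close>; on the scales \<open>u < h / t\<close> it is at most \<open>exp (- r / (2 (1 + h)))\<close>, which beats
\<open>t powr (- a)\<close> because \<open>r\<close> exceeds \<open>2 a ln (1 / t)\<close> by the factor \<open>(1 + h)\<^sup>2\<close>.\<close>

lemma shrunk_norm_bounded:
  assumes h: "0 < h"
  shows "\<exists>C\<ge>0. \<exists>t1>0. t1 < 1 \<and> (\<forall>t r. 0 < t \<longrightarrow> t < t1 \<longrightarrow> 2 * (1 + h)\<^sup>2 * (a * ln (1 / t)) \<le> r \<longrightarrow>
    sqrt r * (1 - weight t r) \<le> C)"
proof -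
  define q where "q = real CARD('k) / 2 + a"
  have q: "0 < q" using a_pos by (simp add: q_def)
  obtain c where c: "c > 0" "\<And>t r. 0 < t \<Longrightarrow> 1 \<le> r \<Longrightarrow> u0 * t \<le> r \<Longrightarrow>
      c * t powr a * r powr (- q) \<le> evidence t r"
    using evidence_polynomial_lower unfolding q_def by blast
  define \<beta> where "\<beta> = 1 / (2 * (1 + h)) - 1 / (2 * (1 + h)\<^sup>2)"
  have "(1 + h) * 1 < (1 + h) * (1 + h)" using h by (intro mult_strict_left_mono) simp_all
  then have "2 * (1 + h) < 2 * (1 + h)\<^sup>2" unfolding power2_eq_square by linarith
  then have \<beta>: "0 < \<beta>" unfolding \<beta>_def using h by (simp add: frac_less2)
  obtain B1 where B1: "B1 \<ge> 0" "\<And>x. 0 < x \<Longrightarrow> x powr (1 + 2 * q) * exp (- (1 / 2) * x) \<le> B1"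
    using powr_exp_bounded[of "1 / 2" "1 + 2 * q"] q by auto
  obtain B2 where B2: "B2 \<ge> 0" "\<And>x. 0 < x \<Longrightarrow> x powr (1 / 2 + q) * exp (- \<beta> * x) \<le> B2"
    using powr_exp_bounded[OF \<beta>, of "1 / 2 + q"] q by auto
  define T where "T = A / a * h powr (- a)"
  have T: "0 \<le> T" using A_pos a_pos by (simp add: T_def)
  define C where "C = 1 + (T * B1 + B2) / c"
  have C: "0 \<le> C" using T B1(1) B2(1) c(1) by (simp add: C_def)
  \<comment> \<open>Below \<open>exp (- 1 / (2 a))\<close> the hypothesis on \<open>r\<close> forces \<open>r \<ge> 1\<close>; below \<open>1 / (u0 + 1)\<close> the scales of order \<open>r / t\<close> lie
    beyond \<open>u0\<close>.\<close>
  define t1 where "t1 = min (exp (- 1 / (2 * a))) (min (1 / (u0 + 1)) (1 / 2))"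
  have t1: "0 < t1" "t1 < 1" using u0_nonneg by (auto simp: t1_def min_less_iff_disj)
  have main: "sqrt r * (1 - weight t r) \<le> C"
    if t: "0 < t" "t < t1" and r: "2 * (1 + h)\<^sup>2 * (a * ln (1 / t)) \<le> r" for t r
  proof -
    have t': "t < 1" using t t1 by simp
    have "ln t < ln (exp (- 1 / (2 * a)))" using t by (subst ln_less_cancel_iff) (simp_all add: t1_def)
    then have "1 / (2 * a) < ln (1 / t)" using t by (simp add: ln_div)
    then have "a * (1 / (2 * a)) < a * ln (1 / t)" using a_pos by (intro mult_strict_left_mono)
    then have al: "1 / 2 < a * ln (1 / t)" using a_pos by simp
    have "2 * 1 * (1 / 2) \<le> 2 * (1 + h)\<^sup>2 * (a * ln (1 / t))"
      using al h by (intro mult_mono) (simp_all add: one_le_power)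
    then have r1: "1 \<le> r" using r by simp
    have "u0 * t \<le> u0 * (1 / (u0 + 1))" using t u0_nonneg by (intro mult_left_mono) (simp_all add: t1_def)
    also have "\<dots> \<le> 1" using u0_nonneg by simp
    finally have tr: "u0 * t \<le> r" using r1 by simp
    have r0: "0 \<le> r" "0 < r" using r1 by simp_all
    define D where "D = evidence t r"
    have D: "0 < D" "c * t powr a * r powr (- q) \<le> D"
      using evidence_pos[OF t(1) t' r0(1)] c(2)[OF t(1) r1 tr] by (simp_all add: D_def)
    define e1 e2 where "e1 = sqrt r * exp (- sqrt r / 2)" and "e2 = sqrt r * exp (- r / (2 * (1 + h)))"
    have e: "0 \<le> e1" "0 \<le> e2" using r0 by (simp_all add: e1_def e2_def)
    have point: "sqrt r * (shrink t u * kernel t r u) \<le> kernel t r u + e1 * indicator {h / t..} u + e2"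
      if u: "0 < u" for u
    proof -
      note b = shrink_bounds[OF t(1) u] kernel_bounds[OF t(1) u r0(1)]
      have kl: "kernel t r u \<le> exp (- r * shrink t u / 2)"
      proof -
        have "sqrt (shrink t u) ^ CARD('k) \<le> 1" using b by (intro power_le_one) simp_all
        then show ?thesis unfolding kernel_def by (simp add: mult_left_le_one_le b less_imp_le)
      qed
      have sk: "sqrt r * (shrink t u * kernel t r u) \<le> sqrt r * exp (- r * shrink t u / 2)"
      proof -
        have "shrink t u * kernel t r u \<le> 1 * exp (- r * shrink t u / 2)"
          using b kl by (intro mult_mono) simp_all
        then show ?thesis using r0 by (intro mult_left_mono) simp_all
      qed
      consider "sqrt r * shrink t u \<le> 1" | "1 < sqrt r * shrink t u" "h / t \<le> u" | "u < h / t"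
        by linarith
      then show ?thesis
      proof cases
        case 1
        then have "(sqrt r * shrink t u) * kernel t r u \<le> 1 * kernel t r u"
          using b by (intro mult_right_mono) simp_all
        moreover have "0 \<le> e1 * indicator {h / t..} u" using e by simp
        ultimately show ?thesis using e unfolding mult.assoc by linarith
      next
        case 2
        have "sqrt r * 1 \<le> sqrt r * (sqrt r * shrink t u)"
          using 2 r0 by (intro mult_left_mono) simp_all
        also have "\<dots> = r * shrink t u" using r0 by (simp add: mult.assoc[symmetric])
        finally have "exp (- r * shrink t u / 2) \<le> exp (- sqrt r / 2)" by simp
        then have "sqrt r * exp (- r * shrink t u / 2) \<le> e1"
          unfolding e1_def using r0 by (intro mult_left_mono) simp_all
        then show ?thesis using sk 2 e b by simp
      next
        case 3
        then have ut: "u * t < h" "0 < u * t" using t u by (simp_all add: field_simps)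
        have "1 / (1 + h) \<le> shrink t u"
          unfolding shrink_def using ut by (intro divide_left_mono) simp_all
        then have "r * (1 / (1 + h)) \<le> r * shrink t u" using r0 by (intro mult_left_mono)
        then have "- (r * shrink t u) / 2 \<le> - (r * (1 / (1 + h))) / 2"
          by (intro divide_right_mono, simp only: neg_le_iff_le) simp
        also have "\<dots> = - r / (2 * (1 + h))"
          by (simp only: times_divide_eq_right mult_1_right divide_divide_eq_left minus_divide_left mult.commute)
        finally have "exp (- r * shrink t u / 2) \<le> exp (- r / (2 * (1 + h)))"
          by (simp only: exp_le_cancel_iff mult_minus_left)
        then have "sqrt r * exp (- r * shrink t u / 2) \<le> e2"
          unfolding e2_def using r0 by (intro mult_left_mono) simp_all
        moreover have "0 \<le> e1 * indicator {h / t..} u" using e by simp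
        ultimately show ?thesis using sk b by linarith
      qed
    qed
    have i3: "integrable lborel (\<lambda>u. indicator {h / t..} u * p u)"
      by (rule integrable_weighted[where B = 1]) (auto simp: indicator_def)
    have i2: "integrable lborel (\<lambda>u. kernel t r u * p u)" by (rule integrable_kernel_one[OF t(1) r0(1)])
    have "sqrt r * (\<integral>u. shrink t u * kernel t r u * p u \<partial>lborel) =
        (\<integral>u. sqrt r * (shrink t u * kernel t r u * p u) \<partial>lborel)" by simp
    also have "\<dots> \<le> (\<integral>u. kernel t r u * p u + e1 * (indicator {h / t..} u * p u) + e2 * p u \<partial>lborel)"
    proof (rule integral_mono)
      show "integrable lborel (\<lambda>u. sqrt r * (shrink t u * kernel t r u * p u))"
        by (intro integrable_mult_right integrable_kernel_shrink t r0)
      show "integrable lborel (\<lambda>u. kernel t r u * p u + e1 * (indicator {h / t..} u * p u) + e2 * p u)"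
        by (intro Bochner_Integration.integrable_add integrable_mult_right i2 i3 integrable_p)
      fix u :: real
      show "sqrt r * (shrink t u * kernel t r u * p u) \<le>
          kernel t r u * p u + e1 * (indicator {h / t..} u * p u) + e2 * p u"
      proof (cases "0 < u")
        case True
        have "sqrt r * (shrink t u * kernel t r u) * p u \<le>
            (kernel t r u + e1 * indicator {h / t..} u + e2) * p u"
          by (intro mult_right_mono point True p_nonneg)
        then show ?thesis by (simp add: algebra_simps)
      qed (simp add: p_zero)
    qed
    also have "\<dots> = D + e1 * (\<integral>u. indicator {h / t..} u * p u \<partial>lborel) + e2"
      using i2 i3 integrable_p by (simp add: D_def evidence_def integral_p)
    also have "\<dots> \<le> D + e1 * (T * t powr a) + e2"
    proof -
      have "(\<integral>u. indicator {h / t..} u * p u \<partial>lborel) \<le> A / a * (h / t) powr (- a)"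
        using h t by (intro tail_upper) simp
      also have "\<dots> = T * t powr a" using h t by (simp add: T_def powr_divide powr_minus field_simps)
      finally show ?thesis using e by (intro add_mono mult_left_mono) simp_all
    qed
    finally have num: "sqrt r * (\<integral>u. shrink t u * kernel t r u * p u \<partial>lborel) \<le> D + (e1 * (T * t powr a) + e2)"
      by simp
    have ta: "t powr (- a) \<le> exp (r / (2 * (1 + h)\<^sup>2))"
    proof -
      have "a * ln (1 / t) \<le> r / (2 * (1 + h)\<^sup>2)" using r h by (simp add: field_simps)
      then show ?thesis using t by (simp add: powr_def ln_div)
    qed
    have x1: "e1 * r powr q \<le> B1"
    proof -
      have "r powr q = sqrt r powr (2 * q)" using r0 by (simp add: powr_half_sqrt[symmetric] powr_powr)
      then have "e1 * r powr q = sqrt r powr (1 + 2 * q) * exp (- (1 / 2) * sqrt r)"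
        using r0 by (simp add: e1_def powr_add)
      then show ?thesis using B1(2)[of "sqrt r"] r0 by simp
    qed
    have x2: "e2 * t powr (- a) * r powr q \<le> B2"
    proof -
      have "e2 * t powr (- a) * r powr q \<le> e2 * exp (r / (2 * (1 + h)\<^sup>2)) * r powr q"
        using e ta by (intro mult_right_mono mult_left_mono) simp_all
      also have "\<dots> = r powr (1 / 2 + q) * (exp (- r / (2 * (1 + h))) * exp (r / (2 * (1 + h)\<^sup>2)))"
        using r0 by (simp add: e2_def powr_add powr_half_sqrt)
      also have "exp (- r / (2 * (1 + h))) * exp (r / (2 * (1 + h)\<^sup>2)) = exp (- \<beta> * r)"
        by (simp add: exp_add[symmetric] \<beta>_def left_diff_distrib)
      also have "r powr (1 / 2 + q) * exp (- \<beta> * r) \<le> B2" by (rule B2(2)[OF r0(2)])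
      finally show ?thesis .
    qed
    have low: "0 < c * t powr a * r powr (- q)" using c(1) t r0 by simp
    have "sqrt r * (1 - weight t r) = sqrt r * (\<integral>u. shrink t u * kernel t r u * p u \<partial>lborel) / D"
      by (simp add: one_minus_weight[OF t(1) t' r0(1)] D_def)
    also have "\<dots> \<le> (D + (e1 * (T * t powr a) + e2)) / D"
      using num D(1) by (intro divide_right_mono) simp_all
    also have "\<dots> = 1 + (e1 * (T * t powr a) + e2) / D" using D(1) by (simp add: add_divide_distrib)
    also have "\<dots> \<le> 1 + (e1 * (T * t powr a) + e2) / (c * t powr a * r powr (- q))"
    proof -
      have "0 \<le> e1 * (T * t powr a) + e2" using e T by simp
      then show ?thesis
        by (intro add_left_mono divide_left_mono[OF D(2) _ mult_pos_pos[OF D(1) low]])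
    qed
    also have "(e1 * (T * t powr a) + e2) / (c * t powr a * r powr (- q)) =
        (T * (e1 * r powr q) + e2 * t powr (- a) * r powr q) / c"
      using t r0 c(1) by (simp add: powr_minus field_simps)
    also have "\<dots> \<le> (T * B1 + B2) / c"
      using c(1) T by (intro divide_right_mono add_mono mult_left_mono x1 x2) simp_all
    finally show ?thesis by (simp add: C_def)
  qed
  show ?thesis
    by (intro exI[of _ C] exI[of _ t1] conjI C t1 allI impI main)
qed

text \<open>A pointwise bound that is affine in \<open>s z\<close>, with \<open>z\<close> the centred observation, integrates to a bound by the total
mass and the second moment of the noise.\<close>

lemma mvn_expect_le:
  assumes t: "0 < t" and c: "0 \<le> c1" "0 \<le> c2"
    and M: "(\<integral>\<^sup>+z. ennreal (s z * (exp (- s z / 2) / Z)) \<partial>lborel) \<le> ennreal M" "0 \<le> M"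
    and le: "\<And>z. s (weight t (s (\<theta> + z)) *\<^sub>R (\<theta> + z) - \<theta>) \<le> c1 + c2 * s z"
  shows "mvn_expect \<theta> S (\<lambda>x. s (posterior_mean S p t x - \<theta>)) \<le> ennreal (c1 + c2 * M)"
proof -
  have "mvn_expect \<theta> S (\<lambda>x. s (posterior_mean S p t x - \<theta>)) \<le>
      (\<integral>\<^sup>+z. ennreal c1 * ennreal (exp (- s z / 2) / Z) + ennreal c2 * ennreal (s z * (exp (- s z / 2) / Z)) \<partial>lborel)"
    unfolding mvn_expect_estimator[OF t]
  proof (rule nn_integral_mono)
    fix z
    have "s (weight t (s (\<theta> + z)) *\<^sub>R (\<theta> + z) - \<theta>) * (exp (- s z / 2) / Z) \<le>
        (c1 + c2 * s z) * (exp (- s z / 2) / Z)"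
      using Z_pos by (intro mult_right_mono le) simp
    also have "\<dots> = c1 * (exp (- s z / 2) / Z) + c2 * (s z * (exp (- s z / 2) / Z))"
      by (simp only: distrib_right mult.assoc)
    finally have "ennreal (s (weight t (s (\<theta> + z)) *\<^sub>R (\<theta> + z) - \<theta>) * (exp (- s z / 2) / Z)) \<le>
        ennreal (c1 * (exp (- s z / 2) / Z) + c2 * (s z * (exp (- s z / 2) / Z)))"
      by (rule ennreal_leI)
    also have "\<dots> = ennreal (c1 * (exp (- s z / 2) / Z)) + ennreal (c2 * (s z * (exp (- s z / 2) / Z)))"
      using c Z_pos s_nonneg[of z] by (intro ennreal_plus) simp_all
    also have "\<dots> = ennreal c1 * ennreal (exp (- s z / 2) / Z) + ennreal c2 * ennreal (s z * (exp (- s z / 2) / Z))"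
      using c Z_pos s_nonneg[of z] by (subst (1 2) ennreal_mult) simp_all
    finally show "ennreal (s (weight t (s (\<theta> + z)) *\<^sub>R (\<theta> + z) - \<theta>) * (exp (- s z / 2) / Z)) \<le> \<dots>" .
  qed
  also have "\<dots> = ennreal c1 * 1 + ennreal c2 * (\<integral>\<^sup>+z. ennreal (s z * (exp (- s z / 2) / Z)) \<partial>lborel)"
    by (subst nn_integral_add) (simp_all add: nn_integral_cmult nn_integral_std[simplified])
  also have "\<dots> \<le> ennreal c1 * 1 + ennreal c2 * ennreal M"
    by (intro add_mono mult_left_mono M order_refl) simp
  also have "\<dots> = ennreal (c1 + c2 * M)"
    using c M(2) by (simp add: ennreal_mult[symmetric] ennreal_plus[symmetric] del: ennreal_plus)
  finally show ?thesis .
qed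

text \<open>Split \<open>W x - \<theta>\<close> into the noise \<open>x - \<theta>\<close> and the shrinkage bias \<open>- (1 - W) x\<close>.  The squared bias is bounded pointwise,
uniformly in \<open>\<theta>\<close>.\<close>

theorem risk_upper_bound:
  assumes \<delta>: "0 < \<delta>"
  shows "\<exists>C\<ge>(0::real). \<exists>t1>0. \<forall>t \<theta>. 0 < t \<longrightarrow> t < t1 \<longrightarrow>
    mvn_expect \<theta> S (\<lambda>x. s (posterior_mean S p t x - \<theta>)) \<le>
      ennreal ((1 + \<delta>) * (2 * (a * ln (1 / t))) + C)"
proof -
  \<comment> \<open>For \<open>h \<le> 1\<close> one has \<open>(1 + h) ^ 3 \<le> 1 + 7 h\<close>; two of the three factors come from the threshold in
    \<open>shrunk_norm_bounded\<close>, the third from the weighted triangle inequality.\<close>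
  define h where "h = min 1 (\<delta> / 7)"
  have h: "0 < h" "h \<le> 1" "7 * h \<le> \<delta>" using \<delta> by (auto simp: h_def)
  have hh: "h * h \<le> h" using mult_left_mono[OF h(2), of h] h(1) by simp
  have "h * (h * h) \<le> h * 1" using order_trans[OF hh h(2)] h(1) by (intro mult_left_mono) simp_all
  moreover have "(1 + h) * (1 + h)\<^sup>2 = 1 + 3 * h + 3 * (h * h) + h * (h * h)"
    by (simp add: power2_eq_square algebra_simps)
  ultimately have h3: "(1 + h) * (1 + h)\<^sup>2 \<le> 1 + \<delta>" using hh h(3) by linarith
  obtain C t1 where C: "C \<ge> 0" "t1 > 0" "t1 < 1"
    "\<And>t r. 0 < t \<Longrightarrow> t < t1 \<Longrightarrow> 2 * (1 + h)\<^sup>2 * (a * ln (1 / t)) \<le> r \<Longrightarrow> sqrt r * (1 - weight t r) \<le> C"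
    using shrunk_norm_bounded[OF h(1)] by blast
  obtain M :: real where M: "M \<ge> 0" "(\<integral>\<^sup>+z. ennreal (s z * (exp (- s z / 2) / Z)) \<partial>lborel) \<le> ennreal M"
    using second_moment by blast
  define C' where "C' = (1 + h) * C\<^sup>2 + (1 + 1 / h) * M"
  have C': "0 \<le> C'" using h M by (simp add: C'_def)
  have "mvn_expect \<theta> S (\<lambda>x. s (posterior_mean S p t x - \<theta>)) \<le>
      ennreal ((1 + \<delta>) * (2 * (a * ln (1 / t))) + C')" if t: "0 < t" "t < t1" for t \<theta>
  proof -
    define B where "B = 2 * (a * ln (1 / t))"
    have "0 \<le> ln (1 / t)" using t C(3) by simp
    then have B: "0 \<le> B" using a_pos by (simp only: B_def mult_nonneg_nonneg less_imp_le zero_le_numeral)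
    have sq: "(1 - weight t r)\<^sup>2 * r \<le> C\<^sup>2 + (1 + h)\<^sup>2 * B" if r: "0 \<le> r" for r
    proof (cases "(1 + h)\<^sup>2 * B \<le> r")
      case True
      have w: "0 \<le> 1 - weight t r" using weight_bounds[of t r] t C(3) r by simp
      have "(sqrt r * (1 - weight t r))\<^sup>2 \<le> C\<^sup>2"
        using C(4)[OF t, of r] True w r by (intro power_mono) (simp_all add: B_def)
      moreover have "0 \<le> (1 + h)\<^sup>2 * B" using B by simp
      ultimately show ?thesis using r by (simp add: power_mult_distrib mult.commute)
    next
      case False
      have "(1 - weight t r)\<^sup>2 * r \<le> 1 * r"
        using weight_bounds[of t r] t C(3) r by (intro mult_right_mono) (simp_all add: power_le_one)
      then show ?thesis using False zero_le_power2[of C] by linarith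
    qed
    have "mvn_expect \<theta> S (\<lambda>x. s (posterior_mean S p t x - \<theta>)) \<le>
        ennreal ((1 + h) * (C\<^sup>2 + (1 + h)\<^sup>2 * B) + (1 + 1 / h) * M)"
    proof (rule mvn_expect_le[OF t(1) _ _ M(2,1)])
      fix z
      define x where "x = \<theta> + z"
      define w where "w = weight t (s x)"
      have "w *\<^sub>R x - \<theta> = (- (1 - w)) *\<^sub>R x + z" by (simp add: x_def algebra_simps)
      then have "s (w *\<^sub>R x - \<theta>) \<le> (1 + h) * s ((- (1 - w)) *\<^sub>R x) + (1 + 1 / h) * s z"
        using s_add_le[OF h(1)] by simp
      also have "s ((- (1 - w)) *\<^sub>R x) = (1 - w)\<^sup>2 * s x" by (simp only: s_scaleR power2_minus)
      also have "\<dots> \<le> C\<^sup>2 + (1 + h)\<^sup>2 * B" unfolding w_def by (rule sq[OF s_nonneg])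
      finally show "s (weight t (s (\<theta> + z)) *\<^sub>R (\<theta> + z) - \<theta>) \<le> (1 + h) * (C\<^sup>2 + (1 + h)\<^sup>2 * B) + (1 + 1 / h) * s z"
        using h by (simp add: x_def w_def mult_left_mono)
    qed (use h B in simp_all)
    also have "\<dots> \<le> ennreal ((1 + \<delta>) * B + C')"
    proof (rule ennreal_leI)
      have "(1 + h) * (1 + h)\<^sup>2 * B \<le> (1 + \<delta>) * B" by (intro mult_right_mono h3 B)
      then show "(1 + h) * (C\<^sup>2 + (1 + h)\<^sup>2 * B) + (1 + 1 / h) * M \<le> (1 + \<delta>) * B + C'"
        by (simp add: C'_def distrib_left mult.assoc)
    qed
    finally show ?thesis by (simp add: B_def)
  qed
  then show ?thesis using C' C(2) by blast
qed

end

section \<open>Lower bound on the risk at a least favourable mean\<close>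

context power_tail_prior
begin

text \<open>Scales with \<open>u t \<le> h\<close> contribute at most \<open>h\<close> to the posterior mean of \<open>1 - \<kappa>\<close>; the others have prior mass of order
\<open>t powr a\<close>, to be divided by an evidence of at least \<open>c exp (- r / 2)\<close>.\<close>

lemma weight_upper:
  assumes h: "0 < h"
  shows "\<exists>C\<ge>0. \<forall>t r. 0 < t \<longrightarrow> t < 1 \<longrightarrow> 0 \<le> r \<longrightarrow> weight t r \<le> h + C * (exp (r / 2) * t powr a)"
proof -
  obtain c0 where c0: "c0 > 0" "\<And>t r. 0 < t \<Longrightarrow> t < 1 \<Longrightarrow> 0 \<le> r \<Longrightarrow> c0 * exp (- r / 2) \<le> evidence t r"
    using evidence_lower by blast
  define T where "T = A / a * h powr (- a)"
  have T: "0 \<le> T" using A_pos a_pos by (simp add: T_def)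
  have "weight t r \<le> h + T / c0 * (exp (r / 2) * t powr a)" if t: "0 < t" "t < 1" and r: "0 \<le> r" for t r
  proof -
    have i2: "integrable lborel (\<lambda>u. kernel t r u * p u)" by (rule integrable_kernel_one[OF t(1) r])
    have i3: "integrable lborel (\<lambda>u. indicator {h / t..} u * p u)"
      by (rule integrable_weighted[where B = 1]) (auto simp: indicator_def)
    have "(\<integral>u. (1 - shrink t u) * kernel t r u * p u \<partial>lborel) \<le>
        (\<integral>u. h * (kernel t r u * p u) + indicator {h / t..} u * p u \<partial>lborel)"
    proof (rule integral_mono)
      show "integrable lborel (\<lambda>u. (1 - shrink t u) * kernel t r u * p u)"
        by (rule integrable_kernel_shrink(2)[OF t(1) r])
      show "integrable lborel (\<lambda>u. h * (kernel t r u * p u) + indicator {h / t..} u * p u)"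
        by (intro Bochner_Integration.integrable_add integrable_mult_right i2 i3)
      fix u :: real
      show "(1 - shrink t u) * kernel t r u * p u \<le> h * (kernel t r u * p u) + indicator {h / t..} u * p u"
      proof (cases "0 < u")
        case u: True
        note b = one_minus_shrink[OF t(1) u] kernel_bounds[OF t(1) u r]
        have "(1 - shrink t u) * kernel t r u \<le> h * kernel t r u + indicator {h / t..} u"
        proof (cases "h / t \<le> u")
          case True
          have "(1 - shrink t u) * kernel t r u \<le> 1" using b by (intro mult_le_one) simp_all
          moreover have "0 \<le> h * kernel t r u" using h b by simp
          ultimately show ?thesis using True by simp
        next
          case False
          then have "u * t \<le> h" using t by (simp add: field_simps)
          then have "(1 - shrink t u) * kernel t r u \<le> h * kernel t r u"
            using b by (intro mult_right_mono) simp_all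
          then show ?thesis using False by simp
        qed
        then have "((1 - shrink t u) * kernel t r u) * p u \<le> (h * kernel t r u + indicator {h / t..} u) * p u"
          by (intro mult_right_mono p_nonneg)
        then show ?thesis by (simp add: distrib_right mult.assoc)
      qed (simp add: p_zero)
    qed
    also have "\<dots> = h * evidence t r + (\<integral>u. indicator {h / t..} u * p u \<partial>lborel)"
      using i2 i3 by (simp add: evidence_def)
    also have "(\<integral>u. indicator {h / t..} u * p u \<partial>lborel) \<le> A / a * (h / t) powr (- a)"
      using h t by (intro tail_upper) simp
    also have "A / a * (h / t) powr (- a) = T * t powr a"
      using h t by (simp add: T_def powr_divide powr_minus field_simps)
    finally have num: "(\<integral>u. (1 - shrink t u) * kernel t r u * p u \<partial>lborel) \<le> h * evidence t r + T * t powr a"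
      by simp
    note D = evidence_pos[OF t r]
    have "weight t r \<le> (h * evidence t r + T * t powr a) / evidence t r"
      unfolding weight_def using num D by (intro divide_right_mono) simp_all
    also have "\<dots> = h + T * t powr a / evidence t r" using D by (simp add: add_divide_distrib)
    also have "\<dots> \<le> h + T * t powr a / (c0 * exp (- r / 2))"
      using T D c0(1) c0(2)[OF t r] by (intro add_mono divide_left_mono mult_pos_pos) simp_all
    also have "\<dots> = h + T / c0 * (exp (r / 2) * t powr a)"
      by (simp add: exp_minus field_simps)
    finally show ?thesis .
  qed
  then show ?thesis using T c0(1) by (intro exI[of _ "T / c0"]) auto
qed

lemma exists_mahalanobis_sq:
  assumes "0 < b"
  shows "\<exists>\<theta>. \<theta> \<noteq> 0 \<and> s \<theta> = b"
proof -
  define v :: "real^'k" where "v = 1"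
  have v: "v \<noteq> 0" by (simp add: v_def)
  have sv: "0 < s v" by (rule s_pos[OF v])
  show ?thesis
    using v sv assms by (intro exI[of _ "sqrt (b / s v) *\<^sub>R v"]) (simp add: s_scaleR)
qed

text \<open>Take \<open>s \<theta> = (1 - \<delta>) B\<close> with \<open>B = 2 a ln (1 / t)\<close>.  As long as \<open>s x \<le> (1 - \<delta> / 2) B\<close>, the second term in \<open>weight_upper\<close>
is of order \<open>t powr (a \<delta> / 2)\<close> and the weight is at most \<open>2 h\<close>.  In the exceptional case the noise must bridge the
gap, so that \<open>B\<close> and \<open>s x\<close> are bounded by a multiple of \<open>s z\<close>, and the second moment of the noise suffices.
The risk stands on the right, multiplied, since it is not known to be finite at this point.\<close>

theorem risk_lower_bound:
  assumes \<delta>: "0 < \<delta>" "\<delta> < 1"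
  shows "\<exists>C\<ge>(0::real). \<exists>t1>0. \<forall>t. 0 < t \<longrightarrow> t < t1 \<longrightarrow> (\<exists>\<theta>. \<theta> \<noteq> 0 \<and>
    ennreal ((1 - 2 * \<delta>) * (2 * (a * ln (1 / t)))) \<le>
      ennreal (1 + \<delta>) * mvn_expect \<theta> S (\<lambda>x. s (posterior_mean S p t x - \<theta>)) + ennreal C)"
proof -
  \<comment> \<open>The choice of \<open>h\<close> makes the total coefficient of \<open>B\<close> in the error term equal to \<open>\<delta>\<close>.\<close>
  define w where "w = 1 + 1 / \<delta>"
  have w: "0 < w" using \<delta> by (simp add: w_def add_pos_pos)
  define h where "h = sqrt (\<delta> / (8 * w))"
  have h: "0 < h" using \<delta> w by (simp add: h_def)
  have h2: "(1 + 1 / \<delta>) * (8 * h\<^sup>2) = \<delta>"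
  proof -
    have "h\<^sup>2 = \<delta> / (8 * w)" using \<delta> w by (simp add: h_def)
    then show ?thesis using w by (simp add: w_def[symmetric])
  qed
  obtain C0 where C0: "C0 \<ge> 0" "\<And>t r. 0 < t \<Longrightarrow> t < 1 \<Longrightarrow> 0 \<le> r \<Longrightarrow> weight t r \<le> h + C0 * (exp (r / 2) * t powr a)"
    using weight_upper[OF h] by blast
  obtain M :: real where M: "M \<ge> 0" "(\<integral>\<^sup>+z. ennreal (s z * (exp (- s z / 2) / Z)) \<partial>lborel) \<le> ennreal M"
    using second_moment by blast
  define E where "E = (4 / \<delta>) * (1 + 4 / \<delta>)"
  define C1 where "C1 = 2 * E + 2"
  have E: "0 \<le> E" "0 \<le> C1" using \<delta> by (simp_all add: E_def C1_def)
  define c2 where "c2 = (1 + 1 / \<delta>) * (C1 + 8 * h\<^sup>2)"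
  have c2: "0 \<le> c2" using \<delta> E by (simp add: c2_def)
  \<comment> \<open>Chosen so that \<open>C0 * t powr (a * \<delta> / 2) \<le> h\<close> for \<open>t < t1\<close>.\<close>
  define t1 where "t1 = min (1 / 2) ((h / (C0 + 1)) powr (2 / (a * \<delta>)))"
  have t1: "0 < t1" using h C0(1) by (simp add: t1_def)
  have main: "\<exists>\<theta>. \<theta> \<noteq> 0 \<and> ennreal ((1 - 2 * \<delta>) * (2 * (a * ln (1 / t)))) \<le>
      ennreal (1 + \<delta>) * mvn_expect \<theta> S (\<lambda>x. s (posterior_mean S p t x - \<theta>)) + ennreal (c2 * M)"
    if t: "0 < t" "t < t1" for t
  proof -
    have t': "t < 1" using t by (simp add: t1_def)
    define B where "B = 2 * (a * ln (1 / t))"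
    have "0 < ln (1 / t)" using t t' by simp
    then have B: "0 < B" using a_pos by (simp add: B_def)
    obtain \<theta> where \<theta>: "\<theta> \<noteq> 0" "s \<theta> = (1 - \<delta>) * B"
      using exists_mahalanobis_sq[of "(1 - \<delta>) * B"] \<delta> B by auto
    have small: "C0 * (exp (r / 2) * t powr a) \<le> h" if r: "r \<le> (1 - \<delta> / 2) * B" for r
    proof -
      have "exp (r / 2) \<le> exp ((1 - \<delta> / 2) * B / 2)" using r by simp
      also have "(1 - \<delta> / 2) * B / 2 = (a * \<delta> / 2 - a) * ln t"
        using t by (simp add: B_def ln_div field_simps)
      also have "exp \<dots> = t powr (a * \<delta> / 2 - a)" using t by (simp add: powr_def)
      finally have "exp (r / 2) * t powr a \<le> t powr (a * \<delta> / 2 - a) * t powr a"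
        by (intro mult_right_mono) simp_all
      also have "\<dots> = t powr (a * \<delta> / 2)" by (simp add: powr_add[symmetric])
      also have "\<dots> \<le> ((h / (C0 + 1)) powr (2 / (a * \<delta>))) powr (a * \<delta> / 2)"
        using t a_pos \<delta> by (intro powr_mono2) (simp_all add: t1_def)
      also have "\<dots> = h / (C0 + 1)" using a_pos \<delta> h C0(1) by (simp add: powr_powr)
      finally have "C0 * (exp (r / 2) * t powr a) \<le> C0 * (h / (C0 + 1))"
        using C0(1) by (intro mult_left_mono)
      also have "\<dots> \<le> h" using C0(1) h by (simp add: field_simps)
      finally show ?thesis .
    qed
    have est: "(weight t (s (\<theta> + z)))\<^sup>2 * s (\<theta> + z) \<le> 8 * h\<^sup>2 * B + (C1 + 8 * h\<^sup>2) * s z" for z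
    proof -
      define r where "r = s (\<theta> + z)"
      have r0: "0 \<le> r" by (simp add: r_def s_nonneg)
      note w = weight_bounds[OF t(1) t' r0]
      have "(1 - \<delta>) * B \<le> B" using \<delta> B by (simp add: algebra_simps)
      then have r2: "r \<le> 2 * B + 2 * s z" using s_add_le2[of \<theta> z] \<theta>(2) by (simp add: r_def)
      have "(weight t r)\<^sup>2 * r \<le> 8 * h\<^sup>2 * B + (C1 + 8 * h\<^sup>2) * s z"
      proof (cases "r \<le> (1 - \<delta> / 2) * B")
        case True
        have "weight t r \<le> 2 * h" using C0(2)[OF t(1) t' r0] small[OF True] by linarith
        then have "(weight t r)\<^sup>2 \<le> (2 * h)\<^sup>2" using w by (intro power_mono)
        then have "(weight t r)\<^sup>2 * r \<le> (2 * h)\<^sup>2 * (2 * B + 2 * s z)"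
          using r2 r0 by (intro mult_mono) simp_all
        also have "\<dots> = 8 * h\<^sup>2 * B + 8 * h\<^sup>2 * s z" by (simp add: power_mult_distrib distrib_left)
        also have "\<dots> \<le> 8 * h\<^sup>2 * B + (C1 + 8 * h\<^sup>2) * s z"
          using E(2) s_nonneg[of z] by (intro add_left_mono mult_right_mono) simp_all
        finally show ?thesis .
      next
        case False
        have "r \<le> (1 + \<delta> / 4) * s \<theta> + (1 + 4 / \<delta>) * s z"
          using s_add_le[of "\<delta> / 4" \<theta> z] \<delta> by (simp add: r_def)
        also have "(1 + \<delta> / 4) * s \<theta> = (1 - 3 * \<delta> / 4 - \<delta> * \<delta> / 4) * B"
          unfolding \<theta>(2) by (simp add: field_simps)
        also have "\<dots> \<le> (1 - 3 * \<delta> / 4) * B" using B \<delta> by (intro mult_right_mono) simp_all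
        finally have "(1 - \<delta> / 2) * B < (1 - 3 * \<delta> / 4) * B + (1 + 4 / \<delta>) * s z" using False by linarith
        then have "\<delta> / 4 * B < (1 + 4 / \<delta>) * s z" by (simp add: algebra_simps)
        then have "(4 / \<delta>) * (\<delta> / 4 * B) < (4 / \<delta>) * ((1 + 4 / \<delta>) * s z)"
          using \<delta> by (intro mult_strict_left_mono) simp_all
        moreover have "(4 / \<delta>) * (\<delta> / 4 * B) = B" using \<delta> by simp
        ultimately have "B < E * s z" by (simp only: E_def mult.assoc)
        then have "r \<le> C1 * s z" using r2 by (simp add: C1_def algebra_simps)
        moreover have "(weight t r)\<^sup>2 * r \<le> 1 * r"
          using w r0 by (intro mult_right_mono) (simp_all add: power_le_one)
        moreover have "0 \<le> 8 * h\<^sup>2 * B" "0 \<le> 8 * h\<^sup>2 * s z" using B s_nonneg[of z] by simp_all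
        ultimately show ?thesis unfolding distrib_right by linarith
      qed
      then show ?thesis by (simp add: r_def)
    qed
    let ?loss = "\<lambda>z. s (weight t (s (\<theta> + z)) *\<^sub>R (\<theta> + z) - \<theta>)"
    let ?\<phi> = "\<lambda>z. exp (- s z / 2) / Z"
    have \<phi>: "0 \<le> ?\<phi> z" for z using Z_pos by simp
    have point: "(1 - 2 * \<delta>) * B \<le> (1 + \<delta>) * ?loss z + c2 * s z" for z
    proof -
      define x where "x = \<theta> + z"
      define w where "w = weight t (s x)"
      have "s \<theta> = s ((w *\<^sub>R x - \<theta>) + (- w) *\<^sub>R x)"
        using s_minus[of \<theta>] by simp
      also have "\<dots> \<le> (1 + \<delta>) * s (w *\<^sub>R x - \<theta>) + (1 + 1 / \<delta>) * s ((- w) *\<^sub>R x)"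
        by (rule s_add_le[OF \<delta>(1)])
      also have "s ((- w) *\<^sub>R x) = w\<^sup>2 * s x" by (simp only: s_scaleR power2_minus)
      also have "(1 + 1 / \<delta>) * (w\<^sup>2 * s x) \<le> (1 + 1 / \<delta>) * (8 * h\<^sup>2 * B + (C1 + 8 * h\<^sup>2) * s z)"
        using est[of z] \<delta> by (intro mult_left_mono) (simp_all add: w_def x_def)
      also have "\<dots> = ((1 + 1 / \<delta>) * (8 * h\<^sup>2)) * B + c2 * s z"
        by (simp only: c2_def distrib_left distrib_right mult.assoc)
      finally have "s \<theta> \<le> (1 + \<delta>) * s (w *\<^sub>R x - \<theta>) + (\<delta> * B + c2 * s z)" unfolding h2 by simp
      then show ?thesis unfolding \<theta>(2) w_def x_def by (simp add: algebra_simps)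
    qed
    have "ennreal ((1 - 2 * \<delta>) * B) = (\<integral>\<^sup>+z. ennreal ((1 - 2 * \<delta>) * B) * ennreal (?\<phi> z) \<partial>lborel)"
      by (subst nn_integral_cmult) (simp_all add: nn_integral_std[simplified])
    also have "\<dots> \<le> (\<integral>\<^sup>+z. ennreal (1 + \<delta>) * ennreal (?loss z * ?\<phi> z) + ennreal c2 * ennreal (s z * ?\<phi> z) \<partial>lborel)"
    proof (rule nn_integral_mono)
      fix z
      have "ennreal ((1 - 2 * \<delta>) * B) * ennreal (?\<phi> z) \<le> ennreal ((1 + \<delta>) * ?loss z + c2 * s z) * ennreal (?\<phi> z)"
        by (intro mult_right_mono ennreal_leI point) simp
      also have "\<dots> = ennreal (((1 + \<delta>) * ?loss z + c2 * s z) * ?\<phi> z)"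
        using \<delta> c2 s_nonneg \<phi> by (intro ennreal_mult[symmetric] add_nonneg_nonneg mult_nonneg_nonneg) simp_all
      also have "((1 + \<delta>) * ?loss z + c2 * s z) * ?\<phi> z = (1 + \<delta>) * (?loss z * ?\<phi> z) + c2 * (s z * ?\<phi> z)"
        by (simp only: distrib_right mult.assoc)
      also have "ennreal \<dots> = ennreal ((1 + \<delta>) * (?loss z * ?\<phi> z)) + ennreal (c2 * (s z * ?\<phi> z))"
        using \<delta> c2 by (intro ennreal_plus mult_nonneg_nonneg \<phi> s_nonneg) simp_all
      also have "\<dots> = ennreal (1 + \<delta>) * ennreal (?loss z * ?\<phi> z) + ennreal c2 * ennreal (s z * ?\<phi> z)"
      proof -
        have "ennreal ((1 + \<delta>) * (?loss z * ?\<phi> z)) = ennreal (1 + \<delta>) * ennreal (?loss z * ?\<phi> z)"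
          using \<delta> by (intro ennreal_mult mult_nonneg_nonneg s_nonneg \<phi>) simp
        moreover have "ennreal (c2 * (s z * ?\<phi> z)) = ennreal c2 * ennreal (s z * ?\<phi> z)"
          by (intro ennreal_mult mult_nonneg_nonneg s_nonneg \<phi> c2)
        ultimately show ?thesis by (simp only:)
      qed
      finally show "ennreal ((1 - 2 * \<delta>) * B) * ennreal (?\<phi> z) \<le> \<dots>" .
    qed
    also have "\<dots> = ennreal (1 + \<delta>) * mvn_expect \<theta> S (\<lambda>x. s (posterior_mean S p t x - \<theta>))
        + ennreal c2 * (\<integral>\<^sup>+z. ennreal (s z * ?\<phi> z) \<partial>lborel)"
      unfolding mvn_expect_estimator[OF t(1)] by (subst nn_integral_add) (simp_all add: nn_integral_cmult)
    also have "\<dots> \<le> ennreal (1 + \<delta>) * mvn_expect \<theta> S (\<lambda>x. s (posterior_mean S p t x - \<theta>)) + ennreal c2 * ennreal M"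
      by (intro add_mono mult_left_mono M order_refl) simp
    also have "ennreal c2 * ennreal M = ennreal (c2 * M)" using c2 M(1) by (simp add: ennreal_mult)
    finally show ?thesis using \<theta>(1) by (auto simp: B_def)
  qed
  show ?thesis
    using main c2 M(1) t1 by (intro exI[of _ "c2 * M"] conjI exI[of _ t1] allI impI) simp_all
qed

end

section \<open>Sums over nearly black configurations\<close>

lemma sup_zero_le:
  fixes f :: "real^'k \<Rightarrow> ennreal"
  assumes f: "f 0 \<le> ennreal V" and V: "0 \<le> V" and d: "0 < d"
  shows "(SUP \<theta>\<in>(nearly_black n q :: (nat \<Rightarrow> real^'k) set).
      (\<Sum>i | i \<in> {1..n} \<and> \<theta> i = 0. f 0) / ennreal d) \<le> ennreal (real n * V / d)"
proof (rule SUP_least)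
  fix \<theta> :: "nat \<Rightarrow> real^'k"
  have "card {i. i \<in> {1..n} \<and> \<theta> i = 0} \<le> card {1..n}" by (rule card_mono) auto
  then have "(of_nat (card {i. i \<in> {1..n} \<and> \<theta> i = 0}) :: ennreal) * f 0 \<le> of_nat n * ennreal V"
    using f by (intro mult_mono) simp_all
  also have "\<dots> = ennreal (real n * V)" using V by (simp add: ennreal_mult ennreal_of_nat_eq_real_of_nat)
  finally have "(\<Sum>i | i \<in> {1..n} \<and> \<theta> i = 0. f 0) / ennreal d \<le> ennreal (real n * V) / ennreal d"
    by (intro divide_right_mono_ennreal) simp
  then show "(\<Sum>i | i \<in> {1..n} \<and> \<theta> i = 0. f 0) / ennreal d \<le> ennreal (real n * V / d)"
    using d V by (simp add: divide_ennreal)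
qed

lemma sup_nonzero_le:
  fixes f :: "real^'k \<Rightarrow> ennreal"
  assumes f: "\<And>\<theta>. f \<theta> \<le> ennreal V" and V: "0 \<le> V" and d: "0 < d"
  shows "(SUP \<theta>\<in>(nearly_black n q :: (nat \<Rightarrow> real^'k) set).
      (\<Sum>i | i \<in> {1..n} \<and> \<theta> i \<noteq> 0. f (\<theta> i)) / ennreal d) \<le> ennreal (real q * V / d)"
proof (rule SUP_least)
  fix \<theta> :: "nat \<Rightarrow> real^'k" assume "\<theta> \<in> nearly_black n q"
  then have c: "card {i. i \<in> {1..n} \<and> \<theta> i \<noteq> 0} \<le> q" by (simp add: nearly_black_def)
  have "(\<Sum>i | i \<in> {1..n} \<and> \<theta> i \<noteq> 0. f (\<theta> i)) \<le> of_nat (card {i. i \<in> {1..n} \<and> \<theta> i \<noteq> 0}) * ennreal V"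
    by (rule sum_bounded_above) (rule f)
  also have "\<dots> \<le> of_nat q * ennreal V" using c by (intro mult_right_mono) simp_all
  also have "\<dots> = ennreal (real q * V)" using V by (simp add: ennreal_mult ennreal_of_nat_eq_real_of_nat)
  finally have "(\<Sum>i | i \<in> {1..n} \<and> \<theta> i \<noteq> 0. f (\<theta> i)) / ennreal d \<le> ennreal (real q * V) / ennreal d"
    by (intro divide_right_mono_ennreal)
  then show "(\<Sum>i | i \<in> {1..n} \<and> \<theta> i \<noteq> 0. f (\<theta> i)) / ennreal d \<le> ennreal (real q * V / d)"
    using d V by (simp add: divide_ennreal)
qed

lemma sup_total_le:
  fixes f :: "real^'k \<Rightarrow> ennreal"
  assumes d: "0 < d0" "d0 \<le> d"
  shows "(SUP \<theta>\<in>(nearly_black n q :: (nat \<Rightarrow> real^'k) set). (\<Sum>i\<in>{1..n}. f (\<theta> i)) / ennreal d) \<le>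
    (SUP \<theta>\<in>(nearly_black n q :: (nat \<Rightarrow> real^'k) set). (\<Sum>i | i \<in> {1..n} \<and> \<theta> i = 0. f 0) / ennreal d0) +
    (SUP \<theta>\<in>(nearly_black n q :: (nat \<Rightarrow> real^'k) set). (\<Sum>i | i \<in> {1..n} \<and> \<theta> i \<noteq> 0. f (\<theta> i)) / ennreal d)"
proof (rule SUP_least)
  fix \<theta> :: "nat \<Rightarrow> real^'k" assume \<theta>: "\<theta> \<in> nearly_black n q"
  have "(\<Sum>i\<in>{1..n}. f (\<theta> i)) = (\<Sum>i\<in>{i. i \<in> {1..n} \<and> \<theta> i = 0} \<union> {i. i \<in> {1..n} \<and> \<theta> i \<noteq> 0}. f (\<theta> i))"
    by (rule sum.cong) auto
  also have "\<dots> = (\<Sum>i | i \<in> {1..n} \<and> \<theta> i = 0. f (\<theta> i)) + (\<Sum>i | i \<in> {1..n} \<and> \<theta> i \<noteq> 0. f (\<theta> i))"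
    by (rule sum.union_disjoint) auto
  also have "(\<Sum>i | i \<in> {1..n} \<and> \<theta> i = 0. f (\<theta> i)) = (\<Sum>i | i \<in> {1..n} \<and> \<theta> i = 0. f 0)"
    by (rule sum.cong) auto
  finally have "(\<Sum>i\<in>{1..n}. f (\<theta> i)) / ennreal d =
      (\<Sum>i | i \<in> {1..n} \<and> \<theta> i = 0. f 0) / ennreal d + (\<Sum>i | i \<in> {1..n} \<and> \<theta> i \<noteq> 0. f (\<theta> i)) / ennreal d"
    by (simp add: add_divide_distrib_ennreal)
  also have "\<dots> \<le> (\<Sum>i | i \<in> {1..n} \<and> \<theta> i = 0. f 0) / ennreal d0 + (\<Sum>i | i \<in> {1..n} \<and> \<theta> i \<noteq> 0. f (\<theta> i)) / ennreal d"
    using d by (intro add_right_mono)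
      (auto simp: divide_ennreal_def inverse_ennreal intro!: mult_left_mono ennreal_leI le_imp_inverse_le)
  also have "\<dots> \<le> (SUP \<theta>\<in>(nearly_black n q :: (nat \<Rightarrow> real^'k) set). (\<Sum>i | i \<in> {1..n} \<and> \<theta> i = 0. f 0) / ennreal d0) +
    (SUP \<theta>\<in>(nearly_black n q :: (nat \<Rightarrow> real^'k) set). (\<Sum>i | i \<in> {1..n} \<and> \<theta> i \<noteq> 0. f (\<theta> i)) / ennreal d)"
    by (intro add_mono SUP_upper \<theta>)
  finally show "(\<Sum>i\<in>{1..n}. f (\<theta> i)) / ennreal d \<le> \<dots>" .
qed

text \<open>Evaluates the supremum at the configuration with mean \<open>\<theta>0\<close> in the first \<open>q\<close> coordinates.\<close>

lemma sup_total_ge: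
  fixes f :: "real^'k \<Rightarrow> ennreal" and \<theta>0 :: "real^'k"
  assumes q: "q \<le> n" and \<theta>0: "\<theta>0 \<noteq> 0" and v: "0 \<le> v" "ennreal v \<le> f \<theta>0" and d: "0 < d"
  shows "ennreal (real q * v / d) \<le>
    (SUP \<theta>\<in>(nearly_black n q :: (nat \<Rightarrow> real^'k) set). (\<Sum>i\<in>{1..n}. f (\<theta> i)) / ennreal d)"
proof -
  define \<theta> where "\<theta> = (\<lambda>i. if i \<in> {1..n} then (if i \<le> q then \<theta>0 else 0) else undefined)"
  have "{i \<in> {1..n}. \<theta> i \<noteq> 0} = {1..q}" using q \<theta>0 by (auto simp: \<theta>_def)
  then have nb: "\<theta> \<in> nearly_black n q" by (auto simp: nearly_black_def \<theta>_def)
  have "ennreal (real q * v) = of_nat q * ennreal v"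
    using v(1) by (simp add: ennreal_mult ennreal_of_nat_eq_real_of_nat)
  also have "\<dots> \<le> of_nat (card {1..q}) * f \<theta>0" using v(2) by (simp add: mult_left_mono)
  also have "\<dots> = (\<Sum>i\<in>{1..q}. f (\<theta> i))"
    using q by (simp add: \<theta>_def)
  also have "\<dots> \<le> (\<Sum>i\<in>{1..n}. f (\<theta> i))" using q by (intro sum_mono2) auto
  finally have "ennreal (real q * v) / ennreal d \<le> (\<Sum>i\<in>{1..n}. f (\<theta> i)) / ennreal d"
    by (rule divide_right_mono_ennreal)
  also have "\<dots> \<le> (SUP \<theta>\<in>(nearly_black n q :: (nat \<Rightarrow> real^'k) set). (\<Sum>i\<in>{1..n}. f (\<theta> i)) / ennreal d)"
    by (rule SUP_upper[OF nb])
  finally show ?thesis using d v(1) by (simp add: divide_ennreal)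
qed

text \<open>The value of \<open>a ln (1 / \<tau>)\<close> in terms of \<open>b = ln (n / q)\<close>.\<close>

definition inflated :: "real \<Rightarrow> real" where
  "inflated b = b * (1 + 1 / ln b)"

lemma inflated_ratio: "((\<lambda>b. (c * (2 * inflated b) + C) / (2 * b)) \<longlongrightarrow> c) at_top"
  unfolding inflated_def by real_asymp

text \<open>The factor \<open>exp b\<close> is \<open>n / q\<close>.  It is cancelled by \<open>exp (- inflated b) = exp (- b - b / ln b)\<close> with
\<open>exp (- b / ln b)\<close> to spare, which is the purpose of the vanishing exponent \<open>1 / ln b\<close>.\<close>

lemma zero_part_vanishes:
  assumes "0 < a"
  shows "((\<lambda>b. exp b / b * (C * (8 * b * (exp (- inflated b) * (1 + inflated b / a)) + exp (- 2 * b)))) \<longlongrightarrow> 0) at_top"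
  using assms unfolding inflated_def by real_asymp

lemma limsup_le_one:
  fixes U :: "nat \<Rightarrow> ennreal"
  assumes "\<And>\<delta>. 0 < \<delta> \<Longrightarrow> \<exists>v. (v \<longlonglongrightarrow> 1 + \<delta>) \<and> (\<forall>\<^sub>F n in sequentially. U n \<le> ennreal (v n))"
  shows "limsup U \<le> 1"
proof (rule ennreal_le_epsilon)
  fix \<delta> :: real assume \<delta>: "0 < \<delta>"
  then obtain v where v: "v \<longlonglongrightarrow> 1 + \<delta>" "\<forall>\<^sub>F n in sequentially. U n \<le> ennreal (v n)"
    using assms by blast
  have "limsup U \<le> limsup (\<lambda>n. ennreal (v n))" by (rule Limsup_mono[OF v(2)])
  also have "\<dots> = ennreal (1 + \<delta>)"
    by (rule lim_imp_Limsup) (use v(1) in \<open>auto intro: tendsto_ennrealI\<close>)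
  also have "\<dots> = 1 + ennreal \<delta>" using \<delta> by simp
  finally show "limsup U \<le> 1 + ennreal \<delta>" .
qed

lemma liminf_ge_one:
  fixes U :: "nat \<Rightarrow> ennreal"
  assumes "\<And>\<delta>. 0 < \<delta> \<Longrightarrow> \<delta> < 1 / 2 \<Longrightarrow>
    \<exists>v. (v \<longlonglongrightarrow> (1 - 2 * \<delta>) / (1 + \<delta>)) \<and> (\<forall>\<^sub>F n in sequentially. ennreal (v n) \<le> U n)"
  shows "1 \<le> liminf U"
proof (rule tendsto_upperbound)
  have "((\<lambda>\<delta>::real. (1 - 2 * \<delta>) / (1 + \<delta>)) \<longlongrightarrow> 1) (at_right 0)" by real_asymp
  then show "((\<lambda>\<delta>::real. ennreal ((1 - 2 * \<delta>) / (1 + \<delta>))) \<longlongrightarrow> 1) (at_right 0)"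
    using tendsto_ennrealI by fastforce
  have "\<forall>\<^sub>F \<delta>::real in at_right 0. 0 < \<delta> \<and> \<delta> < 1 / 2"
    using eventually_at_right_real[of 0 "1 / 2"] by (auto elim: eventually_mono)
  then show "\<forall>\<^sub>F \<delta>::real in at_right 0. ennreal ((1 - 2 * \<delta>) / (1 + \<delta>)) \<le> liminf U"
  proof (rule eventually_mono)
    fix \<delta> :: real assume \<delta>: "0 < \<delta> \<and> \<delta> < 1 / 2"
    then obtain v where v: "v \<longlonglongrightarrow> (1 - 2 * \<delta>) / (1 + \<delta>)" "\<forall>\<^sub>F n in sequentially. ennreal (v n) \<le> U n"
      using assms by blast
    have "ennreal ((1 - 2 * \<delta>) / (1 + \<delta>)) = liminf (\<lambda>n. ennreal (v n))"
      by (rule lim_imp_Liminf[symmetric]) (use v(1) in \<open>auto intro: tendsto_ennrealI\<close>)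
    also have "\<dots> \<le> liminf U" by (rule Liminf_mono[OF v(2)])
    finally show "ennreal ((1 - 2 * \<delta>) / (1 + \<delta>)) \<le> liminf U" .
  qed
qed simp

text \<open>The bounds on \<open>l\<close> sandwich the density, and normalisation is the assumption that the prior is a probability.\<close>

lemma power_tail_prior_scale_density:
  assumes S: "positive_definite S"
    and prior: "0 < K" "0 < a" "prob_space (scale_prior K a l)"
    and l: "slowly_varying l"
    and l_upper: "\<And>u. 0 < u \<Longrightarrow> l u \<le> M"
    and l_lower: "0 < m" "0 \<le> u0" "\<And>u. u0 < u \<Longrightarrow> m \<le> l u"
  shows "power_tail_prior S (scale_density K a l) a (K * M) (K * m) u0"
proof
  have lpos: "\<And>u. 0 < u \<Longrightarrow> 0 < l u" and lm: "set_borel_measurable borel {0<..} l"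
    using l by (auto simp: slowly_varying_def)
  show "positive_definite S" by (rule S)
  have "scale_density K a l = (\<lambda>u. K * u powr (- a - 1) * (indicator {0<..} u *\<^sub>R l u))"
    by (auto simp: scale_density_def fun_eq_iff indicator_def)
  moreover have "(\<lambda>u. indicator {0<..} u *\<^sub>R l u) \<in> borel_measurable borel"
    using lm by (simp add: set_borel_measurable_def)
  ultimately show meas: "scale_density K a l \<in> borel_measurable borel" by simp
  show "0 \<le> scale_density K a l u" for u
    using prior lpos[of u] by (auto simp: scale_density_def less_imp_le)
  show "u \<le> 0 \<Longrightarrow> scale_density K a l u = 0" for u by (simp add: scale_density_def)
  show "(\<integral>\<^sup>+u. ennreal (scale_density K a l u) \<partial>lborel) = 1"
    using prob_space.emeasure_space_1[OF prior(3)] meas by (simp add: scale_prior_def emeasure_density)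
  show "0 < a" by (rule prior)
  have "0 < M" using l_upper[of 1] lpos[of 1] by simp
  then show "0 < K * M" using prior by simp
  show "0 < K * m" using prior l_lower by simp
  show "0 \<le> u0" by (rule l_lower)
  show "scale_density K a l u \<le> K * M * u powr (- a - 1)" if "0 < u" for u
  proof -
    have "K * u powr (- a - 1) * l u \<le> K * u powr (- a - 1) * M"
      using prior that l_upper by (intro mult_left_mono) simp_all
    then show ?thesis using that by (simp add: scale_density_def mult_ac)
  qed
  show "K * m * u powr (- a - 1) \<le> scale_density K a l u" if "u0 < u" for u
  proof -
    have "K * u powr (- a - 1) * m \<le> K * u powr (- a - 1) * l u"
      using prior that l_lower(3) by (intro mult_left_mono) simp_all
    then show ?thesis using that l_lower(2) by (simp add: scale_density_def mult_ac)
  qed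
qed

theorem theorem2:
  fixes \<Sigma> :: "real^'k^'k"
    and K a m M u0 :: real
    and l :: "real \<Rightarrow> real"
    and q :: "nat \<Rightarrow> nat"
    and \<tau> :: "nat \<Rightarrow> real"
  defines "est \<equiv> \<lambda>n. posterior_mean \<Sigma> (scale_density K a l) (\<tau> n)"
  assumes Sigma: "positive_definite \<Sigma>" "0 < lambda_min \<Sigma>" "lambda_min \<Sigma> \<le> lambda_max \<Sigma>"
    and prior: "0 < K" "0 < a" "prob_space (scale_prior K a l)"
    and l: "slowly_varying l" "mono_on {0<..} l"
    and l_upper: "\<And>u. 0 < u \<Longrightarrow> l u \<le> M"
    and l_lower: "0 < m" "0 \<le> u0" "\<And>u. u0 < u \<Longrightarrow> m \<le> l u" "u0 = 0 \<or> a \<le> 2"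
    and q: "\<And>n. 0 < q n" "(\<lambda>n. real (q n)) \<in> o(\<lambda>n. real n)"
    and tau: "\<And>n. 0 < \<tau> n" "\<And>n. \<tau> n < 1" "\<tau> \<longlonglongrightarrow> 0"
    and tau_eq: "\<forall>\<^sub>F n in sequentially.
      \<tau> n = (real (q n) / real n) powr ((1 + 1 / ln (ln (real n / real (q n)))) / a)"
  shows
    "((\<lambda>n. SUP \<theta>\<in>(nearly_black n (q n) :: (nat \<Rightarrow> real^'k) set).
        (\<Sum>i | i \<in> {1..n} \<and> \<theta> i = 0. mvn_expect 0 \<Sigma> (\<lambda>x. mahalanobis_sq \<Sigma> (est n x)))
          / ennreal (real (q n) * ln (real n / real (q n)))) \<longlonglongrightarrow> 0)
     \<and> limsup (\<lambda>n. SUP \<theta>\<in>nearly_black n (q n).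
        (\<Sum>i | i \<in> {1..n} \<and> \<theta> i \<noteq> 0.
            mvn_expect (\<theta> i) \<Sigma> (\<lambda>x. mahalanobis_sq \<Sigma> (est n x - \<theta> i)))
          / ennreal (2 * real (q n) * ln (real n / real (q n)))) \<le> 1
     \<and> limsup (\<lambda>n. SUP \<theta>\<in>nearly_black n (q n).
        (\<Sum>i\<in>{1..n}. mvn_expect (\<theta> i) \<Sigma> (\<lambda>x. mahalanobis_sq \<Sigma> (est n x - \<theta> i)))
          / ennreal (2 * real (q n) * ln (real n / real (q n)))) \<le> 1
     \<and> ((\<lambda>n. SUP \<theta>\<in>nearly_black n (q n).
        (\<Sum>i\<in>{1..n}. mvn_expect (\<theta> i) \<Sigma> (\<lambda>x. mahalanobis_sq \<Sigma> (est n x - \<theta> i)))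
          / ennreal (2 * real (q n) * ln (real n / real (q n)))) \<longlonglongrightarrow> 1)"
proof -
  interpret power_tail_prior \<Sigma> "scale_density K a l" a "K * M" "K * m" u0
    by (rule power_tail_prior_scale_density) fact+
  have a2: "a \<le> 2" using l_lower(4) u0_pos by simp
  define b where "b = (\<lambda>n. ln (real n / real (q n)))"
  define f where "f = (\<lambda>n (\<theta>::real^'k). mvn_expect \<theta> \<Sigma> (\<lambda>x. mahalanobis_sq \<Sigma> (est n x - \<theta>)))"
  define U1 where "U1 = (\<lambda>n. SUP \<theta>\<in>(nearly_black n (q n) :: (nat \<Rightarrow> real^'k) set).
        (\<Sum>i | i \<in> {1..n} \<and> \<theta> i = 0. f n 0) / ennreal (real (q n) * b n))"
  define U2 where "U2 = (\<lambda>n. SUP \<theta>\<in>(nearly_black n (q n) :: (nat \<Rightarrow> real^'k) set).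
        (\<Sum>i | i \<in> {1..n} \<and> \<theta> i \<noteq> 0. f n (\<theta> i)) / ennreal (2 * real (q n) * b n))"
  define U3 where "U3 = (\<lambda>n. SUP \<theta>\<in>(nearly_black n (q n) :: (nat \<Rightarrow> real^'k) set).
        (\<Sum>i\<in>{1..n}. f n (\<theta> i)) / ennreal (2 * real (q n) * b n))"
  have qn: "0 < real (q n)" for n using q(1) by simp
  have "((\<lambda>n. real (q n) / real n) \<longlonglongrightarrow> 0)" by (rule smalloD_tendsto[OF q(2)])
  moreover have "\<forall>\<^sub>F n in sequentially. 0 < real (q n) / real n"
    using eventually_gt_at_top[of 0] by eventually_elim (simp add: q(1))
  ultimately have "filterlim (\<lambda>n. inverse (real (q n) / real n)) at_top sequentially"
    by (rule filterlim_inverse_at_top)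
  then have "filterlim (\<lambda>n. real n / real (q n)) at_top sequentially" by (simp add: field_simps)
  then have b_top: "filterlim b at_top sequentially"
    unfolding b_def by (rule filterlim_compose[OF ln_at_top])
  have regular: "\<forall>\<^sub>F n in sequentially. 1 < b n \<and> 0 < n \<and> q n \<le> n \<and> real n / real (q n) = exp (b n) \<and>
      a * ln (1 / \<tau> n) = inflated (b n)"
    using eventually_gt_at_top[of 0] filterlim_at_top_dense[THEN iffD1, OF b_top, rule_format, of 1] tau_eq
  proof eventually_elim
    case (elim n)
    define L where "L = real n / real (q n)"
    have L: "0 < L" using elim q(1) by (simp add: L_def)
    have bL: "b n = ln L" by (simp add: b_def L_def)
    have "ln 1 < ln L" using elim bL by simp
    then have "1 < L" using L by (subst (asm) ln_less_cancel_iff) simp_all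
    then have "q n \<le> n" using q(1)[of n] by (simp add: L_def field_simps)
    moreover have "real (q n) / real n = 1 / L" by (simp add: L_def)
    then have "\<tau> n = (1 / L) powr ((1 + 1 / ln (b n)) / a)"
      using elim by (simp add: b_def)
    then have "ln (\<tau> n) = (1 + 1 / ln (b n)) / a * ln (1 / L)"
      using L by (simp add: ln_powr)
    then have "a * ln (1 / \<tau> n) = inflated (b n)"
      using L prior(2) tau(1)[of n] by (simp add: ln_div bL inflated_def mult.commute)
    ultimately show ?case using elim L by (simp add: bL L_def)
  qed
  obtain C1 where C1: "0 \<le> C1" "\<And>t b. 0 < t \<Longrightarrow> t < 1 \<Longrightarrow> 0 < b \<Longrightarrow>
      mvn_expect 0 \<Sigma> (\<lambda>x. mahalanobis_sq \<Sigma> (posterior_mean \<Sigma> (scale_density K a l) t x)) \<le>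
      ennreal (C1 * (b * (t powr a * (1 + ln (1 / t))) + exp (- b / 4)))"
    using risk_at_zero[OF a2] by blast
  \<comment> \<open>The truncation level is \<open>8 b\<close>, so that the Gaussian tail \<open>exp (- 8 b / 4)\<close> outweighs \<open>n / q = exp b\<close>.\<close>
  define r where "r = (\<lambda>b. exp b / b * (C1 * (8 * b * (exp (- inflated b) * (1 + inflated b / a)) + exp (- 2 * b))))"
  have r_lim: "(\<lambda>n. r (b n)) \<longlonglongrightarrow> 0"
    unfolding r_def by (rule filterlim_compose[OF zero_part_vanishes[OF prior(2)] b_top])
  have U1_le: "\<forall>\<^sub>F n in sequentially. U1 n \<le> ennreal (r (b n))"
    using regular
  proof eventually_elim
    case (elim n)
    then have b: "1 < b n" and n: "0 < n" "q n \<le> n" and L: "real n / real (q n) = exp (b n)"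
      and ln: "a * ln (1 / \<tau> n) = inflated (b n)" by auto
    define V where "V = C1 * (8 * b n * (exp (- inflated (b n)) * (1 + inflated (b n) / a)) + exp (- 2 * b n))"
    have lnt: "ln (1 / \<tau> n) = inflated (b n) / a" using ln prior(2) by (simp add: field_simps)
    have "\<tau> n powr a = exp (- inflated (b n))"
      unfolding ln[symmetric] using tau(1)[of n] by (simp add: powr_def ln_div)
    then have fV: "f n 0 \<le> ennreal V"
      using C1(2)[OF tau(1,2), of "8 * b n" n] b lnt by (simp add: f_def est_def V_def)
    have "0 \<le> inflated (b n)" using b by (simp add: inflated_def)
    then have V: "0 \<le> V" using b C1(1) prior(2) by (simp add: V_def)
    have "U1 n \<le> ennreal (real n * V / (real (q n) * b n))"
      unfolding U1_def using qn[of n] b by (intro sup_zero_le fV V) simp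
    also have "real n * V / (real (q n) * b n) = (real n / real (q n)) / b n * V" by simp
    also have "\<dots> = r (b n)" unfolding L by (simp add: r_def V_def)
    finally show ?case .
  qed
  have upper: "\<exists>v. (v \<longlonglongrightarrow> 1 + \<delta>) \<and> (\<forall>\<^sub>F n in sequentially. U2 n \<le> ennreal (v n) \<and> 0 \<le> v n)"
    if \<delta>: "0 < \<delta>" for \<delta>
  proof -
    obtain C t1 where C: "0 \<le> C" "0 < t1" "\<And>t \<theta>. 0 < t \<Longrightarrow> t < t1 \<Longrightarrow>
      mvn_expect \<theta> \<Sigma> (\<lambda>x. mahalanobis_sq \<Sigma> (posterior_mean \<Sigma> (scale_density K a l) t x - \<theta>)) \<le>
      ennreal ((1 + \<delta>) * (2 * (a * ln (1 / t))) + C)"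
      using risk_upper_bound[OF \<delta>] by blast
    define v where "v = (\<lambda>b. ((1 + \<delta>) * (2 * inflated b) + C) / (2 * b))"
    have v: "(\<lambda>n. v (b n)) \<longlonglongrightarrow> 1 + \<delta>"
      unfolding v_def by (rule filterlim_compose[OF inflated_ratio b_top])
    have "\<forall>\<^sub>F n in sequentially. \<tau> n < t1" using tau(3) C(2) by (rule order_tendstoD(2))
    with regular have "\<forall>\<^sub>F n in sequentially. U2 n \<le> ennreal (v (b n)) \<and> 0 \<le> v (b n)"
    proof eventually_elim
      case (elim n)
      then have b: "1 < b n" and ln: "a * ln (1 / \<tau> n) = inflated (b n)" by auto
      define V where "V = (1 + \<delta>) * (2 * inflated (b n)) + C"
      have "0 \<le> inflated (b n)" using b by (simp add: inflated_def)
      then have V: "0 \<le> V" using \<delta> C(1) by (simp add: V_def)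
      have fV: "f n \<theta> \<le> ennreal V" for \<theta>
        using C(3)[OF tau(1) elim(2), of \<theta>] by (simp add: f_def est_def V_def ln)
      have "U2 n \<le> ennreal (real (q n) * V / (2 * real (q n) * b n))"
        unfolding U2_def using qn[of n] b by (intro sup_nonzero_le fV V) simp
      also have "real (q n) * V / (2 * real (q n) * b n) = v (b n)"
        using qn[of n] by (simp add: v_def V_def)
      finally show ?case using V b by (simp add: v_def V_def)
    qed
    then show ?thesis using v by blast
  qed
  have U2: "limsup U2 \<le> 1"
  proof (rule limsup_le_one)
    fix \<delta> :: real assume "0 < \<delta>"
    then obtain v where v: "v \<longlonglongrightarrow> 1 + \<delta>" "\<forall>\<^sub>F n in sequentially. U2 n \<le> ennreal (v n) \<and> 0 \<le> v n"
      using upper by blast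
    have "\<forall>\<^sub>F n in sequentially. U2 n \<le> ennreal (v n)"
      using v(2) by (rule eventually_mono) simp
    then show "\<exists>v. (v \<longlonglongrightarrow> 1 + \<delta>) \<and> (\<forall>\<^sub>F n in sequentially. U2 n \<le> ennreal (v n))"
      using v(1) by blast
  qed
  have U3: "limsup U3 \<le> 1"
  proof (rule limsup_le_one)
    fix \<delta> :: real assume "0 < \<delta>"
    then obtain v where v: "v \<longlonglongrightarrow> 1 + \<delta>" "\<forall>\<^sub>F n in sequentially. U2 n \<le> ennreal (v n) \<and> 0 \<le> v n"
      using upper by blast
    have "(\<lambda>n. r (b n) + v n) \<longlonglongrightarrow> 0 + (1 + \<delta>)" by (intro tendsto_add r_lim v)
    moreover have "\<forall>\<^sub>F n in sequentially. U3 n \<le> ennreal (r (b n) + v n)"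
      using U1_le v(2) regular
    proof eventually_elim
      case (elim n)
      have b: "1 < b n" using elim by simp
      have "0 \<le> inflated (b n)" using b by (simp add: inflated_def)
      then have r0: "0 \<le> r (b n)" using b C1(1) prior(2) by (simp add: r_def)
      have "U3 n \<le> U1 n + U2 n"
        unfolding U1_def U2_def U3_def using qn[of n] b by (intro sup_total_le) simp_all
      also have "\<dots> \<le> ennreal (r (b n)) + ennreal (v n)" using elim by (intro add_mono) simp_all
      also have "\<dots> = ennreal (r (b n) + v n)" using r0 elim by simp
      finally show ?case .
    qed
    ultimately show "\<exists>v. (v \<longlonglongrightarrow> 1 + \<delta>) \<and> (\<forall>\<^sub>F n in sequentially. U3 n \<le> ennreal (v n))" by auto
  qed
  have U3': "1 \<le> liminf U3"
  proof (rule liminf_ge_one)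
    fix \<delta> :: real assume \<delta>: "0 < \<delta>" "\<delta> < 1 / 2"
    then obtain C t1 where C: "0 \<le> C" "0 < t1" "\<And>t. 0 < t \<Longrightarrow> t < t1 \<Longrightarrow> \<exists>\<theta>. \<theta> \<noteq> 0 \<and>
      ennreal ((1 - 2 * \<delta>) * (2 * (a * ln (1 / t)))) \<le> ennreal (1 + \<delta>) *
        mvn_expect \<theta> \<Sigma> (\<lambda>x. mahalanobis_sq \<Sigma> (posterior_mean \<Sigma> (scale_density K a l) t x - \<theta>)) + ennreal C"
      using risk_lower_bound[of \<delta>] by auto
    define v where "v = (\<lambda>b. ((1 - 2 * \<delta>) * (2 * inflated b) + (- C)) / (2 * b))"
    have v_lim: "(\<lambda>n. v (b n)) \<longlonglongrightarrow> 1 - 2 * \<delta>"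
      unfolding v_def by (rule filterlim_compose[OF inflated_ratio b_top])
    then have v: "(\<lambda>n. v (b n) / (1 + \<delta>)) \<longlonglongrightarrow> (1 - 2 * \<delta>) / (1 + \<delta>)"
      using \<delta> by (intro tendsto_divide) simp_all
    have vpos: "\<forall>\<^sub>F n in sequentially. 0 < v (b n)"
      by (rule order_tendstoD(1)[OF v_lim]) (use \<delta> in simp)
    have "\<forall>\<^sub>F n in sequentially. \<tau> n < t1" using tau(3) C(2) by (rule order_tendstoD(2))
    with regular vpos have "\<forall>\<^sub>F n in sequentially. ennreal (v (b n) / (1 + \<delta>)) \<le> U3 n"
    proof eventually_elim
      case (elim n)
      then have b: "1 < b n" and ln: "a * ln (1 / \<tau> n) = inflated (b n)" and qle: "q n \<le> n" by auto
      define V where "V = ((1 - 2 * \<delta>) * (2 * inflated (b n)) - C) / (1 + \<delta>)"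
      have vV: "v (b n) = V * (1 + \<delta>) / (2 * b n)" using \<delta> by (simp add: v_def V_def)
      then have V: "0 \<le> V" using elim(2) b \<delta> by (simp add: zero_less_divide_iff zero_less_mult_iff)
      obtain \<theta> where \<theta>: "\<theta> \<noteq> 0" "ennreal ((1 - 2 * \<delta>) * (2 * inflated (b n))) \<le> ennreal (1 + \<delta>) * f n \<theta> + ennreal C"
        using C(3)[OF tau(1) elim(3)] unfolding ln f_def est_def by blast
      have fV: "ennreal V \<le> f n \<theta>"
      proof (cases "f n \<theta>")
        case (real e)
        have "ennreal ((1 - 2 * \<delta>) * (2 * inflated (b n))) \<le> ennreal ((1 + \<delta>) * e + C)"
          using \<theta>(2) real \<delta> C(1) by (simp add: ennreal_mult)
        then have "(1 - 2 * \<delta>) * (2 * inflated (b n)) \<le> (1 + \<delta>) * e + C"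
          using real \<delta> C(1) by (subst (asm) ennreal_le_iff) simp_all
        then have "V \<le> e" using \<delta> by (simp add: V_def divide_le_eq mult.commute)
        then show ?thesis using real by (simp add: ennreal_leI)
      qed simp
      have "ennreal (real (q n) * V / (2 * real (q n) * b n)) \<le> U3 n"
        unfolding U3_def using qn[of n] b by (intro sup_total_ge[where f = "f n", OF qle \<theta>(1) V fV]) simp
      also have "real (q n) * V / (2 * real (q n) * b n) = v (b n) / (1 + \<delta>)"
        using qn[of n] \<delta> by (simp add: vV)
      finally show ?case .
    qed
    then show "\<exists>v. (v \<longlonglongrightarrow> (1 - 2 * \<delta>) / (1 + \<delta>)) \<and> (\<forall>\<^sub>F n in sequentially. ennreal (v n) \<le> U3 n)"
      using v by blast
  qed
  have U1: "U1 \<longlonglongrightarrow> 0"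
  proof (rule tendsto_sandwich[of "\<lambda>_. 0"])
    show "(\<lambda>n. ennreal (r (b n))) \<longlonglongrightarrow> 0" using tendsto_ennrealI[OF r_lim] by simp
  qed (use U1_le in simp_all)
  have U3_lim: "U3 \<longlonglongrightarrow> 1"
  proof (rule Liminf_eq_Limsup)
    have "liminf U3 \<le> limsup U3" by (rule Liminf_le_Limsup) simp
    then show "liminf U3 = 1" "limsup U3 = 1" using U3 U3' by auto
  qed simp
  show ?thesis
    using U1 U2 U3 U3_lim unfolding U1_def U2_def U3_def f_def b_def by simp
qed

end
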